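(* Let $1\le m'\le m\le r$ and $1\le d<r$ be integers, let $n=(m-1)r+d$, $k=(m'-1)r+d$, let $u=(s_1s_2\cdots s_r)^{m-1}s_1\cdots s_d$ and let $\mathbf i=(1,\dots,r,\,\dots,\,1,\dots,r,\,1,\dots,d)$ ($m-1$ full cycles followed by $1,\dots,d$) be its reduced word, so $i_k=i_n=d$. Let $\mathbf Y=(Y_{1,1},\dots,Y_{1,r},\dots,Y_{m-1,1},\dots,Y_{m-1,r},Y_{m,1},\dots,Y_{m,d})\in(\mathbb C^\times)^n$. Then $$\Delta^L(k;\mathbf i)(\mathbf Y)=\sum_{p\in X_d(m,m')}Q(p),$$ where $X_d(m,m')$ is the set of paths and $Q(p)$ the label of a path as defined in the context.
   Context: Let $G$ be the simply connected simple algebraic group over $\mathbb C$ of type $\mathrm B_r$, $B,B_-$ opposite Borel subgroups, $N\subset B$, $N_-\subset B_-$ their unipotent radicals, $H=B\cap B_-$, $W=\mathrm{Norm}_G(H)/H$ the Weyl group with simple reflections $s_1,\dots,s_r$. Chevalley generators $e_i,f_i$ and simple coroots $h_i$ of $\mathrm{Lie}(G)$ are taken for the Cartan matrix $a_{ij}=\alpha_j(h_i)$ with $a_{ii}=2$, $a_{ij}=-1$ if $|i-j|=1$ and $(i,j)\ne(r,r-1)$, $a_{r,r-1}=-2$, and $a_{ij}=0$ otherwise. $\Lambda_i$ is the $i$-th fundamental weight. Put $x_i(t)=\exp(te_i)$, $y_i(t)=\exp(tf_i)$, $\alpha_i^\vee(t)=t^{h_i}$, $x_{-i}(t)=y_i(t)\alpha_i^\vee(t^{-1})$,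 $\overline{s_i}=x_i(-1)y_i(1)x_i(-1)$; for a reduced expression $w=s_{j_1}\cdots s_{j_p}$ put $\overline w=\overline{s_{j_1}}\cdots\overline{s_{j_p}}$. For $x\in G_0=N_-HN$ write $x=[x]_-[x]_0[x]_+$ accordingly; $\Delta_{w\Lambda_i,\Lambda_i}$ is the regular function on $G$ whose restriction to $\overline wG_0$ is $x\mapsto([\overline w^{-1}x]_0)^{\Lambda_i}$. For a reduced word $\mathbf i=(i_1,\dots,i_n)$ put $u_{\le k}=s_{i_1}\cdots s_{i_k}$, $\Delta(k;\mathbf i)=\Delta_{u_{\le k}\Lambda_{i_k},\Lambda_{i_k}}$, $x^L_{\mathbf i}(t_1,\dots,t_n)=x_{-i_1}(t_1)\cdots x_{-i_n}(t_n)$, and $\Delta^L(k;\mathbf i)(\mathbf Y)=\Delta(k;\mathbf i)(x^L_{\mathbf i}(\mathbf Y))$ (entries of $\mathbf Y$ inserted in the listed order). Paths. Let $J=\{1,\dots,r,0,\overline r,\dots,\overline 1\}$ with total order $1<2<\cdots<r<0<\overline r<\cdots<\overline 1$, and $|j|=|\overline j|=j$. An element $p\in X_d(m,m')$ is a directed path $$p=\mathrm{vt}(m;a^{(0)})\to\mathrm{vt}(m-1;a^{(1)})\to\cdots\to\mathrm{vt}(0;a^{(m)}),\qquad a^{(s)}=(a^{(s)}_1,\dots,a^{(s)}_d)\in J^d,$$ such that for all relevant $s,\zeta$: (i) $a^{(s)}_\zeta\in J$; (ii) $a^{(s)}_1<a^{(s)}_2<\cdots<a^{(s)}_d$; (iii)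 if $a^{(s)}_\zeta\in\{1,\dots,r-1\}$ then $a^{(s+1)}_\zeta\in\{a^{(s)}_\zeta,a^{(s)}_\zeta+1\}$; if $a^{(s)}_\zeta\in\{r,0,\overline r,\dots,\overline1\}$ then $a^{(s)}_\zeta\le a^{(s+1)}_\zeta\le\overline1$; (iv) $a^{(0)}=(1,2,\dots,d)$, and $a^{(m)}=(m'+1,m'+2,\dots,r,\overline{d-r+m'},\dots,\overline2,\overline1)$ if $m'+d>r$, while $a^{(m)}=(m'+1,\dots,m'+d)$ if $m'+d\le r$; (v) if $a^{(s+1)}_\zeta\in\{0,\overline r,\dots,\overline1\}$ (with $\zeta\le d-1$) then $a^{(s+1)}_\zeta\le a^{(s)}_{\zeta+1}$, and $a^{(s+1)}_\zeta=a^{(s)}_{\zeta+1}$ if and only if $a^{(s+1)}_\zeta=a^{(s)}_{\zeta+1}=0$. Labels. With the convention $Y_{s,0}=1$, for $0\le s\le m-1$ put: for $1\le i\le r-1$: $Q^{(s)}(i\to i)=\frac{Y_{m-s,i-1}}{Y_{m-s,i}}$, $Q^{(s)}(i\to i+1)=1$; $Q^{(s)}(r\to r)=\frac{Y_{m-s,r-1}}{Y_{m-s,r}^2}$, $Q^{(s)}(r\to0)=\frac1{Y_{m-s,r}}$, $Q^{(s)}(r\to j)=\frac1{Y_{m-s,|j|-1}}$ for $j\in\{\overline r,\dots,\overline1\}$; $Q^{(s)}(0\to0)=1$, $Q^{(s)}(0\to j)=\frac{2Y_{m-s,r}}{Y_{m-s,|j|-1}}$ for $j\in\{\overline r,\dots,\overline1\}$;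 $Q^{(s)}(\overline r\to j)=\frac{Y_{m-s,r}^2}{Y_{m-s,|j|-1}}$ for $j\in\{\overline r,\dots,\overline1\}$; $Q^{(s)}(i\to j)=\frac{Y_{m-s,|i|}}{Y_{m-s,|j|-1}}$ for $\overline{r-1}\le i\le j\le\overline1$. The label of the edge $\mathrm{vt}(m-s;a^{(s)})\to\mathrm{vt}(m-s-1;a^{(s+1)})$ of $p$ is $Q^{(s)}(p)=c^{(s)}\prod_{\zeta=1}^dQ^{(s)}(a^{(s)}_\zeta\to a^{(s+1)}_\zeta)$, where $c^{(s)}=\frac12$ if there is some $\zeta$ with $a^{(s+1)}_\zeta=a^{(s)}_{\zeta+1}=0$ and $c^{(s)}=1$ otherwise. The label of $p$ is $Q(p)=\prod_{s=0}^{m-1}Q^{(s)}(p)$. *)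

theory Defs
  imports
    "HOL-Analysis.Complex_Transcendental"
    "HOL-Algebra.Generated_Groups"
    "Jordan_Normal_Form.Determinant"
begin

section \<open>The simply connected group of type $B_r$\<close>

text \<open>
  The group is taken as $\mathrm{Spin}_{2r+1}(\mathbb C)$, in its faithful spin representation on
  the Fock space with $r$ fermionic modes, which has dimension $2^r$. The basis vector with number
  $S < 2^r$ is the state in which exactly the modes $i$ with \<open>bit S (i - 1)\<close> are occupied
  ($1 \le i \le r$), so that mode $i$ contributes $\pm\frac12\varepsilon_i$ to the weight. All
  Chevalley generators below are with respect to the Cartan matrix $a_{ij} = \alpha_j(h_i)$ with
  $a_{r,r-1} = -2$, $a_{r-1,r} = -1$: the simple roots are
  $\alpha_i = \varepsilon_i - \varepsilon_{i+1}$ for $i < r$ and $\alpha_r = \varepsilon_r$.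
  The weights of this representation span the whole weight lattice, which is why the group
  generated by the root subgroups is the simply connected one.
\<close>

definition creation :: "nat \<Rightarrow> nat \<Rightarrow> complex mat" where
  "creation r i = mat (2^r) (2^r) (\<lambda>(S', S).
     if \<not> bit S (i - 1) \<and> S' = S + 2^(i - 1) then (-1) ^ card {j. j < i - 1 \<and> bit S j} else 0)"

definition annihilation :: "nat \<Rightarrow> nat \<Rightarrow> complex mat" where
  "annihilation r i = transpose_mat (creation r i)"

definition chev_e :: "nat \<Rightarrow> nat \<Rightarrow> complex mat" where
  "chev_e r i = (if i = r then creation r r else creation r i * annihilation r (i + 1))"

definition chev_f :: "nat \<Rightarrow> nat \<Rightarrow> complex mat" where
  "chev_f r i = (if i = r then annihilation r r else creation r (i + 1) * annihilation r i)"

definition chev_h :: "nat \<Rightarrow> nat \<Rightarrow> complex mat" where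
  "chev_h r i = chev_e r i * chev_f r i - chev_f r i * chev_e r i"

definition mat_exp :: "complex mat \<Rightarrow> complex mat" where
  "mat_exp A = mat (dim_row A) (dim_row A) (\<lambda>(i, j). \<Sum>k. (A ^\<^sub>m k) $$ (i, j) / fact k)"

definition x_pos :: "nat \<Rightarrow> nat \<Rightarrow> complex \<Rightarrow> complex mat" where
  "x_pos r i t = mat_exp (t \<cdot>\<^sub>m chev_e r i)"

definition y_neg :: "nat \<Rightarrow> nat \<Rightarrow> complex \<Rightarrow> complex mat" where
  "y_neg r i t = mat_exp (t \<cdot>\<^sub>m chev_f r i)"

text \<open>
  $\alpha_i^\vee(t) = t^{h_i}$ for $t \neq 0$. The choice of the branch of the logarithm is
  irrelevant, because $h_i$ is diagonal with integer entries.
\<close>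

definition coroot :: "nat \<Rightarrow> nat \<Rightarrow> complex \<Rightarrow> complex mat" where
  "coroot r i t = mat_exp (Ln t \<cdot>\<^sub>m chev_h r i)"

definition GL :: "nat \<Rightarrow> complex mat monoid" where
  "GL n = units_of (ring_mat TYPE(complex) n ())"

definition grp_G :: "nat \<Rightarrow> complex mat set" where
  "grp_G r = generate (GL (2^r)) (\<Union>i\<in>{1..r}. range (x_pos r i) \<union> range (y_neg r i))"

text \<open>
  In characteristic 0 the unipotent radicals $N$ and $N_-$ are generated by the root subgroups of
  the simple roots and their negatives, and the maximal torus $H$ by the simple coroots.
\<close>

definition grp_N :: "nat \<Rightarrow> complex mat set" where
  "grp_N r = generate (GL (2^r)) (\<Union>i\<in>{1..r}. range (x_pos r i))"

definition grp_N_minus :: "nat \<Rightarrow> complex mat set" where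
  "grp_N_minus r = generate (GL (2^r)) (\<Union>i\<in>{1..r}. range (y_neg r i))"

definition grp_H :: "nat \<Rightarrow> complex mat set" where
  "grp_H r = generate (GL (2^r)) (\<Union>i\<in>{1..r}. coroot r i ` (- {0}))"

definition grp_G0 :: "nat \<Rightarrow> complex mat set" where
  "grp_G0 r = {a * h * b | a h b. a \<in> grp_N_minus r \<and> h \<in> grp_H r \<and> b \<in> grp_N r}"

text \<open>The component $[x]_0$ of $x = [x]_-[x]_0[x]_+ \in G_0 = N_- H N$.\<close>

definition torus_part :: "nat \<Rightarrow> complex mat \<Rightarrow> complex mat" where
  "torus_part r x =
     (THE h. h \<in> grp_H r \<and> (\<exists>a\<in>grp_N_minus r. \<exists>b\<in>grp_N r. x = a * h * b))"

definition mat_prod :: "nat \<Rightarrow> complex mat list \<Rightarrow> complex mat" where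
  "mat_prod n gs = foldr (*) gs (1\<^sub>m n)"

text \<open>
  The character $h \mapsto h^{\Lambda_i}$ of $H$. As $G$ is simply connected,
  $(t_1, \dots, t_r) \mapsto \prod_j \alpha_j^\vee(t_j)$ is an isomorphism from
  $(\mathbb C^\times)^r$ onto $H$, and $\Lambda_i(h_j) = \delta_{ij}$ makes $\Lambda_i$ the $i$-th
  coordinate.
\<close>

definition fund_weight :: "nat \<Rightarrow> nat \<Rightarrow> complex mat \<Rightarrow> complex" where
  "fund_weight r i h = (THE c. \<exists>t. (\<forall>j\<in>{1..r}. t j \<noteq> 0) \<and>
     h = mat_prod (2^r) (map (\<lambda>j. coroot r j (t j)) [1..<Suc r]) \<and> c = t i)"


section \<open>Generalized minors\<close>

text \<open>
  The algebra of regular functions on $\mathrm{GL}_n(\mathbb C)$: it is generated by the matrix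
  entries and the inverse of the determinant. Regular functions on a closed subgroup are the
  restrictions of these.
\<close>

inductive_set coord_ring :: "nat \<Rightarrow> (complex mat \<Rightarrow> complex) set" for n :: nat where
  const: "(\<lambda>_. c) \<in> coord_ring n"
| entry: "i < n \<Longrightarrow> j < n \<Longrightarrow> (\<lambda>g. g $$ (i, j)) \<in> coord_ring n"
| inv_det: "(\<lambda>g. inverse (det g)) \<in> coord_ring n"
| add: "p \<in> coord_ring n \<Longrightarrow> q \<in> coord_ring n \<Longrightarrow> (\<lambda>g. p g + q g) \<in> coord_ring n"
| mult: "p \<in> coord_ring n \<Longrightarrow> q \<in> coord_ring n \<Longrightarrow> (\<lambda>g. p g * q g) \<in> coord_ring n"

definition regular_on :: "nat \<Rightarrow> complex mat set \<Rightarrow> (complex mat \<Rightarrow> complex) \<Rightarrow> bool" where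
  "regular_on n X F \<longleftrightarrow> (\<exists>p\<in>coord_ring n. \<forall>g\<in>X. F g = p g)"

definition s_bar :: "nat \<Rightarrow> nat \<Rightarrow> complex mat" where
  "s_bar r i = x_pos r i (-1) * y_neg r i 1 * x_pos r i (-1)"

text \<open>$\overline{w} = \overline{s_{j_1}} \cdots \overline{s_{j_p}}$ for a reduced expression
  $w = s_{j_1} \cdots s_{j_p}$, which is passed as the list $[j_1, \dots, j_p]$.\<close>

definition w_bar :: "nat \<Rightarrow> nat list \<Rightarrow> complex mat" where
  "w_bar r js = mat_prod (2^r) (map (s_bar r) js)"

text \<open>
  $\Delta_{w\Lambda_i,\Lambda_i}$ for $w$ given by a reduced word \<open>js\<close>: the regular function on
  $G$ with the prescribed restriction to $\overline{w} G_0$. It is unique as a function on $G$;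
  extensionality only fixes a default value outside $G$.
\<close>

definition gen_minor :: "nat \<Rightarrow> nat list \<Rightarrow> nat \<Rightarrow> complex mat \<Rightarrow> complex" where
  "gen_minor r js i = (THE F. F \<in> extensional (grp_G r) \<and> regular_on (2^r) (grp_G r) F \<and>
     (\<forall>x \<in> (\<lambda>g. w_bar r js * g) ` grp_G0 r.
        F x = fund_weight r i (torus_part r (inv\<^bsub>GL (2^r)\<^esub> (w_bar r js) * x))))"

text \<open>$\Delta(k;\mathbf i) = \Delta_{u_{\le k}\Lambda_{i_k},\Lambda_{i_k}}$; positions $k$ in the word
  \<open>ws\<close> $= \mathbf i$ are counted from 1, and \<open>take k ws\<close> is the reduced word of
  $u_{\le k}$.\<close>

definition Delta :: "nat \<Rightarrow> nat \<Rightarrow> nat list \<Rightarrow> complex mat \<Rightarrow> complex" where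
  "Delta r k ws = gen_minor r (take k ws) (ws ! (k - 1))"

definition x_minus :: "nat \<Rightarrow> nat \<Rightarrow> complex \<Rightarrow> complex mat" where
  "x_minus r i t = y_neg r i t * coroot r i (inverse t)"

definition xL :: "nat \<Rightarrow> nat list \<Rightarrow> complex list \<Rightarrow> complex mat" where
  "xL r ws ts = mat_prod (2^r) (map2 (x_minus r) ws ts)"

definition DeltaL :: "nat \<Rightarrow> nat \<Rightarrow> nat list \<Rightarrow> complex list \<Rightarrow> complex" where
  "DeltaL r k ws ts = Delta r k ws (xL r ws ts)"

definition word_i :: "nat \<Rightarrow> nat \<Rightarrow> nat \<Rightarrow> nat list" where
  "word_i r m d = concat (replicate (m - 1) [1..<Suc r]) @ [1..<Suc d]"

definition coord_list :: "nat \<Rightarrow> nat \<Rightarrow> nat \<Rightarrow> (nat \<Rightarrow> nat \<Rightarrow> complex) \<Rightarrow> complex list" where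
  "coord_list r m d Y =
     concat (map (\<lambda>s. map (Y s) [1..<Suc r]) [1..<m]) @ map (Y m) [1..<Suc d]"


section \<open>Paths and their labels\<close>

text \<open>\<open>Plain i\<close>, \<open>Nul\<close>, \<open>Bar i\<close> stand for $i$, $0$, $\overline i$, ordered by
  $1 < 2 < \cdots < 0 < \cdots < \overline 2 < \overline 1$.\<close>

datatype letter = Plain nat | Nul | Bar nat

instantiation letter :: linorder
begin

fun less_eq_letter :: "letter \<Rightarrow> letter \<Rightarrow> bool" where
  "less_eq_letter (Plain i) (Plain j) = (i \<le> j)"
| "less_eq_letter (Plain i) Nul = True"
| "less_eq_letter (Plain i) (Bar j) = True"
| "less_eq_letter Nul (Plain j) = False"
| "less_eq_letter Nul Nul = True"
| "less_eq_letter Nul (Bar j) = True"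
| "less_eq_letter (Bar i) (Plain j) = False"
| "less_eq_letter (Bar i) Nul = False"
| "less_eq_letter (Bar i) (Bar j) = (j \<le> i)"

definition less_letter :: "letter \<Rightarrow> letter \<Rightarrow> bool" where
  "less_letter a b \<longleftrightarrow> a \<le> b \<and> \<not> b \<le> a"

instance
proof
  fix a b c :: letter
  show "a < b \<longleftrightarrow> a \<le> b \<and> \<not> b \<le> a" by (rule less_letter_def)
  show "a \<le> a" by (cases a) auto
  show "a \<le> c" if "a \<le> b" "b \<le> c" using that by (cases a; cases b; cases c) auto
  show "a = b" if "a \<le> b" "b \<le> a" using that by (cases a; cases b) auto
  show "a \<le> b \<or> b \<le> a" by (cases a; cases b) auto
qed

end

definition letters :: "nat \<Rightarrow> letter set" where
  "letters r = Plain ` {1..r} \<union> {Nul} \<union> Bar ` {1..r}"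

definition admissible_step :: "nat \<Rightarrow> letter \<Rightarrow> letter \<Rightarrow> bool" where
  "admissible_step r a b \<longleftrightarrow>
     (if a \<in> Plain ` {1..<r} then b = a \<or> (\<exists>i. a = Plain i \<and> b = Plain (i + 1))
      else a \<le> b \<and> b \<le> Bar 1)"

definition start_tuple :: "nat \<Rightarrow> letter list" where
  "start_tuple d = map Plain [1..<Suc d]"

definition end_tuple :: "nat \<Rightarrow> nat \<Rightarrow> nat \<Rightarrow> letter list" where
  "end_tuple r d m' =
     (if m' + d > r
      then map Plain [m' + 1..<Suc r] @ map Bar (rev [1..<Suc (m' + d - r)])
      else map Plain [m' + 1..<Suc (m' + d)])"

text \<open>
  A path is the list $[a^{(0)}, \dots, a^{(m)}]$, so \<open>p ! s ! z\<close> is $a^{(s)}_{z+1}$; the first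
  component $m - s$ of the vertex $\mathrm{vt}(m - s; a^{(s)})$ is determined by the position $s$.
\<close>

definition paths :: "nat \<Rightarrow> nat \<Rightarrow> nat \<Rightarrow> nat \<Rightarrow> letter list list set" where
  "paths r d m m' = {p. length p = m + 1 \<and>
     (\<forall>s\<le>m. length (p ! s) = d \<and> set (p ! s) \<subseteq> letters r \<and> sorted_wrt (<) (p ! s)) \<and>
     (\<forall>s<m. \<forall>z<d. admissible_step r (p ! s ! z) (p ! Suc s ! z)) \<and>
     p ! 0 = start_tuple d \<and> p ! m = end_tuple r d m' \<and>
     (\<forall>s<m. \<forall>z. Suc z < d \<longrightarrow> p ! Suc s ! z \<ge> Nul \<longrightarrow>
        p ! Suc s ! z \<le> p ! s ! Suc z \<and>
        (p ! Suc s ! z = p ! s ! Suc z \<longleftrightarrow> p ! Suc s ! z = Nul \<and> p ! s ! Suc z = Nul))}"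

definition Yc :: "(nat \<Rightarrow> nat \<Rightarrow> complex) \<Rightarrow> nat \<Rightarrow> nat \<Rightarrow> complex" where
  "Yc Y s i = (if i = 0 then 1 else Y s i)"

text \<open>\<open>step_label r Y (m - s) a b\<close> is $Q^{(s)}(a \to b)$; the value 0 is a default for pairs
  that are not admissible steps.\<close>

fun step_label ::
    "nat \<Rightarrow> (nat \<Rightarrow> nat \<Rightarrow> complex) \<Rightarrow> nat \<Rightarrow> letter \<Rightarrow> letter \<Rightarrow> complex" where
  "step_label r Y t (Plain i) (Plain j) =
     (if i < r then (if j = i then Yc Y t (i - 1) / Yc Y t i else if j = i + 1 then 1 else 0)
      else if j = r then Yc Y t (r - 1) / (Yc Y t r)\<^sup>2 else 0)"
| "step_label r Y t (Plain i) Nul = (if i = r then 1 / Yc Y t r else 0)"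
| "step_label r Y t (Plain i) (Bar j) = (if i = r then 1 / Yc Y t (j - 1) else 0)"
| "step_label r Y t Nul Nul = 1"
| "step_label r Y t Nul (Bar j) = 2 * Yc Y t r / Yc Y t (j - 1)"
| "step_label r Y t (Bar i) (Bar j) =
     (if i = r then (Yc Y t r)\<^sup>2 / Yc Y t (j - 1) else Yc Y t i / Yc Y t (j - 1))"
| "step_label r Y t Nul (Plain j) = 0"
| "step_label r Y t (Bar i) (Plain j) = 0"
| "step_label r Y t (Bar i) Nul = 0"

text \<open>\<open>edge_label r Y (m - s) a b\<close> is $Q^{(s)}(p)$ for an edge with $a^{(s)} = a$ and
  $a^{(s+1)} = b$.\<close>

definition edge_label ::
    "nat \<Rightarrow> (nat \<Rightarrow> nat \<Rightarrow> complex) \<Rightarrow> nat \<Rightarrow> letter list \<Rightarrow> letter list \<Rightarrow> complex" where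
  "edge_label r Y t a b =
     (if \<exists>z. Suc z < length a \<and> b ! z = Nul \<and> a ! Suc z = Nul then 1/2 else 1) *
     (\<Prod>z<length a. step_label r Y t (a ! z) (b ! z))"

definition path_label ::
    "nat \<Rightarrow> nat \<Rightarrow> (nat \<Rightarrow> nat \<Rightarrow> complex) \<Rightarrow> letter list list \<Rightarrow> complex" where
  "path_label r m Y p = (\<Prod>s<m. edge_label r Y (m - s) (p ! s) (p ! Suc s))"

end

theory Submission
  imports Defs
begin

text \<open>
  Let $V$ be the vector representation of $\mathrm{Spin}_{2r+1}$, with basis $v_a$ indexed by the
  letters $a \in J$. For $d < r$ the highest weight vector of weight $\Lambda_d$ is
  $v_1 \wedge \dots \wedge v_d \in \Lambda^d V$, so $\Delta_{w\Lambda_d,\Lambda_d}(g)$ is the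
  $d \times d$ minor of the matrix of $g$ on $V$ with columns $1, \dots, d$ and with the rows that
  occur in $\overline w (v_1 \wedge \dots \wedge v_d)$. For $w = u_{\le k}$ these rows are the end
  tuple of the paths, and the sign is $+1$ (\<open>minor_end_tuple\<close>).

  The element $x^L_{\mathbf i}(\mathbf Y)$ is a product of $m$ cycles
  $x_{-1}(Y_{s,1}) \cdots x_{-r}(Y_{s,r})$, the last of them stopped after $d$ factors, which makes no
  difference on the columns $1, \dots, d$. The matrix of one cycle on $V$ has the step labels as its
  entries (\<open>vrep_cyc\<close>). The Cauchy-Binet formula \<open>Cauchy_Binet\<close> writes the minor of
  the product as a sum over all sequences of strictly increasing $d$-tuples, that is over walks from
  the start tuple to the end tuple, of products of minors of single cycles. By
  \<open>minor_cycle_entry\<close> such a minor is the label of the edge if the edge is allowed in a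
  path, and zero otherwise: below the letter $r$ the matrix is bidiagonal, beyond it it is triangular
  of rank one, apart from the entry $0 \to 0$, which is half of what rank one would require. That
  entry is the origin of the condition (v) and of the factor $\frac12$. So the minor is the sum over
  paths.

  It remains to connect the minor of $V$ with the generalized minor, which is given by its values on
  $\overline w G_0$ inside the spin representation. The space $V$ is found inside the operators on
  Fock space: with $\Gamma = (-1)^N$ and the creation and annihilation operators
  $a_i^\dagger, a_i$, the span of $a_i^\dagger \Gamma, \Gamma, a_i \Gamma$ is stable under
  conjugation by the group. The coefficients of $g v_a g^{-1}$ are regular functions of $g$
  (\<open>regular_on_vrep\<close>). For $g = n_- h n_+$ the minor with rows and columns $1, \dots, d$
  is $h^{\Lambda_d}$ because $n_\pm$ act by unitriangular matrices
  (\<open>fund_weight_torus_part\<close>). Finally the translate $\overline w G_0$ determines a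
  regular function on $G$ (\<open>translate_big_cell_dense\<close>): for $x \in G_0$ also
  $x\, x_i(t) \in G_0$ for all $t$, and $x\, y_i(t) \in G_0$ for all but finitely many $t$, so a
  regular function that vanishes on $\overline w G_0$ vanishes, by continuity in $t$, on everything
  that is reached by further factors $x_i(t)$ and $y_i(t)$.
\<close>

section \<open>Minors and the Cauchy-Binet formula\<close>

definition minor :: "('b \<Rightarrow> 'a \<Rightarrow> complex) \<Rightarrow> 'b list \<Rightarrow> 'a list \<Rightarrow> complex" where
  "minor M bs as = det (mat (length as) (length as) (\<lambda>(i, j). M (bs ! i) (as ! j)))"

lemma minor_cong:
  assumes "length bs = length as" "\<And>b a. b \<in> set bs \<Longrightarrow> a \<in> set as \<Longrightarrow> M b a = M' b a"
  shows "minor M bs as = minor M' bs as"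
  unfolding minor_def using assms by (intro arg_cong[where f = det] eq_matI) auto

lemma minor_Nil [simp]: "minor M [] [] = 1"
  by (simp add: minor_def)

lemma minor_map_rows: "length bs = length as \<Longrightarrow> minor M (map g bs) as = minor (\<lambda>b. M (g b)) bs as"
  unfolding minor_def by (intro arg_cong[where f = det] eq_matI) auto

lemma minor_first_row:
  assumes len: "length bs = length as" and zero: "\<And>a'. a' \<in> set as \<Longrightarrow> M b a' = 0"
  shows "minor M (b # bs) (a # as) = M b a * minor M bs as"
proof -
  let ?n = "Suc (length as)"
  let ?A = "mat ?n ?n (\<lambda>(i, j). M ((b # bs) ! i) ((a # as) ! j))"
  have "det ?A = (\<Sum>j<?n. ?A $$ (0, j) * cofactor ?A 0 j)"
    by (rule laplace_expansion_row) auto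
  also have "\<dots> = ?A $$ (0, 0) * cofactor ?A 0 0 + (\<Sum>j<length as. ?A $$ (0, Suc j) * cofactor ?A 0 (Suc j))"
    by (rule sum.lessThan_Suc_shift)
  also have "(\<Sum>j<length as. ?A $$ (0, Suc j) * cofactor ?A 0 (Suc j)) = 0"
    using zero by (intro sum.neutral) auto
  also have "mat_delete ?A 0 0 = mat (length as) (length as) (\<lambda>(i, j). M (bs ! i) (as ! j))"
    unfolding mat_delete_def by (rule eq_matI) auto
  ultimately show ?thesis by (simp add: minor_def cofactor_def mat_delete_def)
qed

lemma minor_first_col:
  assumes len: "length bs = length as" and zero: "\<And>b'. b' \<in> set bs \<Longrightarrow> M b' a = 0"
  shows "minor M (b # bs) (a # as) = M b a * minor M bs as"
proof -
  let ?n = "Suc (length as)"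
  let ?A = "mat ?n ?n (\<lambda>(i, j). M ((b # bs) ! i) ((a # as) ! j))"
  have "det ?A = (\<Sum>j<?n. ?A $$ (j, 0) * cofactor ?A j 0)"
    by (rule laplace_expansion_column) auto
  also have "\<dots> = ?A $$ (0, 0) * cofactor ?A 0 0 + (\<Sum>j<length as. ?A $$ (Suc j, 0) * cofactor ?A (Suc j) 0)"
    by (rule sum.lessThan_Suc_shift)
  also have "(\<Sum>j<length as. ?A $$ (Suc j, 0) * cofactor ?A (Suc j) 0) = 0"
    using zero len by (intro sum.neutral) auto
  also have "mat_delete ?A 0 0 = mat (length as) (length as) (\<lambda>(i, j). M (bs ! i) (as ! j))"
    unfolding mat_delete_def by (rule eq_matI) auto
  ultimately show ?thesis by (simp add: minor_def cofactor_def mat_delete_def)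
qed

lemma minor_add_col:
  assumes len: "length bs = Suc (Suc (length as))" and a: "a \<noteq> a'" "a \<notin> set as"
  shows "minor (\<lambda>b x. if x = a then M b a + c * M b a' else M b x) bs (a # a' # as) = minor M bs (a # a' # as)"
proof -
  let ?n = "Suc (Suc (length as))"
  let ?A = "mat ?n ?n (\<lambda>(i, j). M (bs ! i) ((a # a' # as) ! j))"
  have "mat ?n ?n (\<lambda>(i, j). (\<lambda>b x. if x = a then M b a + c * M b a' else M b x) (bs ! i) ((a # a' # as) ! j))
      = addcol c 0 1 ?A"
    using a by (intro eq_matI) (auto simp: nth_Cons split: nat.splits)
  moreover have "det (addcol c 0 1 ?A) = det ?A"
    by (rule det_addcol[of _ ?n]) auto
  ultimately show ?thesis by (simp add: minor_def)
qed

lemma minor_swap_rows: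
  assumes len: "length as = length xs + 2 + length ys"
  shows "minor M (xs @ [b, b'] @ ys) as = - minor M (xs @ [b', b] @ ys) as"
proof -
  let ?n = "length as" and ?k = "length xs"
  let ?A = "mat ?n ?n (\<lambda>(i, j). M ((xs @ [b', b] @ ys) ! i) (as ! j))"
  have "mat ?n ?n (\<lambda>(i, j). M ((xs @ [b, b'] @ ys) ! i) (as ! j)) = swaprows ?k (Suc ?k) ?A"
  proof (rule eq_matI, goal_cases)
    case (1 i j)
    show ?case
    proof (cases "i < ?k \<or> i = ?k \<or> i = Suc ?k")
      case True then show ?thesis using 1 len by (auto simp: nth_append)
    next
      case False
      then obtain l where "i = Suc (Suc ?k) + l" by (metis not_less_eq less_iff_Suc_add linorder_neqE_nat add_Suc_shift add_Suc)
      then show ?thesis using 1 len by (auto simp: nth_append)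
    qed
  qed auto
  moreover have "det (swaprows ?k (Suc ?k) ?A) = - det ?A"
    by (rule det_swaprows[of _ ?n]) (use len in auto)
  ultimately show ?thesis by (simp add: minor_def)
qed

lemma minor_move_row:
  assumes "length as = length xs + length ys + 1 + length zs"
  shows "minor M (xs @ b # ys @ zs) as = (-1) ^ length ys * minor M (xs @ ys @ b # zs) as"
  using assms
proof (induction ys arbitrary: xs)
  case (Cons y ys)
  have "minor M (xs @ b # (y # ys) @ zs) as = - minor M (xs @ [y, b] @ ys @ zs) as"
    using minor_swap_rows[of as xs "ys @ zs" M b y] Cons.prems by simp
  also have "minor M (xs @ [y, b] @ ys @ zs) as = (-1) ^ length ys * minor M ((xs @ [y]) @ ys @ b # zs) as"
    using Cons.IH[of "xs @ [y]"] Cons.prems by simp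
  finally show ?case by simp
qed simp

lemma minor_scale_row:
  assumes "length as = length xs + 1 + length ys"
  shows "minor (\<lambda>f. f) (xs @ (\<lambda>a. c * f a) # ys) as = c * minor (\<lambda>f. f) (xs @ f # ys) as"
proof -
  let ?n = "length as" and ?k = "length xs"
  let ?A = "mat ?n ?n (\<lambda>(i, j). ((xs @ f # ys) ! i) (as ! j))"
  have "mat ?n ?n (\<lambda>(i, j). ((xs @ (\<lambda>a. c * f a) # ys) ! i) (as ! j)) = multrow ?k c ?A"
    by (intro eq_matI) (auto simp: nth_append nth_Cons split: nat.splits)
  moreover have "det (multrow ?k c ?A) = c * det ?A"
    by (rule det_multrow[of _ ?n]) (use assms in auto)
  ultimately show ?thesis by (simp add: minor_def)
qed

lemma minor_zero_rows_repeat: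
  assumes "length bs = length as" "\<not> distinct bs"
  shows "minor M bs as = 0"
proof -
  obtain i j where ij: "i < length bs" "j < length bs" "i \<noteq> j" "bs ! i = bs ! j"
    using assms(2) by (auto simp: distinct_conv_nth)
  show ?thesis unfolding minor_def
    by (rule det_identical_rows[of _ "length as" i j]) (use ij assms(1) in \<open>auto intro!: eq_vecI\<close>)
qed

definition sorted_tuples :: "'a::linorder set \<Rightarrow> nat \<Rightarrow> 'a list set" where
  "sorted_tuples L d = {cs. length cs = d \<and> set cs \<subseteq> L \<and> sorted_wrt (<) cs}"

lemma finite_sorted_tuples: "finite L \<Longrightarrow> finite (sorted_tuples L d)"
  by (rule finite_subset[OF _ finite_lists_length_eq[of L d]]) (auto simp: sorted_tuples_def)

lemma sorted_tuples_eqI: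
  assumes "sorted_wrt (<) (xs :: 'a::linorder list)" "sorted_wrt (<) ys" "set xs = set ys"
  shows "xs = ys"
  by (simp add: assms(1,2,3) strict_sorted_equal)

lemma det_rows_scaled_alternating:
  assumes "length (bs :: 'b list) = d" "length as = d" "f \<in> {0..<d} \<rightarrow>\<^sub>E L"
  shows "(\<Sum>p | p permutes {0..<d}. signof p * (\<Prod>i = 0..<d. A (bs ! i) (f i) * B (f i) (as ! p i)))
       = (\<Prod>i = 0..<d. A (bs ! i) (f i)) * minor B (map f [0..<d]) as"
  unfolding minor_def
  by (subst det_def'[of _ d], use assms in force)
     (auto simp: assms prod.distrib sum_distrib_left permutes_in_image intro!: sum.cong prod.cong)

text \<open>
  Expand every row multilinearly: the minor becomes a sum over all maps $f$ from row positions to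
  intermediate letters. Maps that are not injective contribute a determinant with two equal rows. An
  injective map is, uniquely, a strictly increasing tuple composed with a permutation; summing the
  signs of the permutations rebuilds the minor of the left factor.
\<close>

theorem Cauchy_Binet:
  fixes L :: "'c::linorder set"
  assumes fin: "finite L" and bs: "length bs = d" and as: "length as = d"
  shows "minor (\<lambda>b a. \<Sum>c\<in>L. A b c * B c a) bs as
       = (\<Sum>cs\<in>sorted_tuples L d. minor A bs cs * minor B cs as)"
proof -
  let ?P = "{p. p permutes {0..<d}}"
  let ?F = "{0..<d} \<rightarrow>\<^sub>E L"
  let ?FI = "{f \<in> ?F. inj_on f {0..<d}}"
  let ?w = "\<lambda>f. (\<Prod>i = 0..<d. A (bs ! i) (f i)) * minor B (map f [0..<d]) as"
  have finF: "finite ?F" using fin by (simp add: finite_PiE)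
  have bij: "bij_betw (\<lambda>(cs, q). \<lambda>i\<in>{0..<d}. cs ! q i) (sorted_tuples L d \<times> ?P) ?FI"
    unfolding bij_betw_def
  proof (intro conjI inj_onI equalityI subsetI)
    fix u v assume uv: "u \<in> sorted_tuples L d \<times> ?P" "v \<in> sorted_tuples L d \<times> ?P"
      and eq: "(case u of (cs, q) \<Rightarrow> \<lambda>i\<in>{0..<d}. cs ! q i) = (case v of (cs, q) \<Rightarrow> \<lambda>i\<in>{0..<d}. cs ! q i)"
    obtain cs q cs' q' where u: "u = (cs, q)" "v = (cs', q')" by fastforce
    have cs: "length cs = d" "sorted_wrt (<) cs" "length cs' = d" "sorted_wrt (<) cs'"
      and q: "q permutes {0..<d}" "q' permutes {0..<d}"
      using uv by (auto simp: u sorted_tuples_def)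
    have e: "cs ! q i = cs' ! q' i" if "i < d" for i
      using fun_cong[OF eq, of i] that by (simp add: u)
    have img: "set xs = (\<lambda>i. xs ! p i) ` {0..<d}" if "length xs = d" "p permutes {0..<d}" for xs :: "'c list" and p
    proof -
      have "set xs = (!) xs ` {0..<d}" using that(1) by (auto simp: set_conv_nth)
      also have "\<dots> = (!) xs ` p ` {0..<d}" using permutes_image[OF that(2)] by simp
      finally show ?thesis by (simp add: image_image)
    qed
    have "set cs = set cs'" unfolding img[OF cs(1) q(1)] img[OF cs(3) q(2)] by (rule image_cong) (auto simp: e)
    then have cc: "cs = cs'" using cs by (intro sorted_tuples_eqI)
    have "distinct cs" using cs(2) strict_sorted_iff by blast
    have "q i = q' i" for i
    proof (cases "i < d")
      case True
      then have "q i < d" "q' i < d" using permutes_in_image[OF q(1)] permutes_in_image[OF q(2)] by auto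
      then show ?thesis using e[OF True] \<open>distinct cs\<close> cs by (simp add: cc nth_eq_iff_index_eq)
    next
      case False
      then show ?thesis using q by (auto simp: permutes_def)
    qed
    then show "u = v" using cc by (auto simp: u)
  next
    fix f assume "f \<in> (\<lambda>(cs, q). \<lambda>i\<in>{0..<d}. cs ! q i) ` (sorted_tuples L d \<times> ?P)"
    then obtain cs q where f: "f = (\<lambda>i\<in>{0..<d}. cs ! q i)" and cs: "cs \<in> sorted_tuples L d" and q: "q permutes {0..<d}"
      by auto
    have "distinct cs" "length cs = d" "set cs \<subseteq> L" using cs strict_sorted_iff by (auto simp: sorted_tuples_def)
    moreover have "q i < d" if "i < d" for i using that permutes_in_image[OF q] by auto
    ultimately show "f \<in> ?FI" using permutes_inj[OF q]
      by (auto simp: f inj_on_def nth_eq_iff_index_eq dest: injD intro!: subsetD[of "set cs" L])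
  next
    fix f assume "f \<in> ?FI"
    then have f: "f \<in> ?F" and inj: "inj_on f {0..<d}" by auto
    define cs where "cs = sorted_list_of_set (f ` {0..<d})"
    have cs: "set cs = f ` {0..<d}" "sorted_wrt (<) cs" "length cs = d" "distinct cs"
      using card_image[OF inj] by (auto simp: cs_def)
    have mem: "cs \<in> sorted_tuples L d" using cs f by (auto simp: sorted_tuples_def)
    define q where "q i = (if i < d then (THE j. j < d \<and> cs ! j = f i) else i)" for i
    have q: "q i < d \<and> cs ! q i = f i" if "i < d" for i
    proof -
      have "\<exists>!j. j < d \<and> cs ! j = f i"
        using cs that by (metis atLeast0LessThan distinct_Ex1 image_eqI lessThan_iff)
      from theI'[OF this] show ?thesis using that by (simp add: q_def)
    qed
    have "inj_on q {0..<d}" using inj q by (metis (no_types, lifting) atLeastLessThan_iff inj_on_def)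
    moreover have "q ` {0..<d} \<subseteq> {0..<d}" using q by auto
    ultimately have "bij_betw q {0..<d} {0..<d}"
      by (simp add: bij_betw_def endo_inj_surj)
    then have "q permutes {0..<d}" by (rule bij_imp_permutes) (simp add: q_def)
    moreover have "f = (\<lambda>i\<in>{0..<d}. cs ! q i)" using f q by (auto simp: fun_eq_iff PiE_def extensional_def)
    ultimately show "f \<in> (\<lambda>(cs, q). \<lambda>i\<in>{0..<d}. cs ! q i) ` (sorted_tuples L d \<times> ?P)"
      using mem by auto
  qed
  have "minor (\<lambda>b a. \<Sum>c\<in>L. A b c * B c a) bs as
      = (\<Sum>p\<in>?P. signof p * (\<Prod>i = 0..<d. \<Sum>c\<in>L. A (bs ! i) c * B c (as ! p i)))"
    unfolding minor_def
    by (subst det_def'[of _ d], use as in force) (auto simp: as permutes_in_image intro!: sum.cong prod.cong)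
  also have "\<dots> = (\<Sum>p\<in>?P. signof p * (\<Sum>f\<in>?F. \<Prod>i = 0..<d. A (bs ! i) (f i) * B (f i) (as ! p i)))"
    using fin by (simp add: prod_sum_PiE)
  also have "\<dots> = (\<Sum>f\<in>?F. \<Sum>p\<in>?P. signof p * (\<Prod>i = 0..<d. A (bs ! i) (f i) * B (f i) (as ! p i)))"
    by (simp only: sum_distrib_left) (rule sum.swap)
  also have "\<dots> = (\<Sum>f\<in>?F. ?w f)"
    by (intro sum.cong refl det_rows_scaled_alternating[OF bs as])
  also have "\<dots> = (\<Sum>f\<in>?FI. ?w f)"
    using finF by (intro sum.mono_neutral_right)
      (auto simp: distinct_map as intro!: minor_zero_rows_repeat)
  also have "\<dots> = (\<Sum>(cs, q)\<in>sorted_tuples L d \<times> ?P. ?w (\<lambda>i\<in>{0..<d}. cs ! q i))"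
    unfolding sum.reindex_bij_betw[OF bij, symmetric] by (simp add: case_prod_beta)
  also have "\<dots> = (\<Sum>cs\<in>sorted_tuples L d. \<Sum>q\<in>?P. ?w (\<lambda>i\<in>{0..<d}. cs ! q i))"
    by (rule sum.cartesian_product[symmetric])
  also have "\<dots> = (\<Sum>cs\<in>sorted_tuples L d. minor A bs cs * minor B cs as)"
  proof (rule sum.cong[OF refl])
    fix cs assume "cs \<in> sorted_tuples L d"
    then have cs: "length cs = d" by (simp add: sorted_tuples_def)
    have "?w (\<lambda>i\<in>{0..<d}. cs ! q i) = (signof q * (\<Prod>i = 0..<d. A (bs ! i) (cs ! q i))) * minor B cs as"
      if q: "q permutes {0..<d}" for q
    proof -
      have "minor B (map (\<lambda>i\<in>{0..<d}. cs ! q i) [0..<d]) as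
          = det (mat d d (\<lambda>(i, j). mat d d (\<lambda>(i, j). B (cs ! i) (as ! j)) $$ (q i, j)))"
        unfolding minor_def as using permutes_in_image[OF q]
        by (intro arg_cong[where f = det] eq_matI) auto
      also have "\<dots> = signof q * minor B cs as"
        unfolding minor_def as by (rule det_permute_rows) (use q in auto)
      finally show ?thesis by simp
    qed
    note w = this
    have "(\<Sum>q\<in>?P. ?w (\<lambda>i\<in>{0..<d}. cs ! q i))
        = (\<Sum>q\<in>?P. signof q * (\<Prod>i = 0..<d. A (bs ! i) (cs ! q i))) * minor B cs as"
      unfolding sum_distrib_right by (rule sum.cong[OF refl], rule w) simp
    also have "(\<Sum>q\<in>?P. signof q * (\<Prod>i = 0..<d. A (bs ! i) (cs ! q i))) = minor A bs cs"
      unfolding minor_def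
      by (subst det_def'[of _ d], use cs in force) (auto simp: cs permutes_in_image intro!: sum.cong prod.cong)
    finally show "(\<Sum>q\<in>?P. ?w (\<lambda>i\<in>{0..<d}. cs ! q i)) = minor A bs cs * minor B cs as" .
  qed
  finally show ?thesis .
qed

section \<open>Minors of the matrix of a cycle\<close>

text \<open>
  The order condition is needed because \<open>step_label\<close> also gives a nonzero value to a pair
  $\overline i, \overline j$ with $\overline j < \overline i$, which is not a step.
\<close>

definition cycle_entry :: "nat \<Rightarrow> (nat \<Rightarrow> nat \<Rightarrow> complex) \<Rightarrow> nat \<Rightarrow> letter \<Rightarrow> letter \<Rightarrow> complex" where
  "cycle_entry r Y t b a = (if a \<le> b then step_label r Y t a b else 0)"

text \<open>
  The conditions (iii) and (v) on two consecutive vertices of a path.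
\<close>

definition admissible_edge :: "nat \<Rightarrow> letter list \<Rightarrow> letter list \<Rightarrow> bool" where
  "admissible_edge r as bs \<longleftrightarrow> (\<forall>z<length as. admissible_step r (as ! z) (bs ! z)) \<and>
     (\<forall>z. Suc z < length as \<longrightarrow> bs ! z \<ge> Nul \<longrightarrow>
        bs ! z \<le> as ! Suc z \<and> (bs ! z = as ! Suc z \<longleftrightarrow> bs ! z = Nul \<and> as ! Suc z = Nul))"

lemma All_nat_split: "(\<forall>z. P z) \<longleftrightarrow> P 0 \<and> (\<forall>z. P (Suc z))"
  by (metis not0_implies_Suc)

lemma Ex_nat_split: "(\<exists>z. P z) \<longleftrightarrow> P 0 \<or> (\<exists>z. P (Suc z))"
  by (metis not0_implies_Suc)

lemma admissible_edge_Nil [simp]: "admissible_edge r [] []"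
  by (simp add: admissible_edge_def)

lemma admissible_edge_Cons:
  "admissible_edge r (a # as) (b # bs) \<longleftrightarrow> admissible_step r a b \<and>
     (as \<noteq> [] \<longrightarrow> Nul \<le> b \<longrightarrow> b \<le> hd as \<and> (b = hd as \<longleftrightarrow> b = Nul \<and> hd as = Nul)) \<and>
     admissible_edge r as bs"
  unfolding admissible_edge_def
  by (subst (1 2) All_nat_split) (auto simp: hd_conv_nth)

lemma edge_label_Cons:
  assumes "length bs = length as" "b = Nul \<Longrightarrow> Nul \<notin> set bs"
  shows "edge_label r Y t (a # as) (b # bs) =
     (if as \<noteq> [] \<and> b = Nul \<and> hd as = Nul then 1/2 else 1) * step_label r Y t a b * edge_label r Y t as bs"
proof -
  have ex: "(\<exists>z. Suc z < length (a # as) \<and> (b # bs) ! z = Nul \<and> (a # as) ! Suc z = Nul) \<longleftrightarrow>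
      (as \<noteq> [] \<and> b = Nul \<and> hd as = Nul) \<or> (\<exists>z. Suc z < length as \<and> bs ! z = Nul \<and> as ! Suc z = Nul)"
    by (subst Ex_nat_split) (auto simp: hd_conv_nth)
  have excl: "\<not> (\<exists>z. Suc z < length as \<and> bs ! z = Nul \<and> as ! Suc z = Nul)" if "b = Nul"
    using assms that by (metis Suc_lessD nth_mem)
  have pr: "(\<Prod>z<length (a # as). step_label r Y t ((a # as) ! z) ((b # bs) ! z))
      = step_label r Y t a b * (\<Prod>z<length as. step_label r Y t (as ! z) (bs ! z))"
    by (simp only: list.size add_Suc_right add_0_right prod.lessThan_Suc_shift) simp
  show ?thesis
    unfolding edge_label_def ex pr using excl by auto
qed

lemma Plain_in_letters [simp]: "Plain i \<in> letters r \<longleftrightarrow> 1 \<le> i \<and> i \<le> r"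
  and Nul_in_letters [simp]: "Nul \<in> letters r"
  and Bar_in_letters [simp]: "Bar i \<in> letters r \<longleftrightarrow> 1 \<le> i \<and> i \<le> r"
  by (auto simp: letters_def)

lemma finite_letters [simp]: "finite (letters r)"
  by (simp add: letters_def)

lemma less_letter_simps [simp]:
  "Plain i < Plain j \<longleftrightarrow> i < j" "Plain i < Nul" "Plain i < Bar j" "\<not> Nul < Plain j" "\<not> Nul < Nul"
  "Nul < Bar j" "\<not> Bar i < Plain j" "\<not> Bar i < Nul" "Bar i < Bar j \<longleftrightarrow> j < i"
  by (auto simp: less_letter_def)

lemma cycle_entry_admissible:
  assumes "a \<in> letters r" "b \<in> letters r"
  shows "cycle_entry r Y t b a = (if admissible_step r a b then step_label r Y t a b else 0)"
  using assms by (cases a; cases b) (auto simp: cycle_entry_def admissible_step_def)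

definition bar_factor :: "nat \<Rightarrow> (nat \<Rightarrow> nat \<Rightarrow> complex) \<Rightarrow> nat \<Rightarrow> letter \<Rightarrow> complex" where
  "bar_factor r Y t a = (case a of Plain i \<Rightarrow> 1 | Nul \<Rightarrow> 2 * Yc Y t r
     | Bar i \<Rightarrow> (if i = r then (Yc Y t r)\<^sup>2 else Yc Y t i))"

text \<open>
  Beyond the middle letter the matrix of a cycle is the lower triangular part of a matrix of rank one:
  an entry is a factor of the column times a factor of the row.
\<close>

lemma cycle_entry_Bar:
  assumes "Plain r \<le> a" "a \<le> Bar j" "a \<in> letters r"
  shows "cycle_entry r Y t (Bar j) a = bar_factor r Y t a / Yc Y t (j - 1)"
  using assms by (cases a) (auto simp: cycle_entry_def bar_factor_def)

lemma bar_factor_nonzero: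
  assumes "\<And>j. 1 \<le> j \<Longrightarrow> j \<le> r \<Longrightarrow> Y t j \<noteq> 0" "a \<in> letters r" "0 < r"
  shows "bar_factor r Y t a \<noteq> 0"
  using assms by (cases a) (auto simp: bar_factor_def Yc_def)

text \<open>
  Induction on the tuples, splitting off the first row $b$ and the first column $a$; let $a_2$ be the
  second column. If $b < a_2$, only the first entry of the first row survives. If $a_2 \le b$ and
  $a < r$, the first column has at most its first entry, since the matrix is bidiagonal there. If
  $r \le a$ and $a_2 \le b$, all rows lie in the part of rank one, and subtracting a multiple of column
  $a_2$ clears column $a$. The exception is the row $0$ with $a = r$, $a_2 = 0$, where the subtraction
  leaves half of the entry: this is the factor $\frac12$ of the edge label.
\<close>

theorem minor_cycle_entry:
  assumes "length bs = length as" "sorted_wrt (<) as" "sorted_wrt (<) bs"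
    and "set as \<subseteq> letters r" "set bs \<subseteq> letters r" "0 < r"
    and Y: "\<And>j. 1 \<le> j \<Longrightarrow> j \<le> r \<Longrightarrow> Y t j \<noteq> 0"
  shows "minor (cycle_entry r Y t) bs as = (if admissible_edge r as bs then edge_label r Y t as bs else 0)"
  using assms(1-5)
proof (induction as arbitrary: bs)
  case Nil
  then show ?case by (simp add: edge_label_def)
next
  case (Cons a as bs0)
  then obtain b bs where bs0: "bs0 = b # bs" and len: "length bs = length as"
    by (metis length_Suc_conv)
  note prems = Cons.prems[unfolded bs0]
  have IH: "minor (cycle_entry r Y t) bs as = (if admissible_edge r as bs then edge_label r Y t as bs else 0)"
    using Cons.IH[OF len] prems by simp
  have ab: "a \<in> letters r" "b \<in> letters r" using prems by auto
  have bless: "b < b'" "b' \<in> letters r" if "b' \<in> set bs" for b' using prems that by auto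
  have aless: "a < a'" "a' \<in> letters r" if "a' \<in> set as" for a' using prems that by auto
  have el: "edge_label r Y t (a # as) (b # bs) =
     (if as \<noteq> [] \<and> b = Nul \<and> hd as = Nul then 1/2 else 1) * step_label r Y t a b * edge_label r Y t as bs"
    using bless by (intro edge_label_Cons len) auto
  note ent = cycle_entry_admissible[OF ab, of Y t]
  let ?M = "cycle_entry r Y t"
  show ?case unfolding bs0
  proof (cases as)
    case Nil
    with len show "minor ?M (b # bs) (a # as) = (if admissible_edge r (a # as) (b # bs) then edge_label r Y t (a # as) (b # bs) else 0)"
      using IH el minor_first_row[of "[]" "[]" ?M b a] by (simp add: ent admissible_edge_Cons edge_label_def)
  next
    case as: (Cons a2 as')
    note IH = IH[unfolded as] and el = el[unfolded as]
    have a2: "a < a2" "a2 \<in> letters r" using aless as by auto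
    show "minor ?M (b # bs) (a # as) = (if admissible_edge r (a # as) (b # bs) then edge_label r Y t (a # as) (b # bs) else 0)"
    proof (cases "b < a2")
      case True
      have "b < a'" if "a' \<in> set as" for a'
        using True prems that by (auto simp: as)
      then have "?M b a' = 0" if "a' \<in> set as" for a'
        using that leD by (auto simp: cycle_entry_def)
      then have "minor ?M (b # bs) (a # as) = ?M b a * minor ?M bs as"
        by (intro minor_first_row len)
      then show ?thesis using True by (auto simp: ent IH el admissible_edge_Cons as)
    next
      case False
      then have a2b: "a2 \<le> b" by simp
      show ?thesis
      proof (cases "\<exists>i<r. a = Plain i")
        case True
        then obtain i where i: "a = Plain i" "i < r" by blast
        have "Plain (Suc i) \<le> a2" using a2 i by (cases a2) auto
        then have "Plain (Suc i) \<le> b" using a2b by order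
        then have "Plain (Suc i) < b'" if "b' \<in> set bs" for b' using bless[OF that] by order
        then have z: "?M b' a = 0" if "b' \<in> set bs" for b' using that i
          by (cases b') (fastforce simp: cycle_entry_def)+
        have "minor ?M (b # bs) (a # as) = ?M b a * minor ?M bs as"
          by (intro minor_first_col len z)
        moreover have "b < Nul" if "admissible_step r a b"
          using that i ab by (auto simp: admissible_step_def)
        ultimately show ?thesis by (auto simp: ent IH el admissible_edge_Cons as)
      next
        case ar: False
        then have ar: "Plain r \<le> a" using ab by (cases a) (auto simp: not_less)
        then have "Plain r < b" using a2 a2b by order
        then have bn: "Nul \<le> b" using ab by (cases b) auto
        have bars: "\<exists>j. b' = Bar j" if "b' \<in> set bs" for b'
        proof -
          have "Nul < b'" using bless(1)[OF that] bn by order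
          then show ?thesis by (cases b') auto
        qed
        have rows: "length (b # bs) = Suc (Suc (length as'))" using len as by simp
        have nin: "a \<noteq> a2" "a \<notin> set as'" "a \<notin> set as" using aless as by auto
        have x: "bar_factor r Y t a2 \<noteq> 0" by (rule bar_factor_nonzero) (use Y a2 \<open>0 < r\<close> in auto)
        \<comment> \<open>the multiple of column $a_2$ that annihilates column $a$ in all barred rows\<close>
        define c where "c = - bar_factor r Y t a / bar_factor r Y t a2"
        define M' where "M' = (\<lambda>b x. if x = a then ?M b a + c * ?M b a2 else ?M b x)"
        have "minor ?M (b # bs) (a # as) = minor M' (b # bs) (a # as)"
          unfolding M'_def as by (rule minor_add_col[symmetric]) (use rows nin in auto)
        also have z: "M' (Bar j) a = 0" if "Bar j \<in> set (b # bs)" for j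
        proof -
          have "a2 \<le> Bar j" using that a2b bless[of "Bar j"] by auto
          then have "a \<le> Bar j" "Plain r \<le> a2" using a2 ar by order+
          then show ?thesis using ar a2 ab x \<open>a2 \<le> Bar j\<close>
            by (simp add: M'_def c_def cycle_entry_Bar)
        qed
        then have "minor M' (b # bs) (a # as) = M' b a * minor M' bs as"
        proof (intro minor_first_col len)
          fix b' assume b': "b' \<in> set bs"
          then obtain j where "b' = Bar j" using bars by blast
          then show "M' b' a = 0" using z b' by auto
        qed
        also have "minor M' bs as = minor ?M bs as"
          by (rule minor_cong) (use nin len in \<open>auto simp: M'_def\<close>)
        finally have eq: "minor ?M (b # bs) (a # as) = M' b a * minor ?M bs as" .
        show ?thesis
        proof (cases "b = Nul")
          case True
          then have "a < Nul" using a2(1) a2b by order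
          then have ap: "a = Plain r" using ar ab by (cases a) auto
          then have "Plain r < a2" "a2 \<le> Nul" using a2(1) a2b True by auto
          then have an: "a2 = Nul" using a2(2) by (cases a2) auto
          note ap an
          moreover have "Yc Y t r \<noteq> 0" using Y[of r] \<open>0 < r\<close> by (simp add: Yc_def)
          ultimately have "M' b a = 1/2 * step_label r Y t a b" using True
            by (simp add: M'_def c_def bar_factor_def cycle_entry_def field_simps)
          then show ?thesis using True ap an
            unfolding eq unfolding as IH el admissible_edge_Cons by (auto simp: admissible_step_def)
        next
          case False
          then obtain j where "b = Bar j" using bn by (cases b) auto
          then have "M' b a = 0" using z by simp
          moreover have "\<not> admissible_edge r (a # as) (b # bs)"
            using a2b False bn by (auto simp: admissible_edge_Cons as)
          ultimately show ?thesis by (simp add: eq)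
        qed
      qed
    qed
  qed
qed

section \<open>Sums over paths\<close>

text \<open>
  The value at $b$ of the $k$-fold product of the transfer matrices $w_0, w_1, \dots$ applied to the
  indicator of $a$.
\<close>

primrec transfer :: "'a set \<Rightarrow> (nat \<Rightarrow> 'a \<Rightarrow> 'a \<Rightarrow> complex) \<Rightarrow> 'a \<Rightarrow> nat \<Rightarrow> 'a \<Rightarrow> complex" where
  "transfer T w a 0 b = (if b = a then 1 else 0)"
| "transfer T w a (Suc k) b = (\<Sum>c\<in>T. w k c b * transfer T w a k c)"

definition walks :: "'a set \<Rightarrow> 'a \<Rightarrow> nat \<Rightarrow> 'a \<Rightarrow> 'a list set" where
  "walks T a k b = {p. length p = Suc k \<and> set p \<subseteq> T \<and> p ! 0 = a \<and> p ! k = b}"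

lemma finite_walks: "finite T \<Longrightarrow> finite (walks T a k b)"
  by (rule finite_subset[OF _ finite_lists_length_eq[of T "Suc k"]]) (auto simp: walks_def)

text \<open>
  Removing the last vertex is a bijection from the walks of length $k + 1$ that end in $b$ to the
  walks of length $k$ with arbitrary end.
\<close>

lemma transfer_eq_sum_walks:
  assumes "finite T" "a \<in> T" "b \<in> T"
  shows "transfer T w a k b = (\<Sum>p\<in>walks T a k b. \<Prod>s<k. w s (p ! s) (p ! Suc s))"
  using assms(3)
proof (induction k arbitrary: b)
  case 0
  have "walks T a 0 b = (if b = a then {[a]} else {})"
    using assms(2) by (auto simp: walks_def length_Suc_conv)
  then show ?case by simp
next
  case (Suc k)
  have bij: "bij_betw (\<lambda>(c, p). p @ [b]) (SIGMA c:T. walks T a k c) (walks T a (Suc k) b)"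
  proof (rule bij_betw_byWitness[where f' = "\<lambda>p. (p ! k, butlast p)"])
    show "\<forall>u\<in>SIGMA c:T. walks T a k c. ((case u of (c, p) \<Rightarrow> p @ [b]) ! k, butlast (case u of (c, p) \<Rightarrow> p @ [b])) = u"
      by (auto simp: walks_def nth_append)
    show "\<forall>p\<in>walks T a (Suc k) b. (case (p ! k, butlast p) of (c, p) \<Rightarrow> p @ [b]) = p"
    proof
      fix p assume p: "p \<in> walks T a (Suc k) b"
      then have "p \<noteq> []" by (auto simp: walks_def)
      with p have "last p = b" by (simp add: walks_def last_conv_nth)
      note this \<open>p \<noteq> []\<close>
      then show "(case (p ! k, butlast p) of (c, p) \<Rightarrow> p @ [b]) = p"
        by (simp add: snoc_eq_iff_butlast)
    qed
    show "(\<lambda>(c, p). p @ [b]) ` (SIGMA c:T. walks T a k c) \<subseteq> walks T a (Suc k) b"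
      using Suc.prems by (auto simp: walks_def nth_append)
    show "(\<lambda>p. (p ! k, butlast p)) ` walks T a (Suc k) b \<subseteq> (SIGMA c:T. walks T a k c)"
      by (auto simp: walks_def nth_butlast dest: in_set_butlastD)
  qed
  have "transfer T w a (Suc k) b = (\<Sum>c\<in>T. \<Sum>p\<in>walks T a k c. w k c b * (\<Prod>s<k. w s (p ! s) (p ! Suc s)))"
    by (simp add: Suc.IH sum_distrib_left)
  also have "\<dots> = (\<Sum>(c, p)\<in>(SIGMA c:T. walks T a k c). w k c b * (\<Prod>s<k. w s (p ! s) (p ! Suc s)))"
    using assms(1) by (intro sum.Sigma) (auto simp: finite_walks)
  also have "\<dots> = (\<Sum>(c, p)\<in>(SIGMA c:T. walks T a k c). (\<lambda>p. \<Prod>s<Suc k. w s (p ! s) (p ! Suc s)) (p @ [b]))"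
    by (intro sum.cong refl) (auto simp: walks_def nth_append intro!: prod.cong)
  also have "\<dots> = (\<Sum>p\<in>walks T a (Suc k) b. \<Prod>s<Suc k. w s (p ! s) (p ! Suc s))"
    unfolding sum.reindex_bij_betw[OF bij, symmetric] by (simp add: case_prod_beta)
  finally show ?case .
qed

lemma paths_eq_admissible_walks:
  assumes "start_tuple d \<in> sorted_tuples (letters r) d" "end_tuple r d m' \<in> sorted_tuples (letters r) d"
  shows "paths r d m m' = {p \<in> walks (sorted_tuples (letters r) d) (start_tuple d) m (end_tuple r d m').
     \<forall>s<m. admissible_edge r (p ! s) (p ! Suc s)}"
proof (rule Set.set_eqI)
  fix p
  let ?T = "sorted_tuples (letters r) d"
  have T: "set p \<subseteq> ?T \<longleftrightarrow> (\<forall>s\<le>m. p ! s \<in> ?T)" if "length p = Suc m"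
    using that by (auto simp: subset_iff in_set_conv_nth less_Suc_eq_le)
  show "p \<in> paths r d m m' \<longleftrightarrow>
     p \<in> {p \<in> walks ?T (start_tuple d) m (end_tuple r d m'). \<forall>s<m. admissible_edge r (p ! s) (p ! Suc s)}"
  proof (cases "length p = Suc m \<and> (\<forall>s\<le>m. p ! s \<in> ?T)")
    case True
    then have "length (p ! s) = d" if "s < m" for s using that by (auto simp: sorted_tuples_def)
    then show ?thesis using True T
      by (auto simp: paths_def walks_def admissible_edge_def sorted_tuples_def)
  next
    case False
    then show ?thesis using T by (auto simp: paths_def walks_def sorted_tuples_def)
  qed
qed

text \<open>
  A walk whose weight is nonzero satisfies the conditions on every edge and hence is a path.
\<close>

lemma sum_paths_eq_transfer:
  assumes "start_tuple d \<in> sorted_tuples (letters r) d" "end_tuple r d m' \<in> sorted_tuples (letters r) d"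
  shows "(\<Sum>p\<in>paths r d m m'. path_label r m Y p)
    = transfer (sorted_tuples (letters r) d)
       (\<lambda>s a b. if admissible_edge r a b then edge_label r Y (m - s) a b else 0)
       (start_tuple d) m (end_tuple r d m')"
proof -
  let ?T = "sorted_tuples (letters r) d"
  let ?w = "\<lambda>s a b. if admissible_edge r a b then edge_label r Y (m - s) a b else 0"
  let ?W = "walks ?T (start_tuple d) m (end_tuple r d m')"
  have fin: "finite ?T" by (simp add: finite_sorted_tuples)
  have "transfer ?T ?w (start_tuple d) m (end_tuple r d m') = (\<Sum>p\<in>?W. \<Prod>s<m. ?w s (p ! s) (p ! Suc s))"
    by (rule transfer_eq_sum_walks[OF fin assms])
  also have "\<dots> = (\<Sum>p\<in>paths r d m m'. \<Prod>s<m. ?w s (p ! s) (p ! Suc s))"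
    unfolding paths_eq_admissible_walks[OF assms]
    by (rule sum.mono_neutral_right) (auto simp: finite_walks fin)
  also have "\<dots> = (\<Sum>p\<in>paths r d m m'. path_label r m Y p)"
    unfolding paths_eq_admissible_walks[OF assms] path_label_def
    by (intro sum.cong prod.cong refl) auto
  finally show ?thesis by simp
qed

section \<open>Exponentials of nilpotent and of diagonal matrices\<close>

lemma mat_exp_square_zero:
  assumes A: "A \<in> carrier_mat n n" and AA: "A * A = 0\<^sub>m n n"
  shows "mat_exp A = 1\<^sub>m n + A"
proof -
  have pow: "A ^\<^sub>m Suc (Suc k) = 0\<^sub>m n n" for k
  proof (induction k)
    case 0
    then show ?case using A AA by simp
  next
    case (Suc k)
    have "A ^\<^sub>m Suc (Suc (Suc k)) = A ^\<^sub>m Suc (Suc k) * A" by simp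
    then show ?case unfolding Suc.IH using A by simp
  qed
  have ser: "(\<Sum>k. (A ^\<^sub>m k) $$ (i, j) / fact k) = (1\<^sub>m n + A) $$ (i, j)" if "i < n" "j < n" for i j
  proof -
    have "(\<Sum>k. (A ^\<^sub>m k) $$ (i, j) / fact k) = (\<Sum>k\<in>{0, 1}. (A ^\<^sub>m k) $$ (i, j) / fact k)"
    proof (rule suminf_finite)
      fix k :: nat assume "k \<notin> {0, 1}"
      then obtain l where "k = Suc (Suc l)" by (metis insertCI not0_implies_Suc One_nat_def)
      then show "(A ^\<^sub>m k) $$ (i, j) / fact k = 0" using pow[of l] that by simp
    qed simp
    then show ?thesis using A that by simp
  qed
  show ?thesis
    unfolding mat_exp_def by (rule eq_matI) (use A ser in auto)
qed

lemma pow_mat_diag: "mat_diag n f ^\<^sub>m k = mat_diag n (\<lambda>i. f i ^ k :: complex)"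
proof (induction k)
  case 0
  then show ?case by (auto simp: mat_diag_def intro!: eq_matI)
next
  case (Suc k)
  then show ?case by (simp add: mult.commute)
qed

lemma mat_exp_diag: "mat_exp (mat_diag n f) = mat_diag n (\<lambda>i. exp (f i))"
proof -
  have e: "(\<Sum>k. f i ^ k / fact k) = exp (f i)" for i
    unfolding exp_def by (simp add: scaleR_conv_of_real divide_inverse mult.commute)
  have z: "(\<Sum>k. (0 :: complex) / fact k) = 0" by simp
  show ?thesis
    unfolding mat_exp_def pow_mat_diag
    by (rule eq_matI) (auto simp: mat_diag_def e)
qed

section \<open>Fock space\<close>

text \<open>
  A matrix with at most one nonzero entry in every column: the basis state $S$ goes to $c(S)$ times
  the state $f(S)$. Products of such matrices are computed on coefficients and state maps.
\<close>

definition monomial :: "nat \<Rightarrow> (nat \<Rightarrow> complex) \<Rightarrow> (nat \<Rightarrow> nat) \<Rightarrow> complex mat" where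
  "monomial r c f = mat (2^r) (2^r) (\<lambda>(S', S). if S' = f S then c S else 0)"

lemma monomial_carrier [simp]: "monomial r c f \<in> carrier_mat (2^r) (2^r)"
  by (simp add: monomial_def)

lemma monomial_dim [simp]: "dim_row (monomial r c f) = 2^r" "dim_col (monomial r c f) = 2^r"
  by (simp_all add: monomial_def)

lemma monomial_index [simp]:
  "S' < 2^r \<Longrightarrow> S < 2^r \<Longrightarrow> monomial r c f $$ (S', S) = (if S' = f S then c S else 0)"
  by (simp add: monomial_def)

lemma monomial_mult:
  assumes "\<And>S. S < 2^r \<Longrightarrow> c' S \<noteq> 0 \<Longrightarrow> f' S < 2^r"
  shows "monomial r c f * monomial r c' f' = monomial r (\<lambda>S. c (f' S) * c' S) (\<lambda>S. f (f' S))"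
proof (rule eq_matI)
  fix i j assume ij: "i < dim_row (monomial r (\<lambda>S. c (f' S) * c' S) (\<lambda>S. f (f' S)))"
    "j < dim_col (monomial r (\<lambda>S. c (f' S) * c' S) (\<lambda>S. f (f' S)))"
  have "(monomial r c f * monomial r c' f') $$ (i, j)
      = (\<Sum>k<2^r. (if i = f k then c k else 0) * (if k = f' j then c' j else 0))"
    using ij by (auto simp: scalar_prod_def atLeast0LessThan intro!: sum.cong)
  also have "\<dots> = (\<Sum>k<2^r. if k = f' j then (if i = f k then c k else 0) * c' j else 0)"
    by (intro sum.cong) auto
  also have "\<dots> = (if f' j < 2^r then (if i = f (f' j) then c (f' j) else 0) * c' j else 0)"
    by (subst sum.delta) auto
  also have "\<dots> = monomial r (\<lambda>S. c (f' S) * c' S) (\<lambda>S. f (f' S)) $$ (i, j)"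
    using ij assms[of j] by auto
  finally show "(monomial r c f * monomial r c' f') $$ (i, j)
      = monomial r (\<lambda>S. c (f' S) * c' S) (\<lambda>S. f (f' S)) $$ (i, j)" .
qed auto

lemma monomial_cong:
  assumes "\<And>S. S < 2^r \<Longrightarrow> c S = c' S" "\<And>S. S < 2^r \<Longrightarrow> c S \<noteq> 0 \<Longrightarrow> f S = f' S"
  shows "monomial r c f = monomial r c' f'"
  by (rule eq_matI) (use assms in force)+

lemma mat_diag_monomial: "mat_diag (2^r) d = monomial r d (\<lambda>S. S)"
  by (rule eq_matI) (auto simp: mat_diag_def)

lemma nat_less_exp_iff_bits: "S < 2^r \<longleftrightarrow> (\<forall>k. bit S k \<longrightarrow> k < r)" for S :: nat
proof -
  have "S < 2^r \<longleftrightarrow> take_bit r S = S" by (simp add: take_bit_nat_eq_self_iff)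
  also have "\<dots> \<longleftrightarrow> (\<forall>k. bit S k \<longrightarrow> k < r)" by (auto simp: bit_eq_iff bit_take_bit_iff)
  finally show ?thesis .
qed

lemma set_bit_less_exp: "k < r \<Longrightarrow> S < 2^r \<Longrightarrow> set_bit k S < 2^r" for S :: nat
  unfolding nat_less_exp_iff_bits by (auto simp: bit_set_bit_iff)

lemma unset_bit_less_exp: "S < 2^r \<Longrightarrow> unset_bit k S < 2^r" for S :: nat
  unfolding nat_less_exp_iff_bits by (auto simp: bit_unset_bit_iff)

lemma bit_set_nat [simp]: "bit (set_bit k S) l \<longleftrightarrow> bit S l \<or> k = l" for S :: nat
  by (auto simp: bit_set_bit_iff)

lemma bit_unset_nat [simp]: "bit (unset_bit k S) l \<longleftrightarrow> bit S l \<and> k \<noteq> l" for S :: nat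
  by (auto simp: bit_unset_bit_iff)

text \<open>
  The Jordan-Wigner sign, which makes operators of different modes anticommute.
\<close>

definition jw :: "nat \<Rightarrow> nat \<Rightarrow> complex" where
  "jw q S = (-1) ^ card {j. j < q \<and> bit S j}"

lemma jw_square [simp]: "jw q S * jw q S = 1"
  by (simp add: jw_def flip: power_mult_distrib)

lemma jw_nonzero [simp]: "jw q S \<noteq> 0"
  by (simp add: jw_def)

lemma jw_set_bit:
  assumes "\<not> bit S k"
  shows "jw q (set_bit k S) = (if k < q then - jw q S else jw q S)"
proof (cases "k < q")
  case True
  then have "{j. j < q \<and> bit (set_bit k S) j} = insert k {j. j < q \<and> bit S j}" by auto
  then show ?thesis using assms True by (simp add: jw_def)
next
  case False
  then have "{j. j < q \<and> bit (set_bit k S) j} = {j. j < q \<and> bit S j}" by auto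
  then show ?thesis using False by (simp add: jw_def)
qed

lemma jw_unset_bit:
  assumes "bit S k"
  shows "jw q (unset_bit k S) = (if k < q then - jw q S else jw q S)"
proof -
  have "set_bit k (unset_bit k S) = S" by (rule bit_eqI) (use assms in auto)
  then show ?thesis using jw_set_bit[of "unset_bit k S" k q] by auto
qed

lemma jw_Suc: "jw (Suc q) S = (if bit S q then - jw q S else jw q S)"
proof (cases "bit S q")
  case True
  then have "{j. j < Suc q \<and> bit S j} = insert q {j. j < q \<and> bit S j}" by (auto simp: less_Suc_eq)
  then show ?thesis using True by (simp add: jw_def)
next
  case False
  then have "{j. j < Suc q \<and> bit S j} = {j. j < q \<and> bit S j}" by (auto simp: less_Suc_eq)
  then show ?thesis using False by (simp add: jw_def)
qed

lemma creation_monomial: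
  "creation r i = monomial r (\<lambda>S. if bit S (i - 1) then 0 else jw (i - 1) S) (set_bit (i - 1))"
  unfolding creation_def by (rule eq_matI) (auto simp: jw_def set_bit_eq)

lemma annihilation_monomial:
  assumes "1 \<le> i" "i \<le> r"
  shows "annihilation r i = monomial r (\<lambda>S. if bit S (i - 1) then jw (i - 1) S else 0) (unset_bit (i - 1))"
proof (rule eq_matI)
  fix S' S assume "S' < dim_row (monomial r (\<lambda>S. if bit S (i - 1) then jw (i - 1) S else 0) (unset_bit (i - 1)))"
    "S < dim_col (monomial r (\<lambda>S. if bit S (i - 1) then jw (i - 1) S else 0) (unset_bit (i - 1)))"
  then have S: "S' < 2^r" "S < 2^r" by auto
  have iff: "S = set_bit (i - 1) S' \<and> \<not> bit S' (i - 1) \<longleftrightarrow> S' = unset_bit (i - 1) S \<and> bit S (i - 1)"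
    by (auto intro!: bit_eqI)
  show "annihilation r i $$ (S', S) = monomial r (\<lambda>S. if bit S (i - 1) then jw (i - 1) S else 0) (unset_bit (i - 1)) $$ (S', S)"
    using S iff jw_unset_bit[of S "i - 1" "i - 1"]
    by (auto simp: annihilation_def creation_monomial)
qed (auto simp: annihilation_def creation_def)

lemma creation_carrier [simp]: "creation r i \<in> carrier_mat (2^r) (2^r)"
  and annihilation_carrier [simp]: "annihilation r i \<in> carrier_mat (2^r) (2^r)"
  by (simp_all add: creation_def annihilation_def)

lemma set_bit_comm: "set_bit i (set_bit j S) = set_bit j (set_bit i S)" for S :: nat
  by (rule bit_eqI) auto

lemma creation_creation:
  assumes "1 \<le> i" "i \<le> r" "1 \<le> j" "j \<le> r"
  shows "creation r i * creation r j = (-1) \<cdot>\<^sub>m (creation r j * creation r i)"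
proof -
  have lt: "S < 2^r \<Longrightarrow> set_bit (i - 1) S < 2^r" "S < 2^r \<Longrightarrow> set_bit (j - 1) S < 2^r" for S :: nat
    using assms by (auto intro: set_bit_less_exp)
  show ?thesis
    unfolding creation_monomial
    by (subst (1 2) monomial_mult, use lt in force, use lt in force, rule eq_matI)
       (use assms in \<open>auto simp: set_bit_comm[of "i - Suc 0" "j - Suc 0"] jw_set_bit\<close>)
qed

lemma annihilation_annihilation:
  assumes "1 \<le> i" "i \<le> r" "1 \<le> j" "j \<le> r"
  shows "annihilation r i * annihilation r j = (-1) \<cdot>\<^sub>m (annihilation r j * annihilation r i)"
proof -
  have "annihilation r i * annihilation r j = transpose_mat (creation r j * creation r i)"
    unfolding annihilation_def by (rule transpose_mult[symmetric, of _ "2^r" "2^r" _ "2^r"]) auto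
  also have "\<dots> = (-1) \<cdot>\<^sub>m transpose_mat (creation r i * creation r j)"
    unfolding creation_creation[OF assms] by (rule eq_matI) (auto simp: creation_def)
  also have "transpose_mat (creation r i * creation r j) = annihilation r j * annihilation r i"
    unfolding annihilation_def by (rule transpose_mult[of _ "2^r" "2^r" _ "2^r"]) auto
  finally show ?thesis .
qed

text \<open>
  Together with the two lemmas above, the canonical anticommutation relations. The commutators of the
  Chevalley generators with the vectors of the vector representation follow from them.
\<close>

lemma annihilation_creation:
  assumes "1 \<le> i" "i \<le> r" "1 \<le> j" "j \<le> r"
  shows "annihilation r i * creation r j
    = of_bool (i = j) \<cdot>\<^sub>m 1\<^sub>m (2^r) + (-1) \<cdot>\<^sub>m (creation r j * annihilation r i)"
proof -
  have lt: "S < 2^r \<Longrightarrow> set_bit (j - 1) S < 2^r" "S < 2^r \<Longrightarrow> unset_bit (i - 1) S < 2^r" for S :: nat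
    using assms by (auto intro: set_bit_less_exp unset_bit_less_exp)
  have ij: "i - 1 = j - 1 \<longleftrightarrow> i = j" using assms by auto
  have comm: "unset_bit (i - 1) (set_bit (j - 1) S) = set_bit (j - 1) (unset_bit (i - 1) S)" if "i \<noteq> j" for S :: nat
    by (rule bit_eqI) (use that ij in auto)
  have us: "unset_bit (i - 1) (set_bit (i - 1) S) = S" if "\<not> bit S (i - 1)" for S :: nat
    by (rule bit_eqI) (use that in auto)
  have su: "set_bit (i - 1) (unset_bit (i - 1) S) = S" if "bit S (i - 1)" for S :: nat
    by (rule bit_eqI) (use that in auto)
  show ?thesis
    unfolding creation_monomial annihilation_monomial[OF assms(1,2)]
    by (subst (1 2) monomial_mult, use lt in force, use lt in force, rule eq_matI)
       (cases "i = j"; use assms ij comm us su in \<open>auto simp: jw_set_bit jw_unset_bit\<close>)+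
qed

text \<open>
  The operator $\Gamma = (-1)^N$; it anticommutes with all creation and annihilation operators.
\<close>

definition parity :: "nat \<Rightarrow> complex mat" where
  "parity r = mat_diag (2^r) (jw r)"

lemma parity_carrier [simp]: "parity r \<in> carrier_mat (2^r) (2^r)"
  by (simp add: parity_def)

lemma parity_creation:
  assumes "1 \<le> i" "i \<le> r"
  shows "parity r * creation r i = (-1) \<cdot>\<^sub>m (creation r i * parity r)"
  unfolding parity_def mat_diag_monomial creation_monomial
  by (subst (1 2) monomial_mult, use assms in \<open>force intro: set_bit_less_exp\<close>, use assms in \<open>force intro: set_bit_less_exp\<close>, rule eq_matI)
     (use assms in \<open>auto simp: jw_set_bit\<close>)

lemma parity_annihilation:
  assumes "1 \<le> i" "i \<le> r"
  shows "parity r * annihilation r i = (-1) \<cdot>\<^sub>m (annihilation r i * parity r)"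
  unfolding parity_def mat_diag_monomial annihilation_monomial[OF assms]
  by (subst (1 2) monomial_mult, use assms in \<open>force intro: unset_bit_less_exp\<close>, use assms in \<open>force intro: unset_bit_less_exp\<close>, rule eq_matI)
     (use assms in \<open>auto simp: jw_unset_bit\<close>)

section \<open>Chevalley generators\<close>

text \<open>
  The eigenvalue of $h_i$ on the basis state $S$. It is one of $-1, 0, 1$ since the spin
  representation is minuscule, and this is why $e_i$ and $f_i$ have square zero.
\<close>

definition coroot_weight :: "nat \<Rightarrow> nat \<Rightarrow> nat \<Rightarrow> int" where
  "coroot_weight r i S = of_bool (bit S (i - 1)) - (if i < r then of_bool (bit S i) else of_bool (\<not> bit S (i - 1)))"

lemma chev_e_monomial:
  assumes "1 \<le> i" "i < r"
  shows "chev_e r i = monomial r (\<lambda>S. of_bool (bit S i \<and> \<not> bit S (i - 1))) (\<lambda>S. set_bit (i - 1) (unset_bit i S))"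
proof -
  obtain q where q: "i = Suc q" using assms by (cases i) auto
  have "chev_e r i = creation r (Suc q) * annihilation r (Suc (Suc q))"
    using assms by (simp add: chev_e_def q)
  also have "\<dots> = monomial r (\<lambda>S. of_bool (bit S (Suc q) \<and> \<not> bit S q)) (\<lambda>S. set_bit q (unset_bit (Suc q) S))"
    unfolding creation_monomial
    by (subst annihilation_monomial, use assms q in simp, use assms q in simp,
        subst monomial_mult, use q assms in \<open>force intro: unset_bit_less_exp\<close>, intro monomial_cong)
       (auto simp: jw_unset_bit jw_Suc)
  finally show ?thesis by (simp add: q)
qed

lemma chev_f_monomial:
  assumes "1 \<le> i" "i < r"
  shows "chev_f r i = monomial r (\<lambda>S. of_bool (bit S (i - 1) \<and> \<not> bit S i)) (\<lambda>S. set_bit i (unset_bit (i - 1) S))"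
proof -
  obtain q where q: "i = Suc q" using assms by (cases i) auto
  have "chev_f r i = creation r (Suc (Suc q)) * annihilation r (Suc q)"
    using assms by (simp add: chev_f_def q)
  also have "\<dots> = monomial r (\<lambda>S. of_bool (bit S q \<and> \<not> bit S (Suc q))) (\<lambda>S. set_bit (Suc q) (unset_bit q S))"
    unfolding creation_monomial
    by (subst annihilation_monomial, use assms q in simp, use assms q in simp,
        subst monomial_mult, use q assms in \<open>force intro: unset_bit_less_exp\<close>, intro monomial_cong)
       (auto simp: jw_unset_bit jw_Suc)
  finally show ?thesis by (simp add: q)
qed

lemma chev_e_last: "chev_e r r = creation r r"
  and chev_f_last: "chev_f r r = annihilation r r"
  by (simp_all add: chev_e_def chev_f_def)

lemma mult_carrier_square [simp]:
  "A \<in> carrier_mat n n \<Longrightarrow> B \<in> carrier_mat n n \<Longrightarrow> A * B \<in> carrier_mat n n"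
  by simp

lemma chev_e_carrier [simp]: "chev_e r i \<in> carrier_mat (2^r) (2^r)"
  and chev_f_carrier [simp]: "chev_f r i \<in> carrier_mat (2^r) (2^r)"
  by (simp_all add: chev_e_def chev_f_def)

lemma chev_e_chev_f:
  assumes "1 \<le> i" "i \<le> r"
  shows "chev_e r i * chev_f r i = mat_diag (2^r) (\<lambda>S. of_bool (coroot_weight r i S = 1))"
proof (cases "i = r")
  case True
  have su: "set_bit (r - 1) (unset_bit (r - 1) S) = S" if "bit S (r - 1)" for S :: nat
    by (rule bit_eqI) (use that in auto)
  show ?thesis unfolding True chev_e_last chev_f_last mat_diag_monomial creation_monomial
    by (subst annihilation_monomial, use assms True in simp, use assms True in simp,
        subst monomial_mult, use assms True in \<open>force intro: unset_bit_less_exp\<close>, intro monomial_cong)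
       (use su in \<open>auto simp: jw_unset_bit coroot_weight_def split: if_splits\<close>)
next
  case False
  then have i: "1 \<le> i" "i < r" using assms by auto
  have su: "set_bit (i - 1) (unset_bit i (set_bit i (unset_bit (i - 1) S))) = S"
    if "bit S (i - 1)" "\<not> bit S i" for S :: nat
    by (rule bit_eqI) (use that i in auto)
  show ?thesis unfolding chev_e_monomial[OF i] chev_f_monomial[OF i] mat_diag_monomial
    by (subst monomial_mult, use i in \<open>force intro: unset_bit_less_exp set_bit_less_exp\<close>, intro monomial_cong)
       (use su i in \<open>auto simp: coroot_weight_def\<close>)
qed

lemma chev_f_chev_e:
  assumes "1 \<le> i" "i \<le> r"
  shows "chev_f r i * chev_e r i = mat_diag (2^r) (\<lambda>S. of_bool (coroot_weight r i S = -1))"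
proof (cases "i = r")
  case True
  have su: "unset_bit (r - 1) (set_bit (r - 1) S) = S" if "\<not> bit S (r - 1)" for S :: nat
    by (rule bit_eqI) (use that in auto)
  show ?thesis unfolding True chev_e_last chev_f_last mat_diag_monomial creation_monomial
    by (subst annihilation_monomial, use assms True in simp, use assms True in simp,
        subst monomial_mult, use assms True in \<open>force intro: set_bit_less_exp\<close>, intro monomial_cong)
       (use su in \<open>auto simp: jw_set_bit coroot_weight_def split: if_splits\<close>)
next
  case False
  then have i: "1 \<le> i" "i < r" using assms by auto
  have su: "set_bit i (unset_bit (i - 1) (set_bit (i - 1) (unset_bit i S))) = S"
    if "\<not> bit S (i - 1)" "bit S i" for S :: nat
    by (rule bit_eqI) (use that i in auto)
  show ?thesis unfolding chev_e_monomial[OF i] chev_f_monomial[OF i] mat_diag_monomial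
    by (subst monomial_mult, use i in \<open>force intro: unset_bit_less_exp set_bit_less_exp\<close>, intro monomial_cong)
       (use su i in \<open>auto simp: coroot_weight_def\<close>)
qed

lemma chev_efe:
  assumes "1 \<le> i" "i \<le> r"
  shows "chev_e r i * (chev_f r i * chev_e r i) = chev_e r i"
proof (cases "i = r")
  case True
  show ?thesis unfolding chev_f_chev_e[OF assms] unfolding True chev_e_last creation_monomial mat_diag_monomial
    by (subst monomial_mult, simp, intro monomial_cong) (auto simp: coroot_weight_def)
next
  case False
  then have i: "1 \<le> i" "i < r" using assms by auto
  show ?thesis unfolding chev_f_chev_e[OF assms] unfolding chev_e_monomial[OF i] mat_diag_monomial
    by (subst monomial_mult, simp, intro monomial_cong) (use i in \<open>auto simp: coroot_weight_def\<close>)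
qed

lemma chev_fef:
  assumes "1 \<le> i" "i \<le> r"
  shows "chev_f r i * (chev_e r i * chev_f r i) = chev_f r i"
proof (cases "i = r")
  case True
  show ?thesis unfolding chev_e_chev_f[OF assms] unfolding True chev_f_last mat_diag_monomial
    by (subst (1 2) annihilation_monomial, use assms True in simp, use assms True in simp,
        subst monomial_mult, simp, intro monomial_cong) (auto simp: coroot_weight_def)
next
  case False
  then have i: "1 \<le> i" "i < r" using assms by auto
  show ?thesis unfolding chev_e_chev_f[OF assms] unfolding chev_f_monomial[OF i] mat_diag_monomial
    by (subst monomial_mult, simp, intro monomial_cong) (use i in \<open>auto simp: coroot_weight_def\<close>)
qed

lemma monomial_zero: "(\<And>S. S < 2^r \<Longrightarrow> c S = 0) \<Longrightarrow> monomial r c f = 0\<^sub>m (2^r) (2^r)"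
  by (rule eq_matI) auto

lemma chev_e_square:
  assumes "1 \<le> i" "i \<le> r"
  shows "chev_e r i * chev_e r i = 0\<^sub>m (2^r) (2^r)"
proof (cases "i = r")
  case True
  show ?thesis unfolding True chev_e_last creation_monomial
    by (subst monomial_mult, use assms True in \<open>force intro: set_bit_less_exp\<close>, intro monomial_zero) auto
next
  case False
  then have i: "1 \<le> i" "i < r" using assms by auto
  show ?thesis unfolding chev_e_monomial[OF i]
    by (subst monomial_mult, use i in \<open>force intro: unset_bit_less_exp set_bit_less_exp\<close>, intro monomial_zero) auto
qed

lemma chev_f_square:
  assumes "1 \<le> i" "i \<le> r"
  shows "chev_f r i * chev_f r i = 0\<^sub>m (2^r) (2^r)"
proof (cases "i = r")
  case True
  show ?thesis unfolding True chev_f_last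
    by (subst (1 2) annihilation_monomial, use assms True in simp, use assms True in simp,
        subst monomial_mult, use assms True in \<open>force intro: unset_bit_less_exp\<close>, intro monomial_zero) auto
next
  case False
  then have i: "1 \<le> i" "i < r" using assms by auto
  show ?thesis unfolding chev_f_monomial[OF i]
    by (subst monomial_mult, use i in \<open>force intro: unset_bit_less_exp set_bit_less_exp\<close>, intro monomial_zero) auto
qed

section \<open>The one-parameter subgroups\<close>

lemma x_pos_eq:
  assumes "1 \<le> i" "i \<le> r"
  shows "x_pos r i t = 1\<^sub>m (2^r) + t \<cdot>\<^sub>m chev_e r i"
  unfolding x_pos_def
proof (rule mat_exp_square_zero)
  show "t \<cdot>\<^sub>m chev_e r i * (t \<cdot>\<^sub>m chev_e r i) = 0\<^sub>m (2^r) (2^r)"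
    by (simp add: mult_smult_distrib[of _ "2^r" "2^r" _ "2^r"] mult_smult_assoc_mat[of _ "2^r" "2^r" _ "2^r"] chev_e_square[OF assms])
qed simp

lemma y_neg_eq:
  assumes "1 \<le> i" "i \<le> r"
  shows "y_neg r i t = 1\<^sub>m (2^r) + t \<cdot>\<^sub>m chev_f r i"
  unfolding y_neg_def
proof (rule mat_exp_square_zero)
  show "t \<cdot>\<^sub>m chev_f r i * (t \<cdot>\<^sub>m chev_f r i) = 0\<^sub>m (2^r) (2^r)"
    by (simp add: mult_smult_distrib[of _ "2^r" "2^r" _ "2^r"] mult_smult_assoc_mat[of _ "2^r" "2^r" _ "2^r"] chev_f_square[OF assms])
qed simp

lemma chev_h_eq:
  assumes "1 \<le> i" "i \<le> r"
  shows "chev_h r i = mat_diag (2^r) (\<lambda>S. of_int (coroot_weight r i S))"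
proof -
  have "coroot_weight r i S \<in> {-1, 0, 1}" for S by (auto simp: coroot_weight_def)
  then show ?thesis unfolding chev_h_def chev_e_chev_f[OF assms] chev_f_chev_e[OF assms]
    by (intro eq_matI) (fastforce simp: mat_diag_def)+
qed

lemma coroot_eq:
  assumes "1 \<le> i" "i \<le> r" "t \<noteq> 0"
  shows "coroot r i t = mat_diag (2^r) (\<lambda>S. t powi coroot_weight r i S)"
proof -
  have "Ln t \<cdot>\<^sub>m chev_h r i = mat_diag (2^r) (\<lambda>S. Ln t * of_int (coroot_weight r i S))"
    unfolding chev_h_eq[OF assms(1,2)] by (rule eq_matI) (auto simp: mat_diag_def)
  moreover have "exp (Ln t * of_int k) = t powi k" for k
    using assms(3) exp_Ln[of t] exp_power_int[of "Ln t" k] by (simp add: mult.commute)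
  ultimately show ?thesis unfolding coroot_def by (simp add: mat_exp_diag)
qed

lemma x_pos_carrier [simp]: "1 \<le> i \<Longrightarrow> i \<le> r \<Longrightarrow> x_pos r i t \<in> carrier_mat (2^r) (2^r)"
  by (simp add: x_pos_eq)

lemma y_neg_carrier [simp]: "1 \<le> i \<Longrightarrow> i \<le> r \<Longrightarrow> y_neg r i t \<in> carrier_mat (2^r) (2^r)"
  by (simp add: y_neg_eq)

lemma coroot_carrier [simp]: "1 \<le> i \<Longrightarrow> i \<le> r \<Longrightarrow> t \<noteq> 0 \<Longrightarrow> coroot r i t \<in> carrier_mat (2^r) (2^r)"
  by (simp add: coroot_eq)

section \<open>Commutation rules\<close>

lemmas square_mat_ring =
  assoc_mult_mat[of _ n n _ n _ n] add_mult_distrib_mat[of _ n n _ _ n] mult_add_distrib_mat[of _ n n _ n]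
  mult_smult_distrib[of _ n n _ n] mult_smult_assoc_mat[of _ n n _ n] for n

lemma square_mat_unit_zero [simp]:
  fixes A :: "'a::comm_ring_1 mat"
  assumes "A \<in> carrier_mat n n"
  shows "1\<^sub>m n * A = A" "A * 1\<^sub>m n = A" "0\<^sub>m n n * A = 0\<^sub>m n n" "A * 0\<^sub>m n n = 0\<^sub>m n n"
    "A + 0\<^sub>m n n = A" "0\<^sub>m n n + A = A"
  using assms by auto

lemma bilinear_commute_right:
  fixes A B C :: "complex mat"
  assumes [simp]: "A \<in> carrier_mat n n" "B \<in> carrier_mat n n" "C \<in> carrier_mat n n"
    and BC: "B * C = k \<cdot>\<^sub>m 1\<^sub>m n + (-1) \<cdot>\<^sub>m (C * B)" and AC: "A * C = (-1) \<cdot>\<^sub>m (C * A)"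
  shows "A * B * C = C * (A * B) + k \<cdot>\<^sub>m A"
proof -
  note [simp] = assms(1-3)[THEN carrier_matD(1)] assms(1-3)[THEN carrier_matD(2)]
  note R = square_mat_ring[where n = n]
  have "A * B * C = A * (B * C)" by (simp add: R)
  also have "\<dots> = k \<cdot>\<^sub>m A + (-1) \<cdot>\<^sub>m (A * C * B)" unfolding BC by (simp add: R)
  also have "A * C * B = (-1) \<cdot>\<^sub>m (C * (A * B))" unfolding AC by (simp add: R)
  finally show ?thesis by simp (rule eq_matI, simp_all add: algebra_simps del: index_mult_mat(1))
qed

lemma bilinear_commute_left:
  fixes A B C :: "complex mat"
  assumes [simp]: "A \<in> carrier_mat n n" "B \<in> carrier_mat n n" "C \<in> carrier_mat n n"
    and BC: "B * C = (-1) \<cdot>\<^sub>m (C * B)" and AC: "A * C = k \<cdot>\<^sub>m 1\<^sub>m n + (-1) \<cdot>\<^sub>m (C * A)"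
  shows "A * B * C = C * (A * B) + (- k) \<cdot>\<^sub>m B"
proof -
  note [simp] = assms(1-3)[THEN carrier_matD(1)] assms(1-3)[THEN carrier_matD(2)]
  note R = square_mat_ring[where n = n]
  have "A * B * C = A * (B * C)" by (simp add: R)
  also have "\<dots> = (-1) \<cdot>\<^sub>m (A * C * B)" unfolding BC by (simp add: R)
  also have "A * C * B = k \<cdot>\<^sub>m B + (-1) \<cdot>\<^sub>m (C * (A * B))" unfolding AC by (simp add: R)
  finally show ?thesis by simp (rule eq_matI, simp_all add: algebra_simps del: index_mult_mat(1))
qed

lemma quasi_commute_mult:
  fixes A B X :: "complex mat"
  assumes [simp]: "A \<in> carrier_mat n n" "B \<in> carrier_mat n n" "X \<in> carrier_mat n n"
    and XA: "X * A = s \<cdot>\<^sub>m (A * X)" and XB: "X * B = t \<cdot>\<^sub>m (B * X)"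
  shows "X * (A * B) = (s * t) \<cdot>\<^sub>m (A * B * X)"
proof -
  note [simp] = assms(1-3)[THEN carrier_matD(1)] assms(1-3)[THEN carrier_matD(2)]
  note R = assoc_mult_mat[of _ n n _ n _ n] mult_smult_distrib[of _ n n _ n] mult_smult_assoc_mat[of _ n n _ n]
  have "X * (A * B) = X * A * B" by (simp add: R)
  also have "\<dots> = s \<cdot>\<^sub>m (A * (X * B))" unfolding XA by (simp add: R)
  also have "\<dots> = s \<cdot>\<^sub>m (t \<cdot>\<^sub>m (A * B * X))" unfolding XB by (simp add: R)
  finally show ?thesis by simp (rule eq_matI, simp_all add: algebra_simps del: index_mult_mat(1))
qed

text \<open>
  If $[E, A] = kB$ and $BE = 0$, the conjugate of $A$ by $1 + tE$ is $A + tkB$. This handles the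
  generators of the simple roots $\alpha_i$ with $i < r$, which are bilinear in the modes; the even
  operator $E$ passes through $G = \Gamma$.
\<close>

lemma intertwine_derivation:
  fixes A B E G :: "complex mat"
  assumes [simp]: "A \<in> carrier_mat n n" "B \<in> carrier_mat n n" "E \<in> carrier_mat n n" "G \<in> carrier_mat n n"
    and EA: "E * A = A * E + k \<cdot>\<^sub>m B" and BE: "B * E = 0\<^sub>m n n" and EG: "E * G = G * E"
  shows "(1\<^sub>m n + t \<cdot>\<^sub>m E) * (A * G) = (A * G + (t * k) \<cdot>\<^sub>m (B * G)) * (1\<^sub>m n + t \<cdot>\<^sub>m E)"
proof -
  note [simp] = assms(1-4)[THEN carrier_matD(1)] assms(1-4)[THEN carrier_matD(2)]
  note R = square_mat_ring[where n = n]
  have "E * (A * G) = (E * A) * G" by (simp add: R)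
  also have "\<dots> = A * (E * G) + k \<cdot>\<^sub>m (B * G)" unfolding EA by (simp add: R)
  finally have 1: "E * (A * G) = A * (G * E) + k \<cdot>\<^sub>m (B * G)" unfolding EG .
  have "B * (G * E) = (B * E) * G" unfolding EG[symmetric] by (simp add: R)
  then have 2: "B * (G * E) = 0\<^sub>m n n" unfolding BE by simp
  show ?thesis by (simp add: R 1 2) (rule eq_matI, simp_all add: algebra_simps del: index_mult_mat(1))
qed

text \<open>
  The short root: $E$ and $F$ are a creation operator and its annihilation operator (in either order)
  and $G = \Gamma$ anticommutes with $E$. Conjugation by $1 + tE$ acts as the three-dimensional
  representation of $\mathrm{SL}_2$ on $FG, G, EG$.
\<close>

lemma intertwine_odd:
  fixes E F G :: "complex mat"
  assumes [simp]: "E \<in> carrier_mat n n" "F \<in> carrier_mat n n" "G \<in> carrier_mat n n"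
    and EE: "E * E = 0\<^sub>m n n" and EF: "E * F = 1\<^sub>m n + (-1) \<cdot>\<^sub>m (F * E)"
    and GE: "G * E = (-1) \<cdot>\<^sub>m (E * G)"
  shows "(1\<^sub>m n + t \<cdot>\<^sub>m E) * G = (G + (2 * t) \<cdot>\<^sub>m (E * G)) * (1\<^sub>m n + t \<cdot>\<^sub>m E)"
    and "(1\<^sub>m n + t \<cdot>\<^sub>m E) * (F * G) = (F * G + t \<cdot>\<^sub>m G + t\<^sup>2 \<cdot>\<^sub>m (E * G)) * (1\<^sub>m n + t \<cdot>\<^sub>m E)"
proof -
  note [simp] = assms(1-3)[THEN carrier_matD(1)] assms(1-3)[THEN carrier_matD(2)]
  note R = square_mat_ring[where n = n]
  have EEG: "E * (E * G) = 0\<^sub>m n n" using R(1)[of E E G] EE by simp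
  have 1: "E * (F * G) = G + (-1) \<cdot>\<^sub>m (F * (E * G))"
  proof -
    have "E * (F * G) = (E * F) * G" by (simp add: R)
    also have "\<dots> = G + (-1) \<cdot>\<^sub>m (F * (E * G))" unfolding EF by (simp add: R)
    finally show ?thesis .
  qed
  show "(1\<^sub>m n + t \<cdot>\<^sub>m E) * G = (G + (2 * t) \<cdot>\<^sub>m (E * G)) * (1\<^sub>m n + t \<cdot>\<^sub>m E)"
    by (simp add: R GE EEG) (rule eq_matI, simp_all add: algebra_simps del: index_mult_mat(1))
  show "(1\<^sub>m n + t \<cdot>\<^sub>m E) * (F * G) = (F * G + t \<cdot>\<^sub>m G + t\<^sup>2 \<cdot>\<^sub>m (E * G)) * (1\<^sub>m n + t \<cdot>\<^sub>m E)"
    by (simp add: R GE EEG 1) (rule eq_matI, simp_all add: algebra_simps power2_eq_square del: index_mult_mat(1))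
qed

text \<open>
  The Gauss decomposition of a $2 \times 2$ matrix in operators: $E F$ and $F E$ are the projections
  onto the highest and the lowest weight vectors of the doublets, so the middle factor is the diagonal
  matrix with $u$ and $1/u$ on the doublets and $1$ elsewhere.
\<close>

lemma rank_one_gauss:
  fixes E F :: "complex mat"
  assumes [simp]: "E \<in> carrier_mat n n" "F \<in> carrier_mat n n"
    and EE: "E * E = 0\<^sub>m n n" and FF: "F * F = 0\<^sub>m n n"
    and EFE: "E * (F * E) = E" and FEF: "F * (E * F) = F" and u: "u = 1 + a * b" "u \<noteq> 0"
  shows "(1\<^sub>m n + a \<cdot>\<^sub>m E) * (1\<^sub>m n + b \<cdot>\<^sub>m F)
    = (1\<^sub>m n + (b / u) \<cdot>\<^sub>m F) * ((1\<^sub>m n + (u - 1) \<cdot>\<^sub>m (E * F) + (1 / u - 1) \<cdot>\<^sub>m (F * E)) * (1\<^sub>m n + (a / u) \<cdot>\<^sub>m E))"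
proof -
  note [simp] = assms(1-2)[THEN carrier_matD(1)] assms(1-2)[THEN carrier_matD(2)]
  note R = square_mat_ring[where n = n]
  define D where "D = 1\<^sub>m n + (u - 1) \<cdot>\<^sub>m (E * F) + (1 / u - 1) \<cdot>\<^sub>m (F * E)"
  have FFE: "F * (F * E) = 0\<^sub>m n n" using R(1)[of F F E] FF by simp
  have DE: "D * E = u \<cdot>\<^sub>m E" unfolding D_def by (simp add: R EE EFE) (rule eq_matI, simp_all add: algebra_simps del: index_mult_mat(1))
  have FD: "F * D = u \<cdot>\<^sub>m F" unfolding D_def by (simp add: R FFE FEF) (rule eq_matI, simp_all add: algebra_simps del: index_mult_mat(1))
  have [simp]: "D \<in> carrier_mat n n" by (simp add: D_def)
  have "(1\<^sub>m n + (b / u) \<cdot>\<^sub>m F) * (D * (1\<^sub>m n + (a / u) \<cdot>\<^sub>m E)) = D + a \<cdot>\<^sub>m E + b \<cdot>\<^sub>m F + (a * b / u) \<cdot>\<^sub>m (F * E)"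
    using u(2) by (simp add: R DE FD) (rule eq_matI, simp_all add: field_simps del: index_mult_mat(1))
  also have "\<dots> = (1\<^sub>m n + a \<cdot>\<^sub>m E) * (1\<^sub>m n + b \<cdot>\<^sub>m F)"
  proof -
    have "1 / u - 1 + a * b / u = 0" using u by (simp add: field_simps)
    then have "(1 / u - 1) * x + (a * b / u) * x = 0" for x by (metis distrib_right mult_zero_left)
    then have z: "(1 / u - 1) * x = - ((a * b / u) * x)" for x by (simp add: eq_neg_iff_add_eq_0)
    show ?thesis unfolding D_def
      by (simp add: R) (rule eq_matI, simp_all add: z del: index_mult_mat(1), simp_all add: u(1) algebra_simps del: index_mult_mat(1))
  qed
  finally show ?thesis by (simp add: D_def)
qed

lemma one_smult_mat [simp]: "1 \<cdot>\<^sub>m (A :: complex mat) = A"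
  by (rule eq_matI) auto

lemma fock_dims [simp]:
  "dim_row (creation r i) = 2^r" "dim_col (creation r i) = 2^r"
  "dim_row (annihilation r i) = 2^r" "dim_col (annihilation r i) = 2^r"
  "dim_row (parity r) = 2^r" "dim_col (parity r) = 2^r"
  by (simp_all add: creation_def annihilation_def parity_def mat_diag_def)

text \<open>
  Up to the choice of the two modes, these are the root vectors $e_i$ and $f_i$ for $i < r$.
\<close>

definition hop :: "nat \<Rightarrow> nat \<Rightarrow> nat \<Rightarrow> complex mat" where
  "hop r p q = creation r p * annihilation r q"

lemma hop_carrier [simp]: "hop r p q \<in> carrier_mat (2^r) (2^r)"
  by (simp add: hop_def)

lemma creation_square:
  assumes "1 \<le> i" "i \<le> r"
  shows "creation r i * creation r i = 0\<^sub>m (2^r) (2^r)"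
  unfolding creation_monomial
  by (subst monomial_mult, use assms in \<open>force intro: set_bit_less_exp\<close>, intro monomial_zero) auto

lemma annihilation_square:
  assumes "1 \<le> i" "i \<le> r"
  shows "annihilation r i * annihilation r i = 0\<^sub>m (2^r) (2^r)"
  unfolding annihilation_monomial[OF assms]
  by (subst monomial_mult, use assms in \<open>force intro: unset_bit_less_exp\<close>, intro monomial_zero) auto

lemma creation_annihilation:
  assumes "1 \<le> i" "i \<le> r" "1 \<le> j" "j \<le> r"
  shows "creation r i * annihilation r j
    = of_bool (i = j) \<cdot>\<^sub>m 1\<^sub>m (2^r) + (-1) \<cdot>\<^sub>m (annihilation r j * creation r i)"
  unfolding annihilation_creation[OF assms(3,4,1,2)]
  by (rule eq_matI) (auto simp: algebra_simps)

lemma hop_creation: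
  assumes "1 \<le> p" "p \<le> r" "1 \<le> q" "q \<le> r" "1 \<le> j" "j \<le> r"
  shows "hop r p q * creation r j = creation r j * hop r p q + of_bool (q = j) \<cdot>\<^sub>m creation r p"
  unfolding hop_def using assms
  by (intro bilinear_commute_right[of _ "2^r"] annihilation_creation creation_creation) auto

lemma hop_annihilation:
  assumes "1 \<le> p" "p \<le> r" "1 \<le> q" "q \<le> r" "1 \<le> j" "j \<le> r"
  shows "hop r p q * annihilation r j = annihilation r j * hop r p q + (- of_bool (p = j)) \<cdot>\<^sub>m annihilation r q"
  unfolding hop_def using assms
  by (intro bilinear_commute_left[of _ "2^r"] annihilation_annihilation creation_annihilation) auto

lemma creation_hop:
  assumes "1 \<le> p" "p \<le> r"
  shows "creation r p * hop r p q = 0\<^sub>m (2^r) (2^r)"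
proof -
  have "creation r p * hop r p q = creation r p * creation r p * annihilation r q"
    unfolding hop_def by (rule assoc_mult_mat[symmetric, of _ "2^r" "2^r" _ "2^r" _ "2^r"]) auto
  then show ?thesis by (simp add: creation_square[OF assms])
qed

lemma annihilation_hop:
  assumes "1 \<le> p" "p \<le> r" "1 \<le> q" "q \<le> r" "p \<noteq> q"
  shows "annihilation r q * hop r p q = 0\<^sub>m (2^r) (2^r)"
proof -
  have "annihilation r q * hop r p q = hop r p q * annihilation r q"
    using hop_annihilation[OF assms(1-4,3,4)] assms(5) by (intro eq_matI) (auto simp: hop_def)
  also have "\<dots> = creation r p * (annihilation r q * annihilation r q)"
    unfolding hop_def by (rule assoc_mult_mat[of _ "2^r" "2^r" _ "2^r" _ "2^r"]) auto
  finally show ?thesis by (simp add: annihilation_square[OF assms(3,4)])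
qed

lemma hop_parity:
  assumes "1 \<le> p" "p \<le> r" "1 \<le> q" "q \<le> r"
  shows "hop r p q * parity r = parity r * hop r p q"
  unfolding hop_def
  using quasi_commute_mult[of "creation r p" "2^r" "annihilation r q" "parity r" "-1" "-1"]
    parity_creation[OF assms(1,2)] parity_annihilation[OF assms(3,4)]
  by (simp del: assoc_mult_mat)

section \<open>The vector representation\<close>

text \<open>
  The basis of the vector representation. Multiplication by $\Gamma$ makes the span stable: the bracket
  of $a_r$ with $a_r^\dagger$ is not central, while
  $[a_r, a_r^\dagger \Gamma] = \Gamma$ and $[a_r, \Gamma] = 2 a_r \Gamma$. The signs of the barred
  vectors are chosen such that every $f_i$ maps basis vectors to nonnegative multiples of basis
  vectors.
\<close>

definition vect :: "nat \<Rightarrow> letter \<Rightarrow> complex mat" where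
  "vect r a = (case a of Plain j \<Rightarrow> creation r j * parity r | Nul \<Rightarrow> parity r
     | Bar j \<Rightarrow> (-1) ^ (r - j) \<cdot>\<^sub>m (annihilation r j * parity r))"

lemma vect_carrier [simp]: "vect r a \<in> carrier_mat (2^r) (2^r)"
  by (cases a) (simp_all add: vect_def)

lemma vect_dims [simp]: "dim_row (vect r a) = 2^r" "dim_col (vect r a) = 2^r"
  using vect_carrier[of r a] by (auto simp del: vect_carrier)

definition lin :: "nat \<Rightarrow> (letter \<Rightarrow> complex) \<Rightarrow> complex mat" where
  "lin r c = mat (2^r) (2^r) (\<lambda>(i, j). \<Sum>b\<in>letters r. c b * vect r b $$ (i, j))"

lemma lin_carrier [simp]: "lin r c \<in> carrier_mat (2^r) (2^r)"
  by (simp add: lin_def)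

lemma lin_dims [simp]: "dim_row (lin r c) = 2^r" "dim_col (lin r c) = 2^r"
  by (simp_all add: lin_def)

lemma lin_index [simp]:
  "i < 2^r \<Longrightarrow> j < 2^r \<Longrightarrow> lin r c $$ (i, j) = (\<Sum>b\<in>letters r. c b * vect r b $$ (i, j))"
  by (simp add: lin_def)

lemma lin_cong: "(\<And>b. b \<in> letters r \<Longrightarrow> c b = c' b) \<Longrightarrow> lin r c = lin r c'"
  by (rule eq_matI) auto

lemma lin_1:
  assumes "a \<in> letters r"
  shows "lin r (\<lambda>b. if b = a then x else 0) = x \<cdot>\<^sub>m vect r a"
  by (rule eq_matI) (use assms in \<open>auto simp: if_distrib[of "\<lambda>x. x * _"] sum.delta cong: if_cong\<close>)

lemma lin_add: "lin r c + lin r c' = lin r (\<lambda>b. c b + c' b)"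
  by (rule eq_matI) (auto simp: sum.distrib algebra_simps)

lemma lin_2:
  assumes "a \<in> letters r" "a' \<in> letters r" "a \<noteq> a'"
  shows "lin r (\<lambda>b. if b = a then x else if b = a' then x' else 0) = x \<cdot>\<^sub>m vect r a + x' \<cdot>\<^sub>m vect r a'"
  unfolding lin_1[OF assms(1), symmetric] lin_1[OF assms(2), symmetric] lin_add
  by (rule lin_cong) (use assms in auto)

lemma lin_3:
  assumes "a \<in> letters r" "a' \<in> letters r" "a'' \<in> letters r" "a \<noteq> a'" "a \<noteq> a''" "a' \<noteq> a''"
  shows "lin r (\<lambda>b. if b = a then x else if b = a' then x' else if b = a'' then x'' else 0)
    = x \<cdot>\<^sub>m vect r a + x' \<cdot>\<^sub>m vect r a' + x'' \<cdot>\<^sub>m vect r a''"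
  unfolding lin_1[OF assms(1), symmetric] lin_1[OF assms(2), symmetric] lin_1[OF assms(3), symmetric] lin_add
  by (rule lin_cong) (use assms in auto)

text \<open>
  The relation $g v_a g^{-1} = \sum_b M_{ba} v_b$, free of inverses.
\<close>

definition intertwines :: "nat \<Rightarrow> complex mat \<Rightarrow> (letter \<Rightarrow> letter \<Rightarrow> complex) \<Rightarrow> bool" where
  "intertwines r g M \<longleftrightarrow> g \<in> carrier_mat (2^r) (2^r) \<and>
     (\<forall>a\<in>letters r. g * vect r a = lin r (\<lambda>b. M b a) * g)"

definition letter_comp :: "nat \<Rightarrow> (letter \<Rightarrow> letter \<Rightarrow> complex) \<Rightarrow> (letter \<Rightarrow> letter \<Rightarrow> complex) \<Rightarrow> letter \<Rightarrow> letter \<Rightarrow> complex" where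
  "letter_comp r A B b a = (\<Sum>c\<in>letters r. A b c * B c a)"

lemma intertwines_lin:
  assumes "intertwines r g M"
  shows "g * lin r c = lin r (\<lambda>b. \<Sum>a\<in>letters r. M b a * c a) * g"
proof (rule eq_matI)
  have g: "g \<in> carrier_mat (2^r) (2^r)" using assms by (simp add: intertwines_def)
  fix i j assume "i < dim_row (lin r (\<lambda>b. \<Sum>a\<in>letters r. M b a * c a) * g)"
    "j < dim_col (lin r (\<lambda>b. \<Sum>a\<in>letters r. M b a * c a) * g)"
  then have ij: "i < 2^r" "j < 2^r" using g by auto
  have prod: "(A * B) $$ (i, j) = (\<Sum>k<2^r. A $$ (i, k) * B $$ (k, j))"
    if "A \<in> carrier_mat (2^r) (2^r)" "B \<in> carrier_mat (2^r) (2^r)" for A B :: "complex mat"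
    using that ij by (auto simp: scalar_prod_def atLeast0LessThan intro!: sum.cong)
  have "(g * lin r c) $$ (i, j) = (\<Sum>k<2^r. \<Sum>a\<in>letters r. c a * (g $$ (i, k) * vect r a $$ (k, j)))"
    using ij g by (auto simp: prod sum_distrib_left algebra_simps simp del: index_mult_mat(1) intro!: sum.cong)
  also have "\<dots> = (\<Sum>a\<in>letters r. c a * (g * vect r a) $$ (i, j))"
    by (subst sum.swap) (simp add: prod g sum_distrib_left del: index_mult_mat(1))
  also have "\<dots> = (\<Sum>a\<in>letters r. c a * (lin r (\<lambda>b. M b a) * g) $$ (i, j))"
    using assms by (intro sum.cong refl) (simp add: intertwines_def del: index_mult_mat)
  also have "\<dots> = (\<Sum>a\<in>letters r. \<Sum>k<2^r. \<Sum>b\<in>letters r. M b a * c a * vect r b $$ (i, k) * g $$ (k, j))"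
    using ij g by (auto simp: prod sum_distrib_left sum_distrib_right algebra_simps simp del: index_mult_mat(1) intro!: sum.cong)
  also have "\<dots> = (\<Sum>k<2^r. \<Sum>b\<in>letters r. \<Sum>a\<in>letters r. M b a * c a * vect r b $$ (i, k) * g $$ (k, j))"
    by (subst sum.swap) (rule sum.cong[OF refl], rule sum.swap)
  also have "\<dots> = (lin r (\<lambda>b. \<Sum>a\<in>letters r. M b a * c a) * g) $$ (i, j)"
    using ij g by (simp add: prod sum_distrib_right del: index_mult_mat(1))
  finally show "(g * lin r c) $$ (i, j) = (lin r (\<lambda>b. \<Sum>a\<in>letters r. M b a * c a) * g) $$ (i, j)" .
qed (use assms in \<open>auto simp: intertwines_def\<close>)

lemma intertwines_mult:
  assumes g: "intertwines r g A" and h: "intertwines r h B"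
  shows "intertwines r (g * h) (letter_comp r A B)"
  unfolding intertwines_def
proof (intro conjI ballI)
  have [simp]: "g \<in> carrier_mat (2^r) (2^r)" "h \<in> carrier_mat (2^r) (2^r)"
    using g h by (auto simp: intertwines_def)
  note R = assoc_mult_mat[of _ "2^r" "2^r" _ "2^r" _ "2^r"]
  show "g * h \<in> carrier_mat (2^r) (2^r)" by simp
  fix a assume "a \<in> letters r"
  then have "g * h * vect r a = g * (lin r (\<lambda>b. B b a) * h)"
    using h by (simp add: R intertwines_def)
  also have "\<dots> = (g * lin r (\<lambda>b. B b a)) * h" by (simp add: R)
  also have "\<dots> = lin r (\<lambda>b. letter_comp r A B b a) * (g * h)"
    unfolding intertwines_lin[OF g] by (simp add: R letter_comp_def)
  finally show "g * h * vect r a = lin r (\<lambda>b. letter_comp r A B b a) * (g * h)" .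
qed

text \<open>
  The symmetry of the weights $\varepsilon \mapsto -\varepsilon$; it exchanges $e_i$ and $f_i$.
\<close>

fun flip :: "letter \<Rightarrow> letter" where
  "flip (Plain i) = Bar i" | "flip Nul = Nul" | "flip (Bar i) = Plain i"

lemma flip_flip [simp]: "flip (flip a) = a"
  by (cases a) auto

lemma flip_eq_iff: "flip a = b \<longleftrightarrow> a = flip b"
  by auto

definition lower_act :: "nat \<Rightarrow> nat \<Rightarrow> complex \<Rightarrow> letter \<Rightarrow> letter \<Rightarrow> complex" where
  "lower_act r i t b a = (if b = a then 1
     else if i < r then (if a = Plain i \<and> b = Plain (i + 1) \<or> a = Bar (i + 1) \<and> b = Bar i then t else 0)
     else if a = Plain r \<and> b = Nul then t
     else if a = Plain r \<and> b = Bar r then t\<^sup>2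
     else if a = Nul \<and> b = Bar r then 2 * t else 0)"

definition raise_act :: "nat \<Rightarrow> nat \<Rightarrow> complex \<Rightarrow> letter \<Rightarrow> letter \<Rightarrow> complex" where
  "raise_act r i t b a = lower_act r i t (flip b) (flip a)"

text \<open>
  The pairing of $\varepsilon_j$ with the coroot $h_i$.
\<close>

definition mode_weight :: "nat \<Rightarrow> nat \<Rightarrow> nat \<Rightarrow> int" where
  "mode_weight r i j = (if i = r then 2 * of_bool (j = r) else of_bool (j = i) - of_bool (j = i + 1))"

fun letter_weight :: "nat \<Rightarrow> nat \<Rightarrow> letter \<Rightarrow> int" where
  "letter_weight r i (Plain j) = mode_weight r i j"
| "letter_weight r i Nul = 0"
| "letter_weight r i (Bar j) = - mode_weight r i j"

definition torus_act :: "nat \<Rightarrow> nat \<Rightarrow> complex \<Rightarrow> letter \<Rightarrow> letter \<Rightarrow> complex" where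
  "torus_act r i t b a = (if b = a then t powi letter_weight r i a else 0)"

lemma minus_one_power_diff_Suc:
  "i < r \<Longrightarrow> (-1) ^ (r - i) = - ((-1) ^ (r - Suc i) :: complex)"
  by (metis Suc_diff_Suc power_Suc mult_minus1)

lemma hop_intertwines_Plain:
  assumes "1 \<le> p" "p \<le> r" "1 \<le> q" "q \<le> r" "p \<noteq> q" "1 \<le> j" "j \<le> r"
  shows "(1\<^sub>m (2^r) + t \<cdot>\<^sub>m hop r p q) * vect r (Plain j)
    = (vect r (Plain j) + (t * of_bool (q = j)) \<cdot>\<^sub>m vect r (Plain p)) * (1\<^sub>m (2^r) + t \<cdot>\<^sub>m hop r p q)"
  unfolding vect_def letter.case using assms
  by (intro intertwine_derivation hop_creation creation_hop hop_parity) auto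

lemma hop_intertwines_Bar:
  assumes "1 \<le> p" "p \<le> r" "1 \<le> q" "q \<le> r" "p \<noteq> q" "1 \<le> j" "j \<le> r"
  shows "(1\<^sub>m (2^r) + t \<cdot>\<^sub>m hop r p q) * (annihilation r j * parity r)
    = (annihilation r j * parity r + (t * (- of_bool (p = j))) \<cdot>\<^sub>m (annihilation r q * parity r)) * (1\<^sub>m (2^r) + t \<cdot>\<^sub>m hop r p q)"
  using assms
  by (intro intertwine_derivation hop_annihilation annihilation_hop hop_parity) auto

text \<open>
  For neighbouring modes the signs in \<open>vect\<close> absorb the minus sign of the bracket of the bilinear
  operator with an annihilation operator.
\<close>

lemma hop_intertwines_Bar_neighbour:
  assumes "1 \<le> p" "p \<le> r" "1 \<le> q" "q \<le> r" "p = Suc q \<or> q = Suc p" "1 \<le> j" "j \<le> r"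
  shows "(1\<^sub>m (2^r) + t \<cdot>\<^sub>m hop r p q) * vect r (Bar j)
    = (vect r (Bar j) + (t * of_bool (p = j)) \<cdot>\<^sub>m vect r (Bar q)) * (1\<^sub>m (2^r) + t \<cdot>\<^sub>m hop r p q)"
proof -
  let ?X = "1\<^sub>m (2^r) + t \<cdot>\<^sub>m hop r p q" and ?s = "\<lambda>j. (-1) ^ (r - j) :: complex"
  let ?A = "\<lambda>j. annihilation r j * parity r"
  have sgn: "?s p = - ?s q"
    using assms minus_one_power_diff_Suc[of q r] minus_one_power_diff_Suc[of p r] by auto
  have "?X * vect r (Bar j) = ?s j \<cdot>\<^sub>m (?X * ?A j)"
    unfolding vect_def letter.case by (rule mult_smult_distrib[of _ "2^r" "2^r" _ "2^r"]) auto
  also have "?X * ?A j = (?A j + (t * (- of_bool (p = j))) \<cdot>\<^sub>m ?A q) * ?X"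
    using assms by (intro hop_intertwines_Bar) auto
  also have "?s j \<cdot>\<^sub>m \<dots> = (?s j \<cdot>\<^sub>m (?A j + (t * (- of_bool (p = j))) \<cdot>\<^sub>m ?A q)) * ?X"
    by (rule mult_smult_assoc_mat[symmetric, of _ "2^r" "2^r" _ "2^r"]) auto
  also have "?s j \<cdot>\<^sub>m (?A j + (t * (- of_bool (p = j))) \<cdot>\<^sub>m ?A q) = vect r (Bar j) + (t * of_bool (p = j)) \<cdot>\<^sub>m vect r (Bar q)"
    using sgn by (intro eq_matI) (auto simp: vect_def algebra_simps)
  finally show ?thesis .
qed

lemma hop_intertwines_Nul:
  assumes "1 \<le> p" "p \<le> r" "1 \<le> q" "q \<le> r"
  shows "(1\<^sub>m (2^r) + t \<cdot>\<^sub>m hop r p q) * parity r = parity r * (1\<^sub>m (2^r) + t \<cdot>\<^sub>m hop r p q)"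
proof -
  note R = add_mult_distrib_mat[of _ "2^r" "2^r" _ _ "2^r"] mult_add_distrib_mat[of _ "2^r" "2^r" _ "2^r"]
    mult_smult_distrib[of _ "2^r" "2^r" _ "2^r"] mult_smult_assoc_mat[of _ "2^r" "2^r" _ "2^r"]
  show ?thesis by (simp add: R hop_parity[OF assms])
qed

lemma y_neg_hop: "1 \<le> i \<Longrightarrow> i < r \<Longrightarrow> y_neg r i t = 1\<^sub>m (2^r) + t \<cdot>\<^sub>m hop r (i + 1) i"
  by (simp add: y_neg_eq chev_f_def hop_def)

lemma x_pos_hop: "1 \<le> i \<Longrightarrow> i < r \<Longrightarrow> x_pos r i t = 1\<^sub>m (2^r) + t \<cdot>\<^sub>m hop r i (i + 1)"
  by (simp add: x_pos_eq chev_e_def hop_def)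

lemma intertwinesI:
  assumes "g \<in> carrier_mat (2^r) (2^r)"
    and "\<And>j. 1 \<le> j \<Longrightarrow> j \<le> r \<Longrightarrow> g * vect r (Plain j) = lin r (\<lambda>b. M b (Plain j)) * g"
    and "\<And>j. 1 \<le> j \<Longrightarrow> j \<le> r \<Longrightarrow> g * vect r (Bar j) = lin r (\<lambda>b. M b (Bar j)) * g"
    and "g * vect r Nul = lin r (\<lambda>b. M b Nul) * g"
  shows "intertwines r g M"
  using assms by (auto simp: intertwines_def letters_def)

lemma lin_1': "a \<in> letters r \<Longrightarrow> (\<And>b. c b = (if b = a then 1 else 0)) \<Longrightarrow> lin r c = vect r a"
  using lin_1[of a r 1] lin_cong[of r c "\<lambda>b. if b = a then 1 else 0"] by simp

lemma lin_2':
  assumes "a \<in> letters r" "a' \<in> letters r" "a \<noteq> a'" "\<And>b. c b = (if b = a then 1 else if b = a' then x else 0)"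
  shows "lin r c = vect r a + x \<cdot>\<^sub>m vect r a'"
  using lin_2[OF assms(1-3), of 1 x] lin_cong[of r c "\<lambda>b. if b = a then 1 else if b = a' then x else 0"] assms(4) by simp

lemma smult_zero_add [simp]: "A \<in> carrier_mat n n \<Longrightarrow> B \<in> carrier_mat n n \<Longrightarrow> A + 0 \<cdot>\<^sub>m (B :: complex mat) = A"
  by (rule eq_matI) auto

lemma intertwines_hop:
  assumes i: "1 \<le> p" "p \<le> r" "1 \<le> q" "q \<le> r" "p = Suc q \<or> q = Suc p"
    and M: "\<And>b a. M b a = (if b = a then 1 else if a = Plain q \<and> b = Plain p \<or> a = Bar p \<and> b = Bar q then t else 0)"
  shows "intertwines r (1\<^sub>m (2^r) + t \<cdot>\<^sub>m hop r p q) M"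
proof (rule intertwinesI)
  fix j assume j: "1 \<le> j" "j \<le> r"
  have "lin r (\<lambda>b. M b (Plain j)) = vect r (Plain j) + (t * of_bool (q = j)) \<cdot>\<^sub>m vect r (Plain p)"
  proof (cases "q = j")
    case True
    then show ?thesis using i j by (subst lin_2'[of "Plain j" _ "Plain p"]) (auto simp: M)
  next
    case False
    then have "lin r (\<lambda>b. M b (Plain j)) = vect r (Plain j)" using j by (intro lin_1') (auto simp: M)
    then show ?thesis using False by (simp add: smult_zero_add[of _ "2^r"])
  qed
  then show "(1\<^sub>m (2^r) + t \<cdot>\<^sub>m hop r p q) * vect r (Plain j) = lin r (\<lambda>b. M b (Plain j)) * (1\<^sub>m (2^r) + t \<cdot>\<^sub>m hop r p q)"
    using hop_intertwines_Plain[of p r q j t] i j by auto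
  have "lin r (\<lambda>b. M b (Bar j)) = vect r (Bar j) + (t * of_bool (p = j)) \<cdot>\<^sub>m vect r (Bar q)"
  proof (cases "p = j")
    case True
    then show ?thesis using i j by (subst lin_2'[of "Bar j" _ "Bar q"]) (auto simp: M)
  next
    case False
    then have "lin r (\<lambda>b. M b (Bar j)) = vect r (Bar j)" using j by (intro lin_1') (auto simp: M)
    then show ?thesis using False by (simp add: smult_zero_add[of _ "2^r"])
  qed
  then show "(1\<^sub>m (2^r) + t \<cdot>\<^sub>m hop r p q) * vect r (Bar j) = lin r (\<lambda>b. M b (Bar j)) * (1\<^sub>m (2^r) + t \<cdot>\<^sub>m hop r p q)"
    using hop_intertwines_Bar_neighbour[of p r q j t] i j by auto
next
  have "lin r (\<lambda>b. M b Nul) = vect r Nul" by (rule lin_1') (auto simp: M)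
  then show "(1\<^sub>m (2^r) + t \<cdot>\<^sub>m hop r p q) * vect r Nul = lin r (\<lambda>b. M b Nul) * (1\<^sub>m (2^r) + t \<cdot>\<^sub>m hop r p q)"
    using hop_intertwines_Nul[of p r q t] i by (simp add: vect_def)
qed simp

lemma one_plus_commute:
  fixes E V :: "complex mat"
  assumes [simp]: "E \<in> carrier_mat n n" "V \<in> carrier_mat n n" and "E * V = V * E"
  shows "(1\<^sub>m n + t \<cdot>\<^sub>m E) * V = V * (1\<^sub>m n + t \<cdot>\<^sub>m E)"
proof -
  note R = add_mult_distrib_mat[of _ n n _ _ n] mult_add_distrib_mat[of _ n n _ n]
    mult_smult_distrib[of _ n n _ n] mult_smult_assoc_mat[of _ n n _ n]
  show ?thesis by (simp add: R assms(3))
qed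

lemma odd_commute:
  fixes E A G :: "complex mat"
  assumes [simp]: "E \<in> carrier_mat n n" "A \<in> carrier_mat n n" "G \<in> carrier_mat n n"
    and EA: "E * A = (-1) \<cdot>\<^sub>m (A * E)" and GE: "G * E = (-1) \<cdot>\<^sub>m (E * G)"
  shows "(1\<^sub>m n + t \<cdot>\<^sub>m E) * (s \<cdot>\<^sub>m (A * G)) = (s \<cdot>\<^sub>m (A * G)) * (1\<^sub>m n + t \<cdot>\<^sub>m E)"
proof -
  note R = assoc_mult_mat[of _ n n _ n _ n] mult_smult_distrib[of _ n n _ n] mult_smult_assoc_mat[of _ n n _ n]
  have "E * G = (-1) \<cdot>\<^sub>m (G * E)" unfolding GE by (rule eq_matI) auto
  from quasi_commute_mult[OF assms(2,3,1) EA this] have "E * (A * G) = A * G * E" by (simp del: assoc_mult_mat)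
  then show ?thesis by (intro one_plus_commute) (simp_all add: R)
qed

text \<open>
  The vectors $v_a, v_0, v_b$ with $a$ and $b$ the two letters of mode $r$ form the triplet of
  \<open>intertwine_odd\<close>; the other vectors are fixed.
\<close>

lemma intertwines_odd:
  assumes r: "1 \<le> r" and E: "E \<in> carrier_mat (2^r) (2^r)" and F: "F \<in> carrier_mat (2^r) (2^r)"
    and EE: "E * E = 0\<^sub>m (2^r) (2^r)" and EF: "E * F = 1\<^sub>m (2^r) + (-1) \<cdot>\<^sub>m (F * E)"
    and GE: "parity r * E = (-1) \<cdot>\<^sub>m (E * parity r)"
    and ab: "a \<in> letters r" "b \<in> letters r" "a \<noteq> b" "a \<noteq> Nul" "b \<noteq> Nul"
    and va: "vect r a = F * parity r" and vb: "vect r b = E * parity r"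
    and other: "\<And>c. c \<in> letters r \<Longrightarrow> c \<noteq> Nul \<Longrightarrow> c \<noteq> a \<Longrightarrow>
      (1\<^sub>m (2^r) + t \<cdot>\<^sub>m E) * vect r c = vect r c * (1\<^sub>m (2^r) + t \<cdot>\<^sub>m E)"
    and M: "\<And>d c. M d c = (if d = c then 1 else if c = a \<and> d = Nul then t else if c = a \<and> d = b then t\<^sup>2
      else if c = Nul \<and> d = b then 2 * t else 0)"
  shows "intertwines r (1\<^sub>m (2^r) + t \<cdot>\<^sub>m E) M"
  unfolding intertwines_def
proof (intro conjI ballI)
  show "1\<^sub>m (2^r) + t \<cdot>\<^sub>m E \<in> carrier_mat (2^r) (2^r)" using E by simp
  fix c assume c: "c \<in> letters r"
  note odd = intertwine_odd[OF E F parity_carrier EE EF GE, of t]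
  consider "c = Nul" | "c = a" | "c \<noteq> Nul" "c \<noteq> a" by blast
  then show "(1\<^sub>m (2^r) + t \<cdot>\<^sub>m E) * vect r c = lin r (\<lambda>d. M d c) * (1\<^sub>m (2^r) + t \<cdot>\<^sub>m E)"
  proof cases
    case 1
    have "lin r (\<lambda>d. M d c) = vect r Nul + (2 * t) \<cdot>\<^sub>m vect r b"
      using ab 1 by (intro lin_2') (auto simp: M)
    then show ?thesis using odd(1) vb by (simp add: 1 vect_def)
  next
    case 2
    have "lin r (\<lambda>d. M d c) = lin r (\<lambda>d. if d = a then 1 else if d = Nul then t else if d = b then t\<^sup>2 else 0)"
      using ab 2 by (intro lin_cong) (auto simp: M)
    also have "\<dots> = vect r a + t \<cdot>\<^sub>m vect r Nul + t\<^sup>2 \<cdot>\<^sub>m vect r b"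
      using ab by (subst lin_3) auto
    finally show ?thesis using odd(2) unfolding 2 va vb by (simp add: vect_def)
  next
    case 3
    have "lin r (\<lambda>d. M d c) = vect r c" using c 3 by (intro lin_1') (auto simp: M)
    then show ?thesis using other[OF c 3] by simp
  qed
qed

lemma intertwines_odd_creation:
  assumes r: "1 \<le> r"
  shows "intertwines r (1\<^sub>m (2^r) + t \<cdot>\<^sub>m creation r r) (raise_act r r t)"
proof (rule intertwines_odd[where a = "Bar r" and b = "Plain r" and F = "annihilation r r"])
  fix c assume c: "c \<in> letters r" "c \<noteq> Nul" "c \<noteq> Bar r"
  show "(1\<^sub>m (2^r) + t \<cdot>\<^sub>m creation r r) * vect r c = vect r c * (1\<^sub>m (2^r) + t \<cdot>\<^sub>m creation r r)"
  proof (cases c)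
    case (Plain j)
    then show ?thesis using c r
        odd_commute[of "creation r r" "2^r" "creation r j" "parity r" t 1] creation_creation[of r r j] parity_creation[of r r]
      by (simp add: vect_def del: assoc_mult_mat)
  next
    case (Bar j)
    then have "creation r r * annihilation r j = (-1) \<cdot>\<^sub>m (annihilation r j * creation r r)"
      using c r by (subst creation_annihilation) (auto intro!: eq_matI)
    then show ?thesis using c r Bar
        odd_commute[of "creation r r" "2^r" "annihilation r j" "parity r" t "(-1) ^ (r - j)"] parity_creation[of r r]
      by (simp add: vect_def del: assoc_mult_mat)
  qed (use c in auto)
qed (use r in \<open>auto simp: creation_square creation_annihilation parity_creation vect_def raise_act_def lower_act_def flip_eq_iff\<close>)

lemma intertwines_odd_annihilation:
  assumes r: "1 \<le> r"
  shows "intertwines r (1\<^sub>m (2^r) + t \<cdot>\<^sub>m annihilation r r) (lower_act r r t)"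
proof (rule intertwines_odd[where a = "Plain r" and b = "Bar r" and F = "creation r r"])
  fix c assume c: "c \<in> letters r" "c \<noteq> Nul" "c \<noteq> Plain r"
  show "(1\<^sub>m (2^r) + t \<cdot>\<^sub>m annihilation r r) * vect r c = vect r c * (1\<^sub>m (2^r) + t \<cdot>\<^sub>m annihilation r r)"
  proof (cases c)
    case (Bar j)
    then show ?thesis using c r
        odd_commute[of "annihilation r r" "2^r" "annihilation r j" "parity r" t "(-1) ^ (r - j)"] annihilation_annihilation[of r r j] parity_annihilation[of r r]
      by (simp add: vect_def del: assoc_mult_mat)
  next
    case (Plain j)
    then have "annihilation r r * creation r j = (-1) \<cdot>\<^sub>m (creation r j * annihilation r r)"
      using c r by (subst annihilation_creation) (auto intro!: eq_matI)
    then show ?thesis using c r Plain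
        odd_commute[of "annihilation r r" "2^r" "creation r j" "parity r" t 1] parity_annihilation[of r r]
      by (simp add: vect_def del: assoc_mult_mat)
  qed (use c in auto)
qed (use r in \<open>auto simp: annihilation_square annihilation_creation parity_annihilation vect_def lower_act_def\<close>)

lemma intertwines_y_neg:
  assumes "1 \<le> i" "i \<le> r"
  shows "intertwines r (y_neg r i t) (lower_act r i t)"
proof (cases "i = r")
  case True
  then show ?thesis using intertwines_odd_annihilation[of r t] assms by (simp add: y_neg_eq chev_f_last)
next
  case False
  then have "i < r" using assms by simp
  then show ?thesis using assms
    by (simp only: y_neg_hop) (intro intertwines_hop, auto simp: lower_act_def)
qed

lemma intertwines_x_pos:
  assumes "1 \<le> i" "i \<le> r"
  shows "intertwines r (x_pos r i t) (raise_act r i t)"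
proof (cases "i = r")
  case True
  then show ?thesis using intertwines_odd_creation[of r t] assms by (simp add: x_pos_eq chev_e_last)
next
  case False
  then have "i < r" using assms by simp
  then show ?thesis using assms
    by (simp only: x_pos_hop) (intro intertwines_hop, auto simp: raise_act_def lower_act_def flip_eq_iff)
qed

section \<open>The torus\<close>

lemma coroot_weight_set_bit:
  assumes "1 \<le> i" "i \<le> r" "1 \<le> j" "j \<le> r" "\<not> bit S (j - 1)"
  shows "coroot_weight r i (set_bit (j - 1) S) = coroot_weight r i S + mode_weight r i j"
proof -
  have "j - 1 = i - 1 \<longleftrightarrow> j = i" "j - 1 = i \<longleftrightarrow> j = i + 1" using assms by auto
  then show ?thesis using assms(1,2,5) by (auto simp: coroot_weight_def mode_weight_def)
qed

lemma coroot_creation: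
  assumes i: "1 \<le> i" "i \<le> r" and j: "1 \<le> j" "j \<le> r" and t: "t \<noteq> 0"
  shows "coroot r i t * creation r j = (t powi mode_weight r i j) \<cdot>\<^sub>m (creation r j * coroot r i t)"
  unfolding coroot_eq[OF i t] mat_diag_mult_left[OF creation_carrier] mat_diag_mult_right[OF creation_carrier]
  by (rule eq_matI)
     (use coroot_weight_set_bit[OF i j] t in \<open>auto simp: creation_monomial power_int_add\<close>)

lemma coroot_annihilation:
  assumes i: "1 \<le> i" "i \<le> r" and j: "1 \<le> j" "j \<le> r" and t: "t \<noteq> 0"
  shows "coroot r i t * annihilation r j = (t powi (- mode_weight r i j)) \<cdot>\<^sub>m (annihilation r j * coroot r i t)"
proof -
  have *: "t powi coroot_weight r i (unset_bit (j - 1) S) = t powi (- mode_weight r i j) * t powi coroot_weight r i S"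
    if "bit S (j - 1)" for S :: nat
  proof -
    have "set_bit (j - 1) (unset_bit (j - 1) S) = S" by (rule bit_eqI) (use that in auto)
    then have "coroot_weight r i S = coroot_weight r i (unset_bit (j - 1) S) + mode_weight r i j"
      using coroot_weight_set_bit[OF i j, of "unset_bit (j - 1) S"] by simp
    then show ?thesis using t by (simp add: power_int_add power_int_minus)
  qed
  show ?thesis
    unfolding coroot_eq[OF i t] mat_diag_mult_left[OF annihilation_carrier] mat_diag_mult_right[OF annihilation_carrier]
    by (rule eq_matI) (use j * in \<open>auto simp: annihilation_monomial\<close>)
qed

lemma coroot_parity:
  assumes "1 \<le> i" "i \<le> r" "t \<noteq> 0"
  shows "coroot r i t * parity r = parity r * coroot r i t"
  by (simp add: coroot_eq[OF assms] parity_def mult.commute)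

lemma coroot_vect:
  assumes i: "1 \<le> i" "i \<le> r" and t: "t \<noteq> 0" and a: "a \<in> letters r"
  shows "coroot r i t * vect r a = (t powi letter_weight r i a) \<cdot>\<^sub>m (vect r a * coroot r i t)"
proof -
  have p: "coroot r i t * parity r = 1 \<cdot>\<^sub>m (parity r * coroot r i t)" using coroot_parity[OF i t] by simp
  show ?thesis
  proof (cases a)
    case (Plain j)
    then show ?thesis using a quasi_commute_mult[OF creation_carrier parity_carrier coroot_carrier[OF i t] coroot_creation[OF i _ _ t, of j] p] i t
      by (simp add: vect_def del: assoc_mult_mat)
  next
    case Nul
    then show ?thesis using coroot_parity[OF i t] by (simp add: vect_def)
  next
    case (Bar j)
    note R = mult_smult_distrib[of _ "2^r" "2^r" _ "2^r"] mult_smult_assoc_mat[of _ "2^r" "2^r" _ "2^r"]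
    show ?thesis using Bar a quasi_commute_mult[OF annihilation_carrier parity_carrier coroot_carrier[OF i t] coroot_annihilation[OF i _ _ t, of j] p] i t
      by (simp add: vect_def R del: assoc_mult_mat) (rule eq_matI, auto)
  qed
qed

lemma intertwines_coroot:
  assumes i: "1 \<le> i" "i \<le> r" and t: "t \<noteq> 0"
  shows "intertwines r (coroot r i t) (torus_act r i t)"
  unfolding intertwines_def
proof (intro conjI ballI)
  show "coroot r i t \<in> carrier_mat (2^r) (2^r)" using i t by simp
  fix a assume a: "a \<in> letters r"
  have "lin r (\<lambda>b. torus_act r i t b a) = lin r (\<lambda>b. if b = a then t powi letter_weight r i a else 0)"
    by (rule lin_cong) (auto simp: torus_act_def)
  then show "coroot r i t * vect r a = lin r (\<lambda>b. torus_act r i t b a) * coroot r i t"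
    using coroot_vect[OF i t a] i t
    by (simp add: lin_1[OF a] mult_smult_assoc_mat[of _ "2^r" "2^r" _ "2^r"])
qed

section \<open>Matrix coefficients of the vector representation\<close>

text \<open>
  A matrix position at which, among all \<open>vect r b\<close>, only \<open>vect r a\<close> has a nonzero
  entry. It exists because the coefficients are read off in the columns of the vacuum and of the
  one-particle states.
\<close>

fun probe :: "letter \<Rightarrow> nat \<times> nat" where
  "probe (Plain j) = (2 ^ (j - 1), 0)" | "probe Nul = (0, 0)" | "probe (Bar j) = (0, 2 ^ (j - 1))"

fun probe_value :: "nat \<Rightarrow> letter \<Rightarrow> complex" where
  "probe_value r (Plain j) = 1" | "probe_value r Nul = 1" | "probe_value r (Bar j) = - ((-1) ^ (r - j))"

lemma probe_value_nonzero [simp]: "probe_value r a \<noteq> 0"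
  by (cases a) auto

lemma jw_0 [simp]: "jw q 0 = 1"
  by (simp add: jw_def)

lemma jw_exp [simp]: "jw q (2 ^ k) = (if k < q then -1 else 1)"
  using jw_set_bit[of 0 k q] by simp

lemma probe_less: "a \<in> letters r \<Longrightarrow> fst (probe a) < 2 ^ r \<and> snd (probe a) < 2 ^ r"
  by (cases a) auto

lemma vect_probe:
  assumes a: "a \<in> letters r" and b: "b \<in> letters r"
  shows "vect r b $$ probe a = (if a = b then probe_value r a else 0)"
proof (cases b)
  case (Plain j)
  have ne: "(set_bit (j - 1) S = 0) = False" for S :: nat
  proof -
    have "set_bit (j - 1) S \<noteq> 0"
    proof
      assume eq: "set_bit (j - 1) S = 0"
      have "bit (set_bit (j - 1) S) (j - 1)" by simp
      then show False unfolding eq by simp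
    qed
    then show ?thesis by blast
  qed
  have inj: "2 ^ (i - 1) = (2::nat) ^ (j - 1) \<longleftrightarrow> i = j" if "1 \<le> i" for i using that b Plain by auto
  have "vect r b $$ (S', S) = (if S' = set_bit (j - 1) S then if bit S (j - 1) then 0 else jw (j - 1) S else 0) * jw r S"
    if "S' < 2^r" "S < 2^r" for S' S
    using that by (simp add: Plain vect_def parity_def mat_diag_mult_right[OF creation_carrier] del: index_mult_mat) (simp add: creation_monomial)
  then show ?thesis using a b Plain inj by (cases a) (auto simp: ne simp del: One_nat_def)
next
  case Nul
  then show ?thesis using a by (cases a) (auto simp: vect_def parity_def mat_diag_def)
next
  case (Bar j)
  have j: "1 \<le> j" "j \<le> r" using b Bar by auto
  have un: "unset_bit (j - 1) (2 ^ (j - 1)) = (0 :: nat)" by (rule bit_eqI) (auto simp: bit_exp_iff)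
  have bit: "bit (2 ^ (i - 1) :: nat) (j - 1) \<longleftrightarrow> i = j" if "1 \<le> i" for i using that j by (auto simp: bit_exp_iff)
  have ent: "vect r b $$ (S', S) = (-1) ^ (r - j) * ((if S' = unset_bit (j - 1) S then if bit S (j - 1) then jw (j - 1) S else 0 else 0) * jw r S)"
    if "S' < 2^r" "S < 2^r" for S' S
    using that by (simp add: Bar vect_def parity_def mat_diag_mult_right[OF annihilation_carrier] del: index_mult_mat(1)) (simp add: annihilation_monomial[OF j])
  show ?thesis
  proof (cases a)
    case (Plain x)
    then have "x - 1 < r" using a by auto
    then show ?thesis using a ent[of "2 ^ (x - 1)" 0] Bar Plain by simp
  next
    case Nul
    then show ?thesis using ent[of 0 0] Bar by simp
  next
    case (Bar x)
    then have x: "1 \<le> x" "x \<le> r" using a by auto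
    then have "x - 1 < r" "j - 1 < r" using j by auto
    then have e: "vect r b $$ (0, 2 ^ (x - 1)) = (-1) ^ (r - j) * ((if 0 = unset_bit (j - 1) (2 ^ (x - 1) :: nat) then if x = j then jw (j - 1) (2 ^ (x - 1)) else 0 else 0) * jw r (2 ^ (x - 1)))"
      using ent[of 0 "2 ^ (x - 1)"] unfolding bit[OF x(1)] by simp
    show ?thesis
    proof (cases "x = j")
      case True
      show ?thesis using e \<open>j - 1 < r\<close> unfolding True un Bar \<open>b = Bar j\<close> by simp
    next
      case False
      then show ?thesis using e unfolding Bar \<open>b = Bar j\<close> by simp
    qed
  qed
qed

lemma lin_probe:
  assumes a: "a \<in> letters r"
  shows "lin r c $$ probe a = c a * probe_value r a"
proof -
  have "lin r c $$ probe a = (\<Sum>b\<in>letters r. c b * vect r b $$ probe a)"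
    using probe_less[OF a] by (cases "probe a") auto
  also have "\<dots> = (\<Sum>b\<in>letters r. if b = a then c b * probe_value r a else 0)"
    by (intro sum.cong refl) (auto simp: vect_probe[OF a])
  also have "\<dots> = c a * probe_value r a" using a by simp
  finally show ?thesis .
qed

text \<open>
  The matrix of $g$ on the vector representation. The inverse of $g$ is written as the adjugate matrix
  divided by the determinant, so that the entries are visibly regular functions.
\<close>

definition vrep :: "nat \<Rightarrow> complex mat \<Rightarrow> letter \<Rightarrow> letter \<Rightarrow> complex" where
  "vrep r g b a = inverse (probe_value r b) * (inverse (det g) * (g * vect r a * adj_mat g) $$ probe b)"

lemma vrep_eq:
  assumes M: "intertwines r g M" and det: "det g \<noteq> 0" and a: "a \<in> letters r" and b: "b \<in> letters r"
  shows "vrep r g b a = M b a"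
proof -
  have g [simp]: "g \<in> carrier_mat (2^r) (2^r)" using M by (simp add: intertwines_def)
  have "g * vect r a * adj_mat g = lin r (\<lambda>b. M b a) * (g * adj_mat g)"
    using M a adj_mat(1)[OF g] by (simp add: intertwines_def assoc_mult_mat[of _ "2^r" "2^r" _ "2^r" _ "2^r"])
  also have "\<dots> = det g \<cdot>\<^sub>m lin r (\<lambda>b. M b a)"
    unfolding adj_mat(2)[OF g] by (simp add: mult_smult_distrib[of _ "2^r" "2^r" _ "2^r"])
  finally have "(g * vect r a * adj_mat g) $$ probe b = det g * (M b a * probe_value r b)"
    using probe_less[OF b] lin_probe[OF b] by (cases "probe b") auto
  then show ?thesis using det by (simp add: vrep_def field_simps)
qed

section \<open>The groups\<close>

lemma group_GL: "group (GL n)"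
proof -
  interpret ring "ring_mat TYPE(complex) n ()" by (rule ring_mat)
  show ?thesis unfolding GL_def by (rule units_group)
qed

lemma GL_mult [simp]: "x \<otimes>\<^bsub>GL n\<^esub> y = x * y"
  and GL_one [simp]: "\<one>\<^bsub>GL n\<^esub> = 1\<^sub>m n"
  by (simp_all add: GL_def units_of_mult units_of_one ring_mat_def)

lemma GL_carrier_mat: "g \<in> carrier (GL n) \<Longrightarrow> g \<in> carrier_mat n n"
  by (auto simp: GL_def units_of_carrier Units_def ring_mat_def)

lemma GL_det: "g \<in> carrier (GL n) \<Longrightarrow> det g \<noteq> 0"
  unfolding GL_def units_of_carrier by (rule unit_imp_det_non_zero)

lemma GL_memI: "A \<in> carrier_mat n n \<Longrightarrow> B \<in> carrier_mat n n \<Longrightarrow> A * B = 1\<^sub>m n \<Longrightarrow> B * A = 1\<^sub>m n \<Longrightarrow> A \<in> carrier (GL n)"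
  unfolding GL_def units_of_carrier Units_def ring_mat_def by auto

lemma GL_inv:
  assumes "A \<in> carrier_mat n n" "B \<in> carrier_mat n n" "A * B = 1\<^sub>m n" "B * A = 1\<^sub>m n"
  shows "inv\<^bsub>GL n\<^esub> A = B"
  by (rule group.inv_equality[OF group_GL])
     (use GL_memI[OF assms] GL_memI[OF assms(2,1,4,3)] assms(4) in auto)

text \<open>
  For a generating set that is closed under inverses, every element of the generated group is a product
  of generators, and induction adds one generator on the left.
\<close>

lemma generate_GL_induct [consumes 3, case_names one mult]:
  assumes S: "S \<subseteq> carrier (GL n)" and closed: "\<And>s. s \<in> S \<Longrightarrow> inv\<^bsub>GL n\<^esub> s \<in> S"
    and g: "g \<in> generate (GL n) S"
    and one: "P (1\<^sub>m n)" and mult: "\<And>s g. s \<in> S \<Longrightarrow> g \<in> generate (GL n) S \<Longrightarrow> P g \<Longrightarrow> P (s * g)"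
  shows "P g"
proof -
  interpret group "GL n" by (rule group_GL)
  have car: "x \<in> carrier (GL n)" if "x \<in> generate (GL n) S" for x using generate_in_carrier[OF S that] .
  have "\<forall>u\<in>generate (GL n) S. P u \<longrightarrow> P (g * u)" using g
  proof (induction rule: generate.induct)
    case one
    then show ?case using car GL_carrier_mat by auto
  next
    case (incl h)
    then show ?case using mult by blast
  next
    case (inv h)
    then show ?case using mult closed by blast
  next
    case (eng h1 h2)
    show ?case
    proof (intro ballI impI)
      fix u assume u: "u \<in> generate (GL n) S" "P u"
      have "h2 * u \<in> generate (GL n) S" using generate.eng[OF eng(2) u(1)] by simp
      then have "P (h1 * (h2 * u))" using eng u by blast
      moreover have "h1 * h2 * u = h1 * (h2 * u)"
        using m_assoc[OF car[OF eng(1)] car[OF eng(2)] car[OF u(1)]] by simp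
      ultimately show "P (h1 \<otimes>\<^bsub>GL n\<^esub> h2 * u)" by simp
    qed
  qed
  then have "P (g * 1\<^sub>m n)" using generate.one[of "GL n" S] one by auto
  then show ?thesis using GL_carrier_mat[OF car[OF g]] by simp
qed

lemma one_plus_mult:
  fixes E :: "complex mat"
  assumes [simp]: "E \<in> carrier_mat n n" and EE: "E * E = 0\<^sub>m n n"
  shows "(1\<^sub>m n + s \<cdot>\<^sub>m E) * (1\<^sub>m n + t \<cdot>\<^sub>m E) = 1\<^sub>m n + (s + t) \<cdot>\<^sub>m E"
proof -
  note R = add_mult_distrib_mat[of _ n n _ _ n] mult_add_distrib_mat[of _ n n _ n]
    mult_smult_distrib[of _ n n _ n] mult_smult_assoc_mat[of _ n n _ n]
  note [simp] = carrier_matD[OF assms(1)]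
  show ?thesis by (simp add: R EE) (rule eq_matI, auto simp: algebra_simps)
qed

lemma zero_smult_mat: "A \<in> carrier_mat n n \<Longrightarrow> 0 \<cdot>\<^sub>m (A :: complex mat) = 0\<^sub>m n n"
  by (rule eq_matI) auto

lemma x_pos_add: "1 \<le> i \<Longrightarrow> i \<le> r \<Longrightarrow> x_pos r i s * x_pos r i t = x_pos r i (s + t)"
  by (simp add: x_pos_eq one_plus_mult chev_e_square)

lemma y_neg_add: "1 \<le> i \<Longrightarrow> i \<le> r \<Longrightarrow> y_neg r i s * y_neg r i t = y_neg r i (s + t)"
  by (simp add: y_neg_eq one_plus_mult chev_f_square)

lemma x_pos_0: "1 \<le> i \<Longrightarrow> i \<le> r \<Longrightarrow> x_pos r i 0 = 1\<^sub>m (2^r)"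
  by (simp add: x_pos_eq zero_smult_mat[of _ "2^r"])

lemma y_neg_0: "1 \<le> i \<Longrightarrow> i \<le> r \<Longrightarrow> y_neg r i 0 = 1\<^sub>m (2^r)"
  by (simp add: y_neg_eq zero_smult_mat[of _ "2^r"])

lemma coroot_mult:
  assumes "1 \<le> i" "i \<le> r" "s \<noteq> 0" "t \<noteq> 0"
  shows "coroot r i s * coroot r i t = coroot r i (s * t)"
  using assms by (simp add: coroot_eq power_int_mult_distrib)

lemma coroot_1: "1 \<le> i \<Longrightarrow> i \<le> r \<Longrightarrow> coroot r i 1 = 1\<^sub>m (2^r)"
  by (simp add: coroot_eq)

lemma x_pos_GL: "1 \<le> i \<Longrightarrow> i \<le> r \<Longrightarrow> x_pos r i t \<in> carrier (GL (2^r))"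
  and x_pos_inv: "1 \<le> i \<Longrightarrow> i \<le> r \<Longrightarrow> inv\<^bsub>GL (2^r)\<^esub> (x_pos r i t) = x_pos r i (- t)"
  by (intro GL_memI[of _ _ "x_pos r i (- t)"] GL_inv; simp add: x_pos_add x_pos_0)+

lemma y_neg_GL: "1 \<le> i \<Longrightarrow> i \<le> r \<Longrightarrow> y_neg r i t \<in> carrier (GL (2^r))"
  and y_neg_inv: "1 \<le> i \<Longrightarrow> i \<le> r \<Longrightarrow> inv\<^bsub>GL (2^r)\<^esub> (y_neg r i t) = y_neg r i (- t)"
  by (intro GL_memI[of _ _ "y_neg r i (- t)"] GL_inv; simp add: y_neg_add y_neg_0)+

lemma coroot_GL: "1 \<le> i \<Longrightarrow> i \<le> r \<Longrightarrow> t \<noteq> 0 \<Longrightarrow> coroot r i t \<in> carrier (GL (2^r))"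
  and coroot_inv: "1 \<le> i \<Longrightarrow> i \<le> r \<Longrightarrow> t \<noteq> 0 \<Longrightarrow> inv\<^bsub>GL (2^r)\<^esub> (coroot r i t) = coroot r i (inverse t)"
  by (intro GL_memI[of _ _ "coroot r i (inverse t)"] GL_inv; simp add: coroot_mult coroot_1)+

lemma grp_G_induct [consumes 1, case_names one x y]:
  assumes "g \<in> grp_G r" "P (1\<^sub>m (2^r))"
    and "\<And>i t g. 1 \<le> i \<Longrightarrow> i \<le> r \<Longrightarrow> g \<in> grp_G r \<Longrightarrow> P g \<Longrightarrow> P (x_pos r i t * g)"
    and "\<And>i t g. 1 \<le> i \<Longrightarrow> i \<le> r \<Longrightarrow> g \<in> grp_G r \<Longrightarrow> P g \<Longrightarrow> P (y_neg r i t * g)"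
  shows "P g"
proof -
  let ?S = "\<Union>i\<in>{1..r}. range (x_pos r i) \<union> range (y_neg r i)"
  have "inv\<^bsub>GL (2^r)\<^esub> s \<in> ?S" if "s \<in> ?S" for s
  proof -
    from that obtain i where i: "i \<in> {1..r}" "s \<in> range (x_pos r i) \<union> range (y_neg r i)" by blast
    then have "inv\<^bsub>GL (2^r)\<^esub> s \<in> range (x_pos r i) \<union> range (y_neg r i)" by (auto simp: x_pos_inv y_neg_inv)
    then show ?thesis using i(1) by blast
  qed
  moreover have "?S \<subseteq> carrier (GL (2^r))" by (auto simp: x_pos_GL y_neg_GL)
  ultimately show ?thesis using assms unfolding grp_G_def
    by (intro generate_GL_induct[of ?S "2^r" g P]) auto
qed

lemma grp_N_induct [consumes 1, case_names one mult]:
  assumes "g \<in> grp_N r" "P (1\<^sub>m (2^r))"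
    and "\<And>i t g. 1 \<le> i \<Longrightarrow> i \<le> r \<Longrightarrow> g \<in> grp_N r \<Longrightarrow> P g \<Longrightarrow> P (x_pos r i t * g)"
  shows "P g"
proof -
  let ?S = "\<Union>i\<in>{1..r}. range (x_pos r i)"
  have "inv\<^bsub>GL (2^r)\<^esub> s \<in> ?S" if "s \<in> ?S" for s
  proof -
    from that obtain i t where i: "1 \<le> i" "i \<le> r" "s = x_pos r i t" by auto
    then have "inv\<^bsub>GL (2^r)\<^esub> s \<in> range (x_pos r i)" by (auto simp: x_pos_inv)
    then show ?thesis using i(1,2) by auto
  qed
  moreover have "?S \<subseteq> carrier (GL (2^r))" by (auto simp: x_pos_GL)
  ultimately show ?thesis using assms unfolding grp_N_def
    by (intro generate_GL_induct[of ?S "2^r" g P]) auto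
qed

lemma grp_N_minus_induct [consumes 1, case_names one mult]:
  assumes "g \<in> grp_N_minus r" "P (1\<^sub>m (2^r))"
    and "\<And>i t g. 1 \<le> i \<Longrightarrow> i \<le> r \<Longrightarrow> g \<in> grp_N_minus r \<Longrightarrow> P g \<Longrightarrow> P (y_neg r i t * g)"
  shows "P g"
proof -
  let ?S = "\<Union>i\<in>{1..r}. range (y_neg r i)"
  have "inv\<^bsub>GL (2^r)\<^esub> s \<in> ?S" if "s \<in> ?S" for s
  proof -
    from that obtain i t where i: "1 \<le> i" "i \<le> r" "s = y_neg r i t" by auto
    then have "inv\<^bsub>GL (2^r)\<^esub> s \<in> range (y_neg r i)" by (auto simp: y_neg_inv)
    then show ?thesis using i(1,2) by auto
  qed
  moreover have "?S \<subseteq> carrier (GL (2^r))" by (auto simp: y_neg_GL)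
  ultimately show ?thesis using assms unfolding grp_N_minus_def
    by (intro generate_GL_induct[of ?S "2^r" g P]) auto
qed

lemma grp_H_induct [consumes 1, case_names one mult]:
  assumes "g \<in> grp_H r" "P (1\<^sub>m (2^r))"
    and "\<And>i t g. 1 \<le> i \<Longrightarrow> i \<le> r \<Longrightarrow> t \<noteq> 0 \<Longrightarrow> g \<in> grp_H r \<Longrightarrow> P g \<Longrightarrow> P (coroot r i t * g)"
  shows "P g"
proof -
  let ?S = "\<Union>i\<in>{1..r}. coroot r i ` (- {0})"
  have "inv\<^bsub>GL (2^r)\<^esub> s \<in> ?S" if "s \<in> ?S" for s
  proof -
    from that obtain i t where i: "i \<in> {1..r}" "t \<noteq> 0" "s = coroot r i t" by blast
    then have "inv\<^bsub>GL (2^r)\<^esub> s \<in> coroot r i ` (- {0})" by (auto simp: coroot_inv)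
    then show ?thesis using i(1) by blast
  qed
  moreover have "?S \<subseteq> carrier (GL (2^r))" by (auto intro!: coroot_GL)
  moreover have "P (s * g)" if "s \<in> ?S" "g \<in> grp_H r" "P g" for s g
  proof -
    from that(1) obtain i t where "i \<in> {1..r}" "t \<noteq> 0" "s = coroot r i t" by blast
    then show ?thesis using assms(3)[of i t g] that by simp
  qed
  ultimately show ?thesis using assms(1,2) unfolding grp_H_def
    by (intro generate_GL_induct[of ?S "2^r" g P]) auto
qed

lemma subgroup_G: "subgroup (grp_G r) (GL (2^r))"
  and subgroup_N: "subgroup (grp_N r) (GL (2^r))"
  and subgroup_N_minus: "subgroup (grp_N_minus r) (GL (2^r))"
  and subgroup_H: "subgroup (grp_H r) (GL (2^r))"
  unfolding grp_G_def grp_N_def grp_N_minus_def grp_H_def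
  by (rule group.generate_is_subgroup[OF group_GL], auto intro!: x_pos_GL y_neg_GL coroot_GL)+

lemma grp_mult_closed:
  "g \<in> grp_G r \<Longrightarrow> h \<in> grp_G r \<Longrightarrow> g * h \<in> grp_G r"
  "g \<in> grp_N r \<Longrightarrow> h \<in> grp_N r \<Longrightarrow> g * h \<in> grp_N r"
  "g \<in> grp_N_minus r \<Longrightarrow> h \<in> grp_N_minus r \<Longrightarrow> g * h \<in> grp_N_minus r"
  "g \<in> grp_H r \<Longrightarrow> h \<in> grp_H r \<Longrightarrow> g * h \<in> grp_H r"
  using subgroup.m_closed[OF subgroup_G] subgroup.m_closed[OF subgroup_N]
    subgroup.m_closed[OF subgroup_N_minus] subgroup.m_closed[OF subgroup_H] by auto

lemma grp_one:
  "1\<^sub>m (2^r) \<in> grp_G r" "1\<^sub>m (2^r) \<in> grp_N r" "1\<^sub>m (2^r) \<in> grp_N_minus r" "1\<^sub>m (2^r) \<in> grp_H r"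
  using subgroup.one_closed[OF subgroup_G] subgroup.one_closed[OF subgroup_N]
    subgroup.one_closed[OF subgroup_N_minus] subgroup.one_closed[OF subgroup_H] by auto

lemma grp_GL:
  "g \<in> grp_G r \<Longrightarrow> g \<in> carrier (GL (2^r))" "g \<in> grp_N r \<Longrightarrow> g \<in> carrier (GL (2^r))"
  "g \<in> grp_N_minus r \<Longrightarrow> g \<in> carrier (GL (2^r))" "g \<in> grp_H r \<Longrightarrow> g \<in> carrier (GL (2^r))"
  by (erule subsetD[OF subgroup.subset[OF subgroup_G]] subsetD[OF subgroup.subset[OF subgroup_N]]
    subsetD[OF subgroup.subset[OF subgroup_N_minus]] subsetD[OF subgroup.subset[OF subgroup_H]])+

lemmas grp_carrier = grp_GL[THEN GL_carrier_mat]

lemma x_pos_mem: "1 \<le> i \<Longrightarrow> i \<le> r \<Longrightarrow> x_pos r i t \<in> grp_G r" "1 \<le> i \<Longrightarrow> i \<le> r \<Longrightarrow> x_pos r i t \<in> grp_N r"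
  unfolding grp_G_def grp_N_def by (intro generate.incl UN_I[of i]; simp)+

lemma y_neg_mem: "1 \<le> i \<Longrightarrow> i \<le> r \<Longrightarrow> y_neg r i t \<in> grp_G r" "1 \<le> i \<Longrightarrow> i \<le> r \<Longrightarrow> y_neg r i t \<in> grp_N_minus r"
  unfolding grp_G_def grp_N_minus_def by (intro generate.incl UN_I[of i]; simp)+

lemma coroot_mem: "1 \<le> i \<Longrightarrow> i \<le> r \<Longrightarrow> t \<noteq> 0 \<Longrightarrow> coroot r i t \<in> grp_H r"
  unfolding grp_H_def by (intro generate.incl UN_I[of i]; simp)+

section \<open>Relations between the generators\<close>

lemma coroot_projections:
  assumes i: "1 \<le> i" "i \<le> r" and u: "u \<noteq> 0"
  shows "1\<^sub>m (2^r) + (u - 1) \<cdot>\<^sub>m (chev_e r i * chev_f r i) + (1 / u - 1) \<cdot>\<^sub>m (chev_f r i * chev_e r i) = coroot r i u"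
proof -
  have "coroot_weight r i S \<in> {-1, 0, 1}" for S by (auto simp: coroot_weight_def)
  then show ?thesis
    unfolding coroot_eq[OF i u] chev_e_chev_f[OF i] chev_f_chev_e[OF i]
    by (intro eq_matI) (fastforce simp: mat_diag_def divide_inverse power_int_minus)+
qed

lemma x_pos_y_neg_same:
  assumes i: "1 \<le> i" "i \<le> r" and u: "u = 1 + a * b" "u \<noteq> 0"
  shows "x_pos r i a * y_neg r i b = y_neg r i (b / u) * (coroot r i u * x_pos r i (a / u))"
  unfolding coroot_projections[OF i u(2), symmetric]
  unfolding x_pos_eq[OF i] y_neg_eq[OF i]
  by (rule rank_one_gauss) (use i u in \<open>auto simp: chev_e_square chev_f_square chev_efe chev_fef\<close>)

lemma chev_e_f_commute:
  assumes i: "1 \<le> i" "i \<le> r" and j: "1 \<le> j" "j \<le> r" and ij: "i \<noteq> j"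
  shows "chev_e r i * chev_f r j = chev_f r j * chev_e r i"
proof -
  have hop1: "hop r i (i + 1) * creation r (j + 1) = 1 \<cdot>\<^sub>m (creation r (j + 1) * hop r i (i + 1))" if "i < r" "j < r"
    using hop_creation[of i r "i + 1" "j + 1"] that i j ij by (intro eq_matI) (auto simp: hop_def)
  have hop2: "hop r i (i + 1) * annihilation r j = 1 \<cdot>\<^sub>m (annihilation r j * hop r i (i + 1))" if "i < r"
    using hop_annihilation[of i r "i + 1" j] that i j ij by (intro eq_matI) (auto simp: hop_def)
  have odd: "creation r r * annihilation r j = (-1) \<cdot>\<^sub>m (annihilation r j * creation r r)" if "i = r"
    using creation_annihilation[of r r j] that i j ij by (intro eq_matI) auto
  consider "i < r" "j < r" | "i < r" "j = r" | "i = r" "j < r" using i j ij by linarith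
  then show ?thesis
  proof cases
    case 1
    then show ?thesis
      using quasi_commute_mult[OF creation_carrier annihilation_carrier hop_carrier hop1 hop2]
      by (simp add: chev_e_def chev_f_def hop_def del: assoc_mult_mat)
  next
    case 2
    then show ?thesis using hop2 by (simp add: chev_e_def chev_f_def hop_def)
  next
    case 3
    then show ?thesis
      using quasi_commute_mult[OF creation_carrier annihilation_carrier creation_carrier creation_creation odd, of "j + 1"] j
      by (simp add: chev_e_def chev_f_def del: assoc_mult_mat)
  qed
qed

lemma x_pos_y_neg_other:
  assumes i: "1 \<le> i" "i \<le> r" and j: "1 \<le> j" "j \<le> r" and ij: "i \<noteq> j"
  shows "x_pos r i a * y_neg r j b = y_neg r j b * x_pos r i a"
  unfolding x_pos_eq[OF i] y_neg_eq[OF j]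
proof (rule one_plus_commute)
  show "chev_e r i * (1\<^sub>m (2^r) + b \<cdot>\<^sub>m chev_f r j) = (1\<^sub>m (2^r) + b \<cdot>\<^sub>m chev_f r j) * chev_e r i"
    by (rule one_plus_commute[symmetric]) (simp_all add: chev_e_f_commute[OF assms])
qed simp_all

lemma coroot_chev:
  assumes i: "1 \<le> i" "i \<le> r" and j: "1 \<le> j" "j \<le> r" and t: "t \<noteq> 0"
  shows "\<exists>s. s \<noteq> 0 \<and> coroot r j t * chev_e r i = s \<cdot>\<^sub>m (chev_e r i * coroot r j t)"
    and "\<exists>s. coroot r j t * chev_f r i = s \<cdot>\<^sub>m (chev_f r i * coroot r j t)"
proof -
  note c = coroot_creation[OF j _ _ t] and a = coroot_annihilation[OF j _ _ t]
  note q = quasi_commute_mult[OF creation_carrier annihilation_carrier coroot_carrier[OF j t] c a]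
  show "\<exists>s. s \<noteq> 0 \<and> coroot r j t * chev_e r i = s \<cdot>\<^sub>m (chev_e r i * coroot r j t)"
  proof (cases "i = r")
    case True
    then show ?thesis using c[of r] i t by (intro exI[of _ "t powi mode_weight r j r"]) (simp add: chev_e_def)
  next
    case False
    then show ?thesis using q[of i "i + 1"] i t
      by (intro exI[of _ "t powi mode_weight r j i * t powi (- mode_weight r j (i + 1))"])
         (simp add: chev_e_def del: assoc_mult_mat)
  qed
  show "\<exists>s. coroot r j t * chev_f r i = s \<cdot>\<^sub>m (chev_f r i * coroot r j t)"
  proof (cases "i = r")
    case True
    then show ?thesis using a[of r] i by (auto simp: chev_f_def)
  next
    case False
    then show ?thesis using q[of "i + 1" i] i
      by (intro exI[of _ "t powi mode_weight r j (i + 1) * t powi (- mode_weight r j i)"])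
         (simp add: chev_f_def del: assoc_mult_mat)
  qed
qed

lemma coroot_y_neg:
  assumes i: "1 \<le> i" "i \<le> r" and j: "1 \<le> j" "j \<le> r" and t: "t \<noteq> 0"
  shows "\<exists>b'. coroot r j t * y_neg r i b = y_neg r i b' * coroot r j t"
proof -
  note R = square_mat_ring[where n = "2^r"]
  have [simp]: "coroot r j t \<in> carrier_mat (2^r) (2^r)" using j t by simp
  obtain s where s: "coroot r j t * chev_f r i = s \<cdot>\<^sub>m (chev_f r i * coroot r j t)"
    using coroot_chev(2)[OF assms] by blast
  have "coroot r j t * y_neg r i b = y_neg r i (b * s) * coroot r j t"
    unfolding y_neg_eq[OF i] by (simp add: R s) (rule eq_matI, auto)
  then show ?thesis by blast
qed

lemma x_pos_coroot:
  assumes i: "1 \<le> i" "i \<le> r" and j: "1 \<le> j" "j \<le> r" and t: "t \<noteq> 0"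
  shows "\<exists>a'. x_pos r i a * coroot r j t = coroot r j t * x_pos r i a'"
proof -
  note R = square_mat_ring[where n = "2^r"]
  have [simp]: "coroot r j t \<in> carrier_mat (2^r) (2^r)" using j t by simp
  obtain s where s: "s \<noteq> 0" "coroot r j t * chev_e r i = s \<cdot>\<^sub>m (chev_e r i * coroot r j t)"
    using coroot_chev(1)[OF assms] by blast
  have "x_pos r i a * coroot r j t = coroot r j t * x_pos r i (a / s)"
    unfolding x_pos_eq[OF i] using s(1) by (simp add: R s(2)) (rule eq_matI, auto)
  then show ?thesis by blast
qed

lemma grp_H_y_neg:
  assumes "h \<in> grp_H r" and i: "1 \<le> i" "i \<le> r"
  shows "\<exists>b'. h * y_neg r i b = y_neg r i b' * h"
  using assms(1)
proof (induction arbitrary: b rule: grp_H_induct)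
  case one
  then show ?case using i by (intro exI[of _ b]) (simp add: y_neg_carrier)
next
  case (mult j t g)
  note R = assoc_mult_mat[of _ "2^r" "2^r" _ "2^r" _ "2^r"]
  have [simp]: "g \<in> carrier_mat (2^r) (2^r)" "coroot r j t \<in> carrier_mat (2^r) (2^r)" "\<And>b. y_neg r i b \<in> carrier_mat (2^r) (2^r)"
    using mult i grp_carrier by auto
  obtain b1 where b1: "g * y_neg r i b = y_neg r i b1 * g" using mult by blast
  obtain b2 where b2: "coroot r j t * y_neg r i b1 = y_neg r i b2 * coroot r j t"
    using coroot_y_neg[OF i mult(1-3)] by blast
  have "coroot r j t * g * y_neg r i b = coroot r j t * y_neg r i b1 * g" by (simp add: R b1)
  also have "\<dots> = y_neg r i b2 * (coroot r j t * g)" unfolding b2 by (simp add: R)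
  finally show ?case by blast
qed

lemma x_pos_grp_H:
  assumes "h \<in> grp_H r" and i: "1 \<le> i" "i \<le> r"
  shows "\<exists>a'. x_pos r i a * h = h * x_pos r i a'"
  using assms(1)
proof (induction arbitrary: a rule: grp_H_induct)
  case one
  then show ?case using i by (intro exI[of _ a]) (simp add: x_pos_carrier)
next
  case (mult j t g)
  note R = assoc_mult_mat[of _ "2^r" "2^r" _ "2^r" _ "2^r"]
  have [simp]: "g \<in> carrier_mat (2^r) (2^r)" "coroot r j t \<in> carrier_mat (2^r) (2^r)" "\<And>b. x_pos r i b \<in> carrier_mat (2^r) (2^r)"
    using mult i grp_carrier by auto
  obtain a1 where a1: "x_pos r i a * coroot r j t = coroot r j t * x_pos r i a1"
    using x_pos_coroot[OF i mult(1-3)] by blast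
  obtain a2 where a2: "x_pos r i a1 * g = g * x_pos r i a2" using mult by blast
  have "x_pos r i a * (coroot r j t * g) = x_pos r i a * coroot r j t * g" by (simp add: R)
  also have "\<dots> = coroot r j t * (x_pos r i a1 * g)" unfolding a1 by (simp add: R)
  also have "\<dots> = coroot r j t * g * x_pos r i a2" unfolding a2 by (simp add: R)
  finally show ?case by blast
qed

text \<open>
  Solve \<open>x_pos_y_neg_same\<close> with $a = t - 1$, $b = 1$ for the torus factor.
\<close>

lemma coroot_mem_G:
  assumes i: "1 \<le> i" "i \<le> r" and t: "t \<noteq> 0"
  shows "coroot r i t \<in> grp_G r"
proof -
  note R = assoc_mult_mat[of _ "2^r" "2^r" _ "2^r" _ "2^r"]
  have [simp]: "coroot r i t \<in> carrier_mat (2^r) (2^r)" "\<And>b. x_pos r i b \<in> carrier_mat (2^r) (2^r)"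
    "\<And>b. y_neg r i b \<in> carrier_mat (2^r) (2^r)" using i t by auto
  let ?c = "(t - 1) / t"
  have "x_pos r i (t - 1) * y_neg r i 1 = y_neg r i (1 / t) * (coroot r i t * x_pos r i ?c)"
    using x_pos_y_neg_same[OF i, of t "t - 1" 1] t by simp
  then have "y_neg r i (- (1 / t)) * (x_pos r i (t - 1) * y_neg r i 1) * x_pos r i (- ?c)
      = (y_neg r i (- (1 / t)) * y_neg r i (1 / t)) * (coroot r i t * (x_pos r i ?c * x_pos r i (- ?c)))"
    by (simp add: R)
  also have "\<dots> = coroot r i t" by (simp add: y_neg_add[OF i] x_pos_add[OF i] y_neg_0[OF i] x_pos_0[OF i])
  finally show ?thesis by (metis grp_mult_closed(1) x_pos_mem(1)[OF i] y_neg_mem(1)[OF i])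
qed

lemma grp_subset_G: "grp_N r \<subseteq> grp_G r" "grp_N_minus r \<subseteq> grp_G r" "grp_H r \<subseteq> grp_G r"
proof -
  have "g \<in> grp_G r" if "g \<in> grp_N r" for g
    using that by (induction rule: grp_N_induct) (simp_all add: grp_one(1) grp_mult_closed(1) x_pos_mem(1))
  moreover have "g \<in> grp_G r" if "g \<in> grp_N_minus r" for g
    using that by (induction rule: grp_N_minus_induct) (simp_all add: grp_one(1) grp_mult_closed(1) y_neg_mem(1))
  moreover have "g \<in> grp_G r" if "g \<in> grp_H r" for g
    using that by (induction rule: grp_H_induct) (simp_all add: grp_one(1) grp_mult_closed(1) coroot_mem_G)
  ultimately show "grp_N r \<subseteq> grp_G r" "grp_N_minus r \<subseteq> grp_G r" "grp_H r \<subseteq> grp_G r" by blast+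
qed

lemma grp_G0_subset: "grp_G0 r \<subseteq> grp_G r"
  using grp_subset_G[of r] by (fastforce simp: grp_G0_def intro: grp_mult_closed(1))

section \<open>The big cell is dense\<close>

text \<open>
  Move $y_i(t)$ to the left through the factors of $n$. A factor $x_j(s)$ with $j \ne i$ commutes with
  it, and a factor $x_i(s)$ replaces the parameter $b$ by $b / (1 + sb)$. Starting from $t$, the
  parameter is therefore always of the form $t / (1 + ct)$, and each step excludes at most one
  further value of $t$.
\<close>

lemma grp_N_y_neg:
  assumes n: "n \<in> grp_N r" and i: "1 \<le> i" "i \<le> r"
  shows "\<exists>c B. finite B \<and> (\<forall>t. t \<notin> B \<longrightarrow> 1 + c * t \<noteq> 0 \<and>
     (\<exists>h\<in>grp_H r. \<exists>n'\<in>grp_N r. n * y_neg r i t = y_neg r i (t / (1 + c * t)) * (h * n')))"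
  using n
proof (induction rule: grp_N_induct)
  case one
  show ?case
    by (rule exI[of _ 0], rule exI[of _ "{}"])
       (use i in \<open>auto intro!: bexI[of _ "1\<^sub>m (2^r)"] simp: grp_one\<close>)
next
  case (mult j s n)
  note R = assoc_mult_mat[of _ "2^r" "2^r" _ "2^r" _ "2^r"]
  obtain c B where fin: "finite B" and IH: "\<And>t. t \<notin> B \<Longrightarrow> 1 + c * t \<noteq> 0 \<and>
     (\<exists>h\<in>grp_H r. \<exists>n'\<in>grp_N r. n * y_neg r i t = y_neg r i (t / (1 + c * t)) * (h * n'))"
    using mult(4) by blast
  have [simp]: "n \<in> carrier_mat (2^r) (2^r)" "\<And>b. y_neg r i b \<in> carrier_mat (2^r) (2^r)"
    "\<And>b. x_pos r j b \<in> carrier_mat (2^r) (2^r)"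
    "\<And>h. h \<in> grp_H r \<Longrightarrow> h \<in> carrier_mat (2^r) (2^r)" "\<And>h. h \<in> grp_N r \<Longrightarrow> h \<in> carrier_mat (2^r) (2^r)"
    using mult i grp_carrier by auto
  show ?case
  proof (cases "j = i")
    case False
    show ?thesis
    proof (intro exI[of _ c] exI[of _ B] conjI allI impI fin)
      fix t assume t: "t \<notin> B"
      then show "1 + c * t \<noteq> 0" using IH by blast
      obtain h n' where h: "h \<in> grp_H r" "n' \<in> grp_N r" and eq: "n * y_neg r i t = y_neg r i (t / (1 + c * t)) * (h * n')"
        using IH[OF t] by blast
      obtain s' where s': "x_pos r j s * h = h * x_pos r j s'" using x_pos_grp_H[OF h(1) mult(1,2)] by blast
      have "x_pos r j s * n * y_neg r i t = x_pos r j s * y_neg r i (t / (1 + c * t)) * (h * n')"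
        using h by (simp add: R eq)
      also have "\<dots> = y_neg r i (t / (1 + c * t)) * (x_pos r j s * h * n')"
        unfolding x_pos_y_neg_other[OF mult(1,2) i False] using h by (simp add: R)
      also have "\<dots> = y_neg r i (t / (1 + c * t)) * (h * (x_pos r j s' * n'))"
        unfolding s' using h by (simp add: R)
      finally show "\<exists>h\<in>grp_H r. \<exists>n'\<in>grp_N r. x_pos r j s * n * y_neg r i t = y_neg r i (t / (1 + c * t)) * (h * n')"
        using h grp_mult_closed(2)[OF x_pos_mem(2)[OF mult(1,2)] h(2)] by blast
    qed
  next
    case True
    define c' where "c' = c + s"
    define B' where "B' = B \<union> {t. 1 + c' * t = 0}"
    have "t = - 1 / c'" if "1 + c' * t = 0" for t
    proof -
      have "c' \<noteq> 0" using that by auto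
      moreover have "t * c' = - 1" using that by (simp add: add_eq_0_iff mult.commute)
      ultimately show ?thesis by (metis nonzero_eq_divide_eq)
    qed
    then have "{t. 1 + c' * t = 0} \<subseteq> {- 1 / c'}" by auto
    then have fin': "finite B'" using fin finite_subset by (auto simp: B'_def)
    show ?thesis
    proof (intro exI[of _ c'] exI[of _ B'] conjI allI impI fin')
      fix t assume "t \<notin> B'"
      then have t: "t \<notin> B" and c': "1 + c' * t \<noteq> 0" by (auto simp: B'_def)
      show "1 + c' * t \<noteq> 0" by (rule c')
      have c: "1 + c * t \<noteq> 0" using IH[OF t] by blast
      obtain h n' where h: "h \<in> grp_H r" "n' \<in> grp_N r" and eq: "n * y_neg r i t = y_neg r i (t / (1 + c * t)) * (h * n')"
        using IH[OF t] by blast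
      define u where "u = 1 + s * (t / (1 + c * t))"
      have u': "u = (1 + c' * t) / (1 + c * t)" using c by (simp add: u_def c'_def field_simps)
      have u0: "u \<noteq> 0" using c c' by (simp add: u')
      have bu: "t / (1 + c * t) / u = t / (1 + c' * t)" using c c' by (simp add: u')
      obtain s' where s': "x_pos r j (s / u) * h = h * x_pos r j s'" using x_pos_grp_H[OF h(1) mult(1,2)] by blast
      have [simp]: "coroot r i u \<in> carrier_mat (2^r) (2^r)" "\<And>b. x_pos r i b \<in> carrier_mat (2^r) (2^r)" using i u0 by auto
      have "x_pos r j s * n * y_neg r i t = x_pos r j s * y_neg r i (t / (1 + c * t)) * (h * n')"
        using h by (simp add: R eq)
      also have "\<dots> = y_neg r i (t / (1 + c' * t)) * (coroot r i u * (x_pos r j (s / u) * h * n'))"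
        unfolding True x_pos_y_neg_same[OF i u_def u0] bu using h by (simp add: R)
      also have "\<dots> = y_neg r i (t / (1 + c' * t)) * (coroot r i u * h * (x_pos r j s' * n'))"
        unfolding s' using h by (simp add: R)
      finally show "\<exists>h\<in>grp_H r. \<exists>n'\<in>grp_N r. x_pos r j s * n * y_neg r i t = y_neg r i (t / (1 + c' * t)) * (h * n')"
        using grp_mult_closed(2)[OF x_pos_mem(2)[OF mult(1,2)] h(2)] grp_mult_closed(4)[OF coroot_mem[OF i u0] h(1)] by blast
    qed
  qed
qed

lemma grp_G0_x_pos:
  assumes "x \<in> grp_G0 r" "1 \<le> i" "i \<le> r"
  shows "x * x_pos r i t \<in> grp_G0 r"
proof -
  note R = assoc_mult_mat[of _ "2^r" "2^r" _ "2^r" _ "2^r"]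
  obtain a h b where x: "x = a * h * b" and m: "a \<in> grp_N_minus r" "h \<in> grp_H r" "b \<in> grp_N r"
    using assms(1) by (auto simp: grp_G0_def)
  have "x * x_pos r i t = a * h * (b * x_pos r i t)"
    unfolding x using m assms grp_carrier by (intro R) auto
  then show ?thesis using m grp_mult_closed(2)[OF m(3) x_pos_mem(2)[OF assms(2,3)]]
    unfolding grp_G0_def by blast
qed

lemma grp_G0_y_neg:
  assumes "x \<in> grp_G0 r" and i: "1 \<le> i" "i \<le> r"
  shows "\<exists>B. finite B \<and> (\<forall>t. t \<notin> B \<longrightarrow> x * y_neg r i t \<in> grp_G0 r)"
proof -
  note R = assoc_mult_mat[of _ "2^r" "2^r" _ "2^r" _ "2^r"]
  obtain a h b where x: "x = a * h * b" and m: "a \<in> grp_N_minus r" "h \<in> grp_H r" "b \<in> grp_N r"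
    using assms(1) by (auto simp: grp_G0_def)
  obtain c B where fin: "finite B" and B: "\<And>t. t \<notin> B \<Longrightarrow>
     (\<exists>h\<in>grp_H r. \<exists>n'\<in>grp_N r. b * y_neg r i t = y_neg r i (t / (1 + c * t)) * (h * n'))"
    using grp_N_y_neg[OF m(3) i] by blast
  have "x * y_neg r i t \<in> grp_G0 r" if t: "t \<notin> B" for t
  proof -
    obtain h' n' where h': "h' \<in> grp_H r" "n' \<in> grp_N r" and eq: "b * y_neg r i t = y_neg r i (t / (1 + c * t)) * (h' * n')"
      using B[OF t] by blast
    obtain b' where b': "h * y_neg r i (t / (1 + c * t)) = y_neg r i b' * h" using grp_H_y_neg[OF m(2) i] by blast
    have [simp]: "a \<in> carrier_mat (2^r) (2^r)" "h \<in> carrier_mat (2^r) (2^r)" "b \<in> carrier_mat (2^r) (2^r)"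
      "h' \<in> carrier_mat (2^r) (2^r)" "n' \<in> carrier_mat (2^r) (2^r)" "\<And>b. y_neg r i b \<in> carrier_mat (2^r) (2^r)"
      using m h' grp_carrier i by auto
    have "x * y_neg r i t = a * (h * y_neg r i (t / (1 + c * t))) * (h' * n')" unfolding x by (simp add: R eq)
    also have "\<dots> = (a * y_neg r i b') * (h * h') * n'" unfolding b' by (simp add: R)
    finally show ?thesis
      using grp_mult_closed(3)[OF m(1) y_neg_mem(2)[OF i]] grp_mult_closed(4)[OF m(2) h'(1)] h'(2)
      unfolding grp_G0_def by blast
  qed
  then show ?thesis using fin by blast
qed

lemma coord_ring_continuous:
  assumes "p \<in> coord_ring n"
    and M: "\<And>t. M t \<in> carrier_mat n n" "\<And>t. det (M t) \<noteq> 0"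
    and cont: "\<And>i j. i < n \<Longrightarrow> j < n \<Longrightarrow> continuous_on UNIV (\<lambda>t :: complex. M t $$ (i, j))"
  shows "continuous_on UNIV (\<lambda>t. p (M t))"
  using assms(1)
proof induction
  case inv_det
  have "continuous_on UNIV (\<lambda>t. \<Sum>q | q permutes {0..<n}. signof q * (\<Prod>i = 0..<n. M t $$ (i, q i)))"
    by (intro continuous_intros cont) (auto simp: permutes_in_image)
  then have "continuous_on UNIV (\<lambda>t. det (M t))" by (simp add: det_def'[OF M(1)])
  then show ?case by (intro continuous_intros) (simp_all add: M)
qed (auto intro!: continuous_intros cont)

text \<open>
  A finite set has no limit points.
\<close>

lemma continuous_zero_cofinite:
  fixes f :: "complex \<Rightarrow> complex"
  assumes "continuous_on UNIV f" "finite B" "\<And>t. t \<notin> B \<Longrightarrow> f t = 0"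
  shows "f t = 0"
proof -
  have "\<forall>\<^sub>F s in at t. s \<notin> B"
    using islimpt_finite[OF assms(2), of t] unfolding islimpt_iff_eventually by simp
  then have "\<forall>\<^sub>F s in at t. f s = 0" by eventually_elim (use assms(3) in auto)
  then have "(f \<longlongrightarrow> 0) (at t)" by (simp add: tendsto_eventually)
  moreover have "(f \<longlongrightarrow> f t) (at t)" using assms(1) by (simp add: continuous_on_def)
  ultimately show ?thesis by (metis tendsto_unique at_neq_bot)
qed

text \<open>
  Induction on a word for $g$, for all $x \in G_0$ at once: the first letter of the word is absorbed
  into $x$. For a letter $y_i(t)$ this is possible for all but finitely many parameters, and the value
  of $p$ depends continuously on the parameter.
\<close>

lemma translate_big_cell_dense:
  assumes p: "p \<in> coord_ring (2^r)" and w: "w \<in> grp_G r"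
    and zero: "\<And>x. x \<in> grp_G0 r \<Longrightarrow> p (w * x) = 0" and g: "g \<in> grp_G r"
  shows "p (w * g) = 0"
proof -
  note R = assoc_mult_mat[of _ "2^r" "2^r" _ "2^r" _ "2^r"]
  have "\<forall>x\<in>grp_G0 r. p (w * (x * g)) = 0" using g
  proof (induction rule: grp_G_induct)
    case one
    then show ?case using zero grp_G0_subset[of r] grp_carrier by auto
  next
    case (x i t g)
    show ?case
    proof
      fix y assume y: "y \<in> grp_G0 r"
      then have "y * (x_pos r i t * g) = y * x_pos r i t * g"
        using x grp_G0_subset[of r] grp_carrier by (intro R[symmetric]) auto
      then show "p (w * (y * (x_pos r i t * g))) = 0" using x(4) grp_G0_x_pos[OF y x(1,2)] by simp
    qed
  next
    case (y i t g)
    show ?case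
    proof
      fix x assume x: "x \<in> grp_G0 r"
      have [simp]: "x \<in> carrier_mat (2^r) (2^r)" "g \<in> carrier_mat (2^r) (2^r)" "w \<in> carrier_mat (2^r) (2^r)"
        "\<And>t. y_neg r i t \<in> carrier_mat (2^r) (2^r)"
        using x y w grp_G0_subset[of r] grp_carrier by auto
      define M where "M t = w * (x * (y_neg r i t * g))" for t
      have MG: "M t \<in> grp_G r" for t
        unfolding M_def using x y w grp_G0_subset[of r] by (intro grp_mult_closed y_neg_mem) auto
      \<comment> \<open>the entries are affine in the parameter, since \<open>chev_f r i\<close> has square zero\<close>
      have M_eq: "M t = w * (x * g) + t \<cdot>\<^sub>m (w * (x * (chev_f r i * g)))" for t
        unfolding M_def y_neg_eq[OF y(1,2)]
        by (simp add: add_mult_distrib_mat[of _ "2^r" "2^r" _ _ "2^r"] mult_add_distrib_mat[of _ "2^r" "2^r" _ "2^r"]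
            mult_smult_distrib[of _ "2^r" "2^r" _ "2^r"] mult_smult_assoc_mat[of _ "2^r" "2^r" _ "2^r"])
      have cont: "continuous_on UNIV (\<lambda>t. p (M t))"
      proof (rule coord_ring_continuous[OF p])
        show "M t \<in> carrier_mat (2^r) (2^r)" "det (M t) \<noteq> 0" for t
          using MG grp_GL(1) GL_carrier_mat GL_det by blast+
        fix k l :: nat assume kl: "k < 2^r" "l < 2^r"
        have "M t $$ (k, l) = (w * (x * g)) $$ (k, l) + t * (w * (x * (chev_f r i * g))) $$ (k, l)" for t
          unfolding M_eq
        proof (subst index_add_mat(1))
          show "k < dim_row (t \<cdot>\<^sub>m (w * (x * (chev_f r i * g))))" "l < dim_col (t \<cdot>\<^sub>m (w * (x * (chev_f r i * g))))"
            using kl carrier_matD[of w "2^r" "2^r"] carrier_matD[of g "2^r" "2^r"] by auto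
          then show "(w * (x * g)) $$ (k, l) + (t \<cdot>\<^sub>m (w * (x * (chev_f r i * g)))) $$ (k, l)
            = (w * (x * g)) $$ (k, l) + t * (w * (x * (chev_f r i * g))) $$ (k, l)" by (simp del: index_mult_mat(1))
        qed
        then show "continuous_on UNIV (\<lambda>t. M t $$ (k, l))" by (auto intro!: continuous_intros)
      qed
      obtain B where B: "finite B" "\<And>t. t \<notin> B \<Longrightarrow> x * y_neg r i t \<in> grp_G0 r"
        using grp_G0_y_neg[OF x y(1,2)] by blast
      have "p (M t) = 0" if "t \<notin> B" for t
      proof -
        have "M t = w * (x * y_neg r i t * g)" by (simp add: M_def R)
        then show ?thesis using y(4) B(2)[OF that] by simp
      qed
      then have "p (M t) = 0" by (rule continuous_zero_cofinite[OF cont B(1)])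
      then show "p (w * (x * (y_neg r i t * g))) = 0" by (simp add: M_def)
    qed
  qed
  moreover have "1\<^sub>m (2^r) \<in> grp_G0 r"
    unfolding grp_G0_def using grp_one[of r] by (auto intro!: exI[of _ "1\<^sub>m (2^r)"])
  ultimately show ?thesis using g grp_carrier(1) by fastforce
qed

section \<open>Regular functions\<close>

lemma regular_on_const: "regular_on n X (\<lambda>_. c)"
  unfolding regular_on_def by (rule bexI[OF _ coord_ring.const[of c]]) simp

lemma regular_on_entry: "i < n \<Longrightarrow> j < n \<Longrightarrow> regular_on n X (\<lambda>g. g $$ (i, j))"
  unfolding regular_on_def by (rule bexI[OF _ coord_ring.entry[of i n j]]) simp_all

lemma regular_on_inv_det: "regular_on n X (\<lambda>g. inverse (det g))"
  unfolding regular_on_def by (rule bexI[OF _ coord_ring.inv_det]) simp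

lemma regular_on_add:
  assumes "regular_on n X p" "regular_on n X q"
  shows "regular_on n X (\<lambda>g. p g + q g)"
proof -
  obtain p' q' where "p' \<in> coord_ring n" "q' \<in> coord_ring n" "\<forall>g\<in>X. p g = p' g" "\<forall>g\<in>X. q g = q' g"
    using assms by (auto simp: regular_on_def)
  then show ?thesis unfolding regular_on_def by (intro bexI[OF _ coord_ring.add[of p' n q']]) auto
qed

lemma regular_on_mult:
  assumes "regular_on n X p" "regular_on n X q"
  shows "regular_on n X (\<lambda>g. p g * q g)"
proof -
  obtain p' q' where "p' \<in> coord_ring n" "q' \<in> coord_ring n" "\<forall>g\<in>X. p g = p' g" "\<forall>g\<in>X. q g = q' g"
    using assms by (auto simp: regular_on_def)
  then show ?thesis unfolding regular_on_def by (intro bexI[OF _ coord_ring.mult[of p' n q']]) auto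
qed

lemma regular_on_sum: "(\<And>i. i \<in> I \<Longrightarrow> regular_on n X (f i)) \<Longrightarrow> regular_on n X (\<lambda>g. \<Sum>i\<in>I. f i g)"
  by (induction I rule: infinite_finite_induct) (auto intro: regular_on_add regular_on_const)

lemma regular_on_prod: "(\<And>i. i \<in> I \<Longrightarrow> regular_on n X (f i)) \<Longrightarrow> regular_on n X (\<lambda>g. \<Prod>i\<in>I. f i g)"
  by (induction I rule: infinite_finite_induct) (auto intro: regular_on_mult regular_on_const)

lemma regular_on_cong: "(\<And>g. g \<in> X \<Longrightarrow> p g = q g) \<Longrightarrow> regular_on n X p \<longleftrightarrow> regular_on n X q"
  by (simp add: regular_on_def)

lemma regular_on_det:
  assumes A: "\<And>g. g \<in> X \<Longrightarrow> A g \<in> carrier_mat m m"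
    and reg: "\<And>i j. i < m \<Longrightarrow> j < m \<Longrightarrow> regular_on n X (\<lambda>g. A g $$ (i, j))"
  shows "regular_on n X (\<lambda>g. det (A g))"
proof -
  have "regular_on n X (\<lambda>g. \<Sum>q | q permutes {0..<m}. signof q * (\<Prod>i = 0..<m. A g $$ (i, q i)))"
    by (intro regular_on_sum regular_on_mult regular_on_const regular_on_prod reg) (auto simp: permutes_in_image)
  then show ?thesis by (subst regular_on_cong) (auto simp: det_def'[OF A])
qed

lemma regular_on_mat_mult:
  assumes AB: "\<And>g. g \<in> X \<Longrightarrow> A g \<in> carrier_mat m m" "\<And>g. g \<in> X \<Longrightarrow> B g \<in> carrier_mat m m"
    and reg: "\<And>i j. i < m \<Longrightarrow> j < m \<Longrightarrow> regular_on n X (\<lambda>g. A g $$ (i, j))"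
      "\<And>i j. i < m \<Longrightarrow> j < m \<Longrightarrow> regular_on n X (\<lambda>g. B g $$ (i, j))"
    and ij: "i < m" "j < m"
  shows "regular_on n X (\<lambda>g. (A g * B g) $$ (i, j))"
proof -
  have "(A g * B g) $$ (i, j) = (\<Sum>k = 0..<m. A g $$ (i, k) * B g $$ (k, j))" if "g \<in> X" for g
    using AB[OF that] ij by (auto simp: scalar_prod_def intro!: sum.cong)
  moreover have "regular_on n X (\<lambda>g. \<Sum>k = 0..<m. A g $$ (i, k) * B g $$ (k, j))"
    using ij by (intro regular_on_sum regular_on_mult reg) auto
  ultimately show ?thesis by (subst regular_on_cong) auto
qed

lemma regular_on_adj_mat:
  assumes X: "X \<subseteq> carrier_mat n n" and ij: "i < n" "j < n"
  shows "regular_on n X (\<lambda>g. adj_mat g $$ (i, j))"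
proof -
  have car: "mat_delete g j i \<in> carrier_mat (n - 1) (n - 1)" if "g \<in> X" for g
    using X that mat_delete_carrier by blast
  have "regular_on n X (\<lambda>g. (-1) ^ (j + i) * det (mat_delete g j i))"
  proof (intro regular_on_mult regular_on_const, rule regular_on_det[OF car])
    fix k l assume kl: "k < n - 1" "l < n - 1"
    let ?k = "if k < j then k else Suc k" and ?l = "if l < i then l else Suc l"
    have "mat_delete g j i $$ (k, l) = g $$ (?k, ?l)" if "g \<in> X" for g
      using X that kl by (auto simp: mat_delete_def)
    moreover have "regular_on n X (\<lambda>g. g $$ (?k, ?l))" by (rule regular_on_entry) (use kl in auto)
    ultimately show "regular_on n X (\<lambda>g. mat_delete g j i $$ (k, l))" by (subst regular_on_cong) auto
  qed
  moreover have "adj_mat g $$ (i, j) = (-1) ^ (j + i) * det (mat_delete g j i)" if "g \<in> X" for g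
    using X that ij by (auto simp: adj_mat_def cofactor_def)
  ultimately show ?thesis by (subst regular_on_cong) auto
qed

lemma regular_on_vrep:
  assumes X: "X \<subseteq> carrier_mat (2^r) (2^r)" and b: "b \<in> letters r"
  shows "regular_on (2^r) X (\<lambda>g. vrep r g b a)"
proof -
  obtain k l where kl: "probe b = (k, l)" "k < 2^r" "l < 2^r" using probe_less[OF b] by (cases "probe b") auto
  have car: "g \<in> carrier_mat (2^r) (2^r)" "adj_mat g \<in> carrier_mat (2^r) (2^r)" if "g \<in> X" for g
    using X that adj_mat(1) by auto
  have "regular_on (2^r) X (\<lambda>g. (g * vect r a * adj_mat g) $$ (k, l))"
    by (intro regular_on_mat_mult[where m = "2^r"] regular_on_adj_mat regular_on_entry regular_on_const)
       (use X kl car in \<open>auto intro!: mult_carrier_square\<close>)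
  then show ?thesis unfolding vrep_def kl by (intro regular_on_mult regular_on_const regular_on_inv_det)
qed

lemma regular_on_minor_vrep:
  assumes X: "X \<subseteq> carrier_mat (2^r) (2^r)" and bs: "set bs \<subseteq> letters r" "length bs = length as"
  shows "regular_on (2^r) X (\<lambda>g. minor (vrep r g) bs as)"
  unfolding minor_def
proof (rule regular_on_det)
  fix i j assume "i < length as" "j < length as"
  moreover from this bs have "bs ! i \<in> letters r" by (metis nth_mem subsetD)
  ultimately show "regular_on (2^r) X (\<lambda>g. mat (length as) (length as) (\<lambda>(i, j). vrep r g (bs ! i) (as ! j)) $$ (i, j))"
    using regular_on_vrep[OF X, of "bs ! i" "as ! j"] by simp
qed simp

section \<open>The torus component and its fundamental weights\<close>

text \<open>
  The element of $H$ with coordinates $t_1, \dots, t_r$.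
\<close>

definition tor :: "nat \<Rightarrow> (nat \<Rightarrow> complex) \<Rightarrow> complex mat" where
  "tor r t = mat_diag (2^r) (\<lambda>S. \<Prod>j\<in>{1..r}. t j powi coroot_weight r j S)"

definition tor_act :: "nat \<Rightarrow> (nat \<Rightarrow> complex) \<Rightarrow> letter \<Rightarrow> letter \<Rightarrow> complex" where
  "tor_act r t b a = (if b = a then \<Prod>j\<in>{1..r}. t j powi letter_weight r j a else 0)"

lemma mat_prod_diag: "mat_prod n (map (\<lambda>j. mat_diag n (f j)) js) = mat_diag n (\<lambda>S. prod_list (map (\<lambda>j. f j S) js))"
  by (induction js) (simp_all add: mat_prod_def)

lemma coroot_product_eq_tor:
  assumes "\<forall>j\<in>{1..r}. t j \<noteq> 0"
  shows "mat_prod (2^r) (map (\<lambda>j. coroot r j (t j)) [1..<Suc r]) = tor r t"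
proof -
  have "map (\<lambda>j. coroot r j (t j)) [1..<Suc r] = map (\<lambda>j. mat_diag (2^r) (\<lambda>S. t j powi coroot_weight r j S)) [1..<Suc r]"
    using assms by (intro map_cong refl coroot_eq) auto
  then show ?thesis
    by (simp only: mat_prod_diag tor_def) (simp add: prod.distinct_set_conv_list[symmetric] atLeastLessThanSuc_atLeastAtMost del: upt_Suc)
qed

lemma prod_fun_upd:
  assumes "finite I" "i \<in> I" "\<And>x y k. G (x * y) k = G x k * G y (k :: 'k) "
  shows "G s (k i) * (\<Prod>j\<in>I. G (t j) (k j)) = (\<Prod>j\<in>I. G ((t(i := s * t i)) j) (k j) :: complex)"
proof -
  have "(\<Prod>j\<in>I - {i}. G ((t(i := s * t i)) j) (k j)) = (\<Prod>j\<in>I - {i}. G (t j) (k j))"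
    by (intro prod.cong) auto
  then show ?thesis using assms by (simp add: prod.remove[of I i])
qed

lemma intertwines_cong:
  assumes "intertwines r g M" "\<And>b a. b \<in> letters r \<Longrightarrow> a \<in> letters r \<Longrightarrow> M b a = M' b a"
  shows "intertwines r g M'"
proof -
  have "lin r (\<lambda>b. M b a) = lin r (\<lambda>b. M' b a)" if "a \<in> letters r" for a
    using assms(2) that by (intro lin_cong) auto
  then show ?thesis using assms(1) by (auto simp: intertwines_def)
qed

lemma intertwines_one: "intertwines r (1\<^sub>m (2^r)) (\<lambda>b a. if b = a then 1 else 0)"
  unfolding intertwines_def by (auto simp: lin_1' one_smult_mat)

lemma intertwines_coroot_product:
  assumes "set js \<subseteq> {1..r}" "\<forall>j\<in>{1..r}. t j \<noteq> 0"
  shows "intertwines r (mat_prod (2^r) (map (\<lambda>j. coroot r j (t j)) js))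
    (\<lambda>b a. if b = a then prod_list (map (\<lambda>j. t j powi letter_weight r j a) js) else 0)"
  using assms(1)
proof (induction js)
  case Nil
  then show ?case using intertwines_cong[OF intertwines_one] by (simp add: mat_prod_def)
next
  case (Cons i js)
  let ?D = "\<lambda>js b a. if b = a then prod_list (map (\<lambda>j. t j powi letter_weight r j a) js) else 0"
  have i: "1 \<le> i" "i \<le> r" "t i \<noteq> 0" using Cons.prems assms(2) by auto
  have IH: "intertwines r (mat_prod (2^r) (map (\<lambda>j. coroot r j (t j)) js)) (?D js)" using Cons by simp
  have "intertwines r (coroot r i (t i) * mat_prod (2^r) (map (\<lambda>j. coroot r j (t j)) js)) (?D (i # js))"
  proof (rule intertwines_cong[OF intertwines_mult[OF intertwines_coroot[OF i] IH]])
    fix b a assume ab: "b \<in> letters r" "a \<in> letters r"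
    have "letter_comp r (torus_act r i (t i)) (?D js) b a
        = (\<Sum>c\<in>letters r. if c = b then (t i powi letter_weight r i b) * ?D js b a else 0)"
      unfolding letter_comp_def by (intro sum.cong refl) (auto simp: torus_act_def)
    then show "letter_comp r (torus_act r i (t i)) (?D js) b a = ?D (i # js) b a"
      using ab by simp
  qed
  then show ?case by (simp add: mat_prod_def)
qed

lemma intertwines_tor:
  assumes "\<forall>j\<in>{1..r}. t j \<noteq> 0"
  shows "intertwines r (tor r t) (tor_act r t)"
proof -
  have "set [1..<Suc r] \<subseteq> {1..r}" by auto
  from intertwines_coroot_product[OF this assms] show ?thesis
    unfolding coroot_product_eq_tor[OF assms]
    by (rule intertwines_cong)
       (simp add: tor_act_def prod.distinct_set_conv_list[symmetric] atLeastLessThanSuc_atLeastAtMost del: upt_Suc)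
qed

lemma grp_H_tor:
  assumes "h \<in> grp_H r"
  shows "\<exists>t. (\<forall>j\<in>{1..r}. t j \<noteq> 0) \<and> h = tor r t"
  using assms
proof (induction rule: grp_H_induct)
  case one
  then show ?case by (intro exI[of _ "\<lambda>_. 1"]) (simp add: tor_def)
next
  case (mult i s g)
  then obtain t where t: "\<forall>j\<in>{1..r}. t j \<noteq> 0" "g = tor r t" by blast
  let ?t = "t(i := s * t i)"
  have i: "i \<in> {1..r}" using mult by simp
  note upd = prod_fun_upd[OF finite_atLeastAtMost i, of "\<lambda>x k. x powi k", OF power_int_mult_distrib]
  have "coroot r i s * g = tor r ?t"
    unfolding t(2) tor_def coroot_eq[OF mult(1-3)] mat_diag_diag
    by (rule arg_cong[where f = "mat_diag _"], rule ext, rule upd)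
  moreover have "\<forall>j\<in>{1..r}. ?t j \<noteq> 0" using t(1) mult(3) by simp
  ultimately show ?case by blast
qed

text \<open>
  In the order of the letters $f_i$ moves upwards, so the matrices of $N_-$ are lower unitriangular and
  those of $N$ upper unitriangular.
\<close>

definition lower_unip :: "nat \<Rightarrow> (letter \<Rightarrow> letter \<Rightarrow> complex) \<Rightarrow> bool" where
  "lower_unip r M \<longleftrightarrow> (\<forall>a\<in>letters r. M a a = 1 \<and> (\<forall>b\<in>letters r. b < a \<longrightarrow> M b a = 0))"

lemma lower_unip_comp:
  assumes A: "lower_unip r A" and B: "lower_unip r B"
  shows "lower_unip r (letter_comp r A B)"
  unfolding lower_unip_def
proof (intro ballI conjI impI)
  fix a assume a: "a \<in> letters r"
  have z: "A a c * B c a = (if c = a then 1 else 0)" if "c \<in> letters r" for c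
    using A B a that unfolding lower_unip_def by (cases c a rule: linorder_cases) auto
  show "letter_comp r A B a a = 1" unfolding letter_comp_def using a by (simp add: z)
  fix b assume b: "b \<in> letters r" "b < a"
  have "A b c * B c a = 0" if "c \<in> letters r" for c
  proof (cases "c < a")
    case True
    then show ?thesis using B a that by (simp add: lower_unip_def)
  next
    case False
    then have "b < c" using b by order
    then show ?thesis using A b that by (simp add: lower_unip_def)
  qed
  then show "letter_comp r A B b a = 0" unfolding letter_comp_def by (intro sum.neutral) blast
qed

lemma letter_comp_transpose:
  "(\<lambda>b a. letter_comp r A B a b) = letter_comp r (\<lambda>b a. B a b) (\<lambda>b a. A a b)"
  by (simp add: letter_comp_def mult.commute fun_eq_iff)

lemma lower_unip_lower_act: "1 \<le> i \<Longrightarrow> i \<le> r \<Longrightarrow> lower_unip r (lower_act r i t)"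
  by (auto simp: lower_unip_def lower_act_def)

lemma flip_less_iff [simp]: "flip a < flip b \<longleftrightarrow> b < a"
  by (cases a; cases b) auto

lemma flip_in_letters [simp]: "flip a \<in> letters r \<longleftrightarrow> a \<in> letters r"
  by (cases a) auto

lemma upper_unip_raise_act:
  assumes "1 \<le> i" "i \<le> r"
  shows "lower_unip r (\<lambda>b a. raise_act r i t a b)"
  using lower_unip_lower_act[OF assms, of t] unfolding lower_unip_def raise_act_def
  by (metis flip_in_letters flip_less_iff)

lemma lower_unip_one: "lower_unip r (\<lambda>b a. if b = a then 1 else 0)"
  by (auto simp: lower_unip_def)

lemma grp_N_minus_lower_unip: "a \<in> grp_N_minus r \<Longrightarrow> \<exists>M. intertwines r a M \<and> lower_unip r M"
proof (induction rule: grp_N_minus_induct)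
  case one
  then show ?case using intertwines_one lower_unip_one by blast
next
  case (mult i t g)
  then show ?case using intertwines_mult[OF intertwines_y_neg[of i r t]] lower_unip_comp[OF lower_unip_lower_act[of i r t]] by blast
qed

lemma grp_N_upper_unip: "b \<in> grp_N r \<Longrightarrow> \<exists>M. intertwines r b M \<and> lower_unip r (\<lambda>b a. M a b)"
proof (induction rule: grp_N_induct)
  case one
  have "lower_unip r (\<lambda>b a. if a = b then 1 else 0)" by (auto simp: lower_unip_def)
  then show ?case using intertwines_one by blast
next
  case (mult i t g)
  then obtain M where M: "intertwines r g M" "lower_unip r (\<lambda>b a. M a b)" by blast
  have "lower_unip r (\<lambda>b a. letter_comp r (raise_act r i t) M a b)"
    unfolding letter_comp_transpose by (rule lower_unip_comp[OF M(2) upper_unip_raise_act[OF mult(1,2)]])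
  then show ?case using intertwines_mult[OF intertwines_x_pos[OF mult(1,2)] M(1)] by blast
qed

lemma minor_transpose:
  assumes "length bs = length as"
  shows "minor (\<lambda>b a. M a b) as bs = minor M bs as"
proof -
  let ?A = "mat (length as) (length as) (\<lambda>(i, j). M (bs ! i) (as ! j))"
  have "mat (length bs) (length bs) (\<lambda>(i, j). M (bs ! j) (as ! i)) = transpose_mat ?A"
    using assms by (intro eq_matI) auto
  then show ?thesis by (simp add: minor_def det_transpose[of ?A "length as"])
qed

lemma minor_zero_col:
  assumes "length bs = length as" "a \<in> set as" "\<And>b. b \<in> set bs \<Longrightarrow> M b a = 0"
  shows "minor M bs as = 0"
proof -
  obtain j where j: "j < length as" "a = as ! j" using assms(2) by (metis in_set_conv_nth)
  let ?A = "mat (length as) (length as) (\<lambda>(i, j). M (bs ! i) (as ! j))"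
  have "det ?A = (\<Sum>i<length as. ?A $$ (i, j) * cofactor ?A i j)"
    using j by (intro laplace_expansion_column) auto
  also have "\<dots> = 0" using assms j by (intro sum.neutral) auto
  finally show ?thesis by (simp add: minor_def)
qed

lemma minor_lower_triangular:
  "sorted_wrt (\<lambda>a a'. M a a' = 0) as \<Longrightarrow> minor M as as = prod_list (map (\<lambda>a. M a a) as)"
  by (induction as) (auto simp: minor_first_row)

lemma start_tuple_mem: "d \<le> r \<Longrightarrow> start_tuple d \<in> sorted_tuples (letters r) d"
  by (auto simp: start_tuple_def sorted_tuples_def sorted_wrt_map simp del: upt_Suc)

lemma set_start_tuple: "set (start_tuple d) = Plain ` {1..d}"
  by (auto simp: start_tuple_def simp del: upt_Suc)

lemma length_start_tuple [simp]: "length (start_tuple d) = d"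
  by (simp add: start_tuple_def)

text \<open>
  In the Cauchy-Binet expansion a tuple other than $(1, \dots, d)$ contains a letter larger than $d$,
  whose column in a lower triangular matrix vanishes on the rows $1, \dots, d$.
\<close>

lemma minor_lower_unip_comp:
  assumes A: "lower_unip r A" and d: "d \<le> r"
  shows "minor (letter_comp r A M) (start_tuple d) (start_tuple d) = minor M (start_tuple d) (start_tuple d)"
proof -
  let ?s = "start_tuple d"
  note s = start_tuple_mem[OF d]
  have lt: "Plain i < c" if "c \<in> letters r" "c \<notin> set ?s" "i \<le> d" for c i
    using that by (cases c) (auto simp: set_start_tuple)
  have A0: "A b c = 0" if "c \<in> letters r" "c \<notin> set ?s" "b \<in> set ?s" for b c
    using lt[OF that(1,2)] that d A by (auto simp: set_start_tuple lower_unip_def)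
  have "minor (letter_comp r A M) ?s ?s = (\<Sum>cs\<in>sorted_tuples (letters r) d. minor A ?s cs * minor M cs ?s)"
    unfolding letter_comp_def by (rule Cauchy_Binet) auto
  also have "\<dots> = (\<Sum>cs\<in>sorted_tuples (letters r) d. if cs = ?s then minor A ?s ?s * minor M ?s ?s else 0)"
  proof (intro sum.cong refl)
    fix cs assume cs: "cs \<in> sorted_tuples (letters r) d"
    show "minor A ?s cs * minor M cs ?s = (if cs = ?s then minor A ?s ?s * minor M ?s ?s else 0)"
    proof (cases "set cs \<subseteq> set ?s")
      case True
      have "card (set cs) = d" "card (set ?s) = d"
        using cs s by (auto simp: sorted_tuples_def strict_sorted_iff distinct_card)
      then have "set cs = set ?s" using True by (metis card_subset_eq List.finite_set)
      then have "cs = ?s" using cs s by (auto simp: sorted_tuples_def intro: sorted_tuples_eqI)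
      then show ?thesis by simp
    next
      case False
      then obtain c where c: "c \<in> set cs" "c \<notin> set ?s" by blast
      then have "c \<in> letters r" using cs by (auto simp: sorted_tuples_def)
      then have "minor A ?s cs = 0" using cs c A0 by (intro minor_zero_col[of _ _ c]) (auto simp: sorted_tuples_def)
      then show ?thesis using False by auto
    qed
  qed
  also have "\<dots> = minor A ?s ?s * minor M ?s ?s" using s by (simp add: finite_sorted_tuples)
  also have "minor A ?s ?s = prod_list (map (\<lambda>a. A a a) ?s)"
  proof (rule minor_lower_triangular)
    have "sorted_wrt (<) ?s" "set ?s \<subseteq> letters r" using s by (auto simp: sorted_tuples_def)
    moreover from this(2) have "A a a' = 0" if "a \<in> set ?s" "a' \<in> set ?s" "a < a'" for a a'
      using A that unfolding lower_unip_def by blast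
    ultimately show "sorted_wrt (\<lambda>a a'. A a a' = 0) ?s"
      using sorted_wrt_mono_rel[of ?s "(<)" "\<lambda>a a'. A a a' = 0"] by blast
  qed
  also have "map (\<lambda>a. A a a) ?s = map (\<lambda>_. 1) ?s"
    using A s by (intro map_cong) (auto simp: lower_unip_def sorted_tuples_def)
  finally show ?thesis by (simp add: map_replicate_const)
qed

lemma minor_upper_unip_comp:
  assumes B: "lower_unip r (\<lambda>b a. B a b)" and d: "d \<le> r"
  shows "minor (letter_comp r M B) (start_tuple d) (start_tuple d) = minor M (start_tuple d) (start_tuple d)"
proof -
  let ?s = "start_tuple d"
  have "minor (letter_comp r M B) ?s ?s = minor (\<lambda>b a. letter_comp r M B a b) ?s ?s"
    by (rule minor_transpose[symmetric]) simp
  also have "\<dots> = minor (\<lambda>b a. M a b) ?s ?s"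
    unfolding letter_comp_transpose by (rule minor_lower_unip_comp[OF assms])
  also have "\<dots> = minor M ?s ?s" by (rule minor_transpose) simp
  finally show ?thesis .
qed

text \<open>
  The weight $\varepsilon_i = \Lambda_i - \Lambda_{i-1}$ for $i < r$; the product over
  $i \le d$ telescopes to $\Lambda_d$.
\<close>

lemma prod_mode_weight:
  assumes "1 \<le> i" "i < r"
  shows "(\<Prod>j\<in>{1..r}. t j powi mode_weight r j i) = t i * (if i = 1 then 1 else inverse (t (i - 1)) :: complex)"
proof -
  have "(\<Prod>j\<in>{1..r}. t j powi mode_weight r j i) = (\<Prod>j\<in>{1..r}. (if j = i then t j else 1) * (if j = i - 1 then inverse (t j) else 1))"
    using assms by (intro prod.cong refl) (auto simp: mode_weight_def)
  also have "\<dots> = t i * (if i = 1 then 1 else inverse (t (i - 1)))"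
    using assms by (auto simp: prod.distrib)
  finally show ?thesis .
qed

lemma minor_tor_act:
  assumes t: "\<forall>j\<in>{1..r}. t j \<noteq> 0" and d: "1 \<le> d" "d < r"
  shows "minor (tor_act r t) (start_tuple d) (start_tuple d) = t d"
proof -
  have "minor (tor_act r t) (start_tuple d) (start_tuple d) = prod_list (map (\<lambda>a. tor_act r t a a) (start_tuple d))"
  proof (rule minor_lower_triangular)
    have "sorted_wrt (<) (start_tuple d)" using start_tuple_mem[of d r] d by (auto simp: sorted_tuples_def)
    then show "sorted_wrt (\<lambda>a a'. tor_act r t a a' = 0) (start_tuple d)"
      by (rule sorted_wrt_mono_rel[rotated]) (auto simp: tor_act_def)
  qed
  also have "\<dots> = (\<Prod>i\<in>{1..d}. \<Prod>j\<in>{1..r}. t j powi mode_weight r j i)"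
    by (simp add: start_tuple_def tor_act_def comp_def prod.distinct_set_conv_list[symmetric]
        atLeastLessThanSuc_atLeastAtMost del: upt_Suc)
  also have "\<dots> = t d" using d
  proof (induction d rule: nat_induct_at_least)
    case base
    then show ?case using prod_mode_weight[of 1 r t] d by simp
  next
    case (Suc n)
    then show ?case using prod_mode_weight[of "Suc n" r t] t by simp
  qed
  finally show ?thesis .
qed

lemma minor_gauss:
  assumes a: "a \<in> grp_N_minus r" and h: "tor r t \<in> grp_H r" and b: "b \<in> grp_N r"
    and t: "\<forall>j\<in>{1..r}. t j \<noteq> 0" and d: "1 \<le> d" "d < r"
  shows "minor (vrep r (a * tor r t * b)) (start_tuple d) (start_tuple d) = t d"
proof -
  obtain A where A: "intertwines r a A" "lower_unip r A" using grp_N_minus_lower_unip[OF a] by blast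
  obtain B where B: "intertwines r b B" "lower_unip r (\<lambda>b a. B a b)" using grp_N_upper_unip[OF b] by blast
  let ?s = "start_tuple d"
  let ?M = "letter_comp r (letter_comp r A (tor_act r t)) B"
  have "a * tor r t * b \<in> grp_G r" using a h b grp_subset_G[of r] by (intro grp_mult_closed) auto
  then have "det (a * tor r t * b) \<noteq> 0" using grp_GL(1) GL_det by blast
  moreover have "set ?s \<subseteq> letters r" using start_tuple_mem[of d r] d by (auto simp: sorted_tuples_def)
  ultimately have "minor (vrep r (a * tor r t * b)) ?s ?s = minor ?M ?s ?s"
    by (intro minor_cong vrep_eq[OF intertwines_mult[OF intertwines_mult[OF A(1) intertwines_tor[OF t]] B(1)]]) auto
  also have "\<dots> = t d" using minor_upper_unip_comp[OF B(2)] minor_lower_unip_comp[OF A(2)] minor_tor_act[OF t d] d by simp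
  finally show ?thesis .
qed

lemma bit_top [simp]: "bit (2 ^ r - 1 :: nat) k \<longleftrightarrow> k < r"
  by (metis bit_mask_iff mask_eq_exp_minus_1 possible_bit_nat)

lemma bit_top_Suc [simp]: "bit (2 ^ r - Suc 0 :: nat) k \<longleftrightarrow> k < r"
  using bit_top by simp

lemma chev_f_top:
  assumes i: "1 \<le> i" "i \<le> r" and S: "S < 2^r"
  shows "chev_f r i $$ (2^r - 1, S) = 0"
proof -
  have ne: "2 ^ r - 1 \<noteq> T" if "\<not> bit T (i - 1)" for T :: nat
    using that i bit_top[of r "i - 1"] by auto
  show ?thesis
  proof (cases "i = r")
    case True
    then show ?thesis using i S ne[of "unset_bit (i - 1) S"] by (simp add: chev_f_last annihilation_monomial)
  next
    case False
    then show ?thesis using i S ne[of "set_bit i (unset_bit (i - 1) S)"] by (simp add: chev_f_monomial)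
  qed
qed

lemma chev_e_top:
  assumes i: "1 \<le> i" "i \<le> r" and S: "S < 2^r"
  shows "chev_e r i $$ (S, 2^r - 1) = 0"
proof (cases "i = r")
  case True
  then show ?thesis using i S by (simp add: chev_e_last creation_monomial)
next
  case False
  then have "1 \<le> i" "i < r" "i - 1 < r" using i by auto
  then show ?thesis using S by (simp add: chev_e_monomial)
qed

lemma mat_mult_index_sum:
  "A \<in> carrier_mat n n \<Longrightarrow> B \<in> carrier_mat n n \<Longrightarrow> i < n \<Longrightarrow> j < n \<Longrightarrow>
    (A * B) $$ (i, j) = (\<Sum>k<n. A $$ (i, k) * B $$ (k, j))"
  by (auto simp: scalar_prod_def atLeast0LessThan intro!: sum.cong)

lemma unit_row_mult:
  assumes "A \<in> carrier_mat n n" "B \<in> carrier_mat n n" "i < n" "j < n" "\<And>k. k < n \<Longrightarrow> A $$ (i, k) = (if k = i then c else 0)"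
  shows "(A * B) $$ (i, j) = (c :: complex) * B $$ (i, j)"
proof -
  have "(A * B) $$ (i, j) = (\<Sum>k<n. if k = i then c * B $$ (i, j) else 0)"
    unfolding mat_mult_index_sum[OF assms(1-4)] using assms(5) by (intro sum.cong) auto
  then show ?thesis using assms(3) by simp
qed

lemma unit_col_mult:
  assumes "A \<in> carrier_mat n n" "B \<in> carrier_mat n n" "i < n" "j < n" "\<And>k. k < n \<Longrightarrow> B $$ (k, j) = (if k = j then c else 0)"
  shows "(A * B) $$ (i, j) = A $$ (i, j) * (c :: complex)"
proof -
  have "(A * B) $$ (i, j) = (\<Sum>k<n. if k = j then A $$ (i, j) * c else 0)"
    unfolding mat_mult_index_sum[OF assms(1-4)] using assms(5) by (intro sum.cong) auto
  then show ?thesis using assms(4) by simp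
qed

lemma grp_N_minus_top: "a \<in> grp_N_minus r \<Longrightarrow> S < 2^r \<Longrightarrow> a $$ (2^r - 1, S) = (if S = 2^r - 1 then 1 else 0)"
proof (induction arbitrary: S rule: grp_N_minus_induct)
  case one
  then show ?case by auto
next
  case (mult i t g)
  have "y_neg r i t $$ (2^r - 1, k) = (if k = 2^r - 1 then 1 else 0)" if "k < 2^r" for k
    unfolding y_neg_eq[OF mult(1,2)] using that chev_f_top[OF mult(1,2) that] carrier_matD[OF chev_f_carrier[of r i]] by auto
  then have "(y_neg r i t * g) $$ (2^r - 1, S) = 1 * g $$ (2^r - 1, S)"
    using mult grp_carrier by (intro unit_row_mult[of _ "2^r"]) auto
  then show ?case using mult by simp
qed

lemma grp_N_top: "b \<in> grp_N r \<Longrightarrow> S < 2^r \<Longrightarrow> b $$ (S, 2^r - 1) = (if S = 2^r - 1 then 1 else 0)"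
proof (induction arbitrary: S rule: grp_N_induct)
  case one
  then show ?case by auto
next
  case (mult i t g)
  have x: "x_pos r i t $$ (S, 2^r - 1) = (if S = 2^r - 1 then 1 else 0)"
    unfolding x_pos_eq[OF mult(1,2)] using mult(5) chev_e_top[OF mult(1,2,5)] carrier_matD[OF chev_e_carrier[of r i]] by auto
  have "(x_pos r i t * g) $$ (S, 2^r - 1) = x_pos r i t $$ (S, 2^r - 1) * 1"
    using mult grp_carrier by (intro unit_col_mult[of _ "2^r"]) auto
  then show ?case using x by simp
qed

lemma tor_top:
  assumes "1 \<le> r"
  shows "tor r t $$ (2^r - 1, 2^r - 1) = t r"
proof -
  have "tor r t $$ (2^r - 1, 2^r - 1) = (\<Prod>j\<in>{1..r}. t j powi coroot_weight r j (2^r - 1))"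
    by (simp add: tor_def mat_diag_def)
  also have "\<dots> = (\<Prod>j\<in>{1..r}. if j = r then t j else 1)"
    using assms by (intro prod.cong refl) (auto simp: coroot_weight_def)
  finally show ?thesis using assms by simp
qed

text \<open>
  The coordinate $t_r$ cannot be read off from the vector representation, on which the kernel of the
  spin covering acts trivially. It is the diagonal entry at the highest weight vector of the spin
  representation, the state with all modes occupied.
\<close>

lemma gauss_top:
  assumes a: "a \<in> grp_N_minus r" and h: "tor r t \<in> grp_H r" and b: "b \<in> grp_N r" and r: "1 \<le> r"
  shows "(a * tor r t * b) $$ (2^r - 1, 2^r - 1) = t r"
proof -
  have c: "a \<in> carrier_mat (2^r) (2^r)" "tor r t \<in> carrier_mat (2^r) (2^r)" "b \<in> carrier_mat (2^r) (2^r)"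
    using a h b grp_carrier by auto
  have "(a * tor r t * b) $$ (2^r - 1, 2^r - 1) = (a * tor r t) $$ (2^r - 1, 2^r - 1) * 1"
    using c grp_N_top[OF b] by (intro unit_col_mult[of _ "2^r"]) auto
  also have "(a * tor r t) $$ (2^r - 1, 2^r - 1) = 1 * tor r t $$ (2^r - 1, 2^r - 1)"
    using c grp_N_minus_top[OF a] by (intro unit_row_mult[of _ "2^r"]) auto
  finally show ?thesis using tor_top[OF r] by simp
qed

text \<open>
  The minors of the vector representation determine $t_1, \dots, t_{r-1}$, and the highest weight entry
  of the spin representation determines $t_r$.
\<close>

lemma gauss_unique:
  assumes a: "a \<in> grp_N_minus r" "a' \<in> grp_N_minus r" and h: "h \<in> grp_H r" "h' \<in> grp_H r"
    and b: "b \<in> grp_N r" "b' \<in> grp_N r" and eq: "a * h * b = a' * h' * b'" and r: "1 \<le> r"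
  shows "h = h'"
proof -
  obtain t where t: "\<forall>j\<in>{1..r}. t j \<noteq> 0" "h = tor r t" using grp_H_tor[OF h(1)] by blast
  obtain t' where t': "\<forall>j\<in>{1..r}. t' j \<noteq> 0" "h' = tor r t'" using grp_H_tor[OF h(2)] by blast
  have "t j = t' j" if j: "j \<in> {1..r}" for j
  proof (cases "j = r")
    case True
    then show ?thesis using gauss_top[OF a(1) _ b(1) r, of t] gauss_top[OF a(2) _ b(2) r, of t'] eq h t(2) t'(2) by simp
  next
    case False
    then have "1 \<le> j" "j < r" using j by auto
    then show ?thesis
      using minor_gauss[OF a(1) h(1)[unfolded t(2)] b(1) t(1)] minor_gauss[OF a(2) h(2)[unfolded t'(2)] b(2) t'(1)]
        eq[unfolded t(2) t'(2)] by metis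
  qed
  then show ?thesis unfolding t(2) t'(2) tor_def by (intro arg_cong[where f = "mat_diag _"] ext prod.cong) auto
qed

theorem fund_weight_torus_part:
  assumes x: "x \<in> grp_G0 r" and d: "1 \<le> d" "d < r"
  shows "fund_weight r d (torus_part r x) = minor (vrep r x) (start_tuple d) (start_tuple d)"
proof -
  obtain a h b where xe: "x = a * h * b" and m: "a \<in> grp_N_minus r" "h \<in> grp_H r" "b \<in> grp_N r"
    using x by (auto simp: grp_G0_def)
  have r: "1 \<le> r" using d by simp
  have tp: "torus_part r x = h"
    unfolding torus_part_def
  proof (rule the_equality)
    show "h \<in> grp_H r \<and> (\<exists>a\<in>grp_N_minus r. \<exists>b\<in>grp_N r. x = a * h * b)" using m xe by blast
    show "h' = h" if "h' \<in> grp_H r \<and> (\<exists>a\<in>grp_N_minus r. \<exists>b\<in>grp_N r. x = a * h' * b)" for h'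
      using that gauss_unique[OF _ m(1) _ m(2) _ m(3) _ r, of _ h'] xe by metis
  qed
  obtain t where t: "\<forall>j\<in>{1..r}. t j \<noteq> 0" "h = tor r t" using grp_H_tor[OF m(2)] by blast
  have "fund_weight r d h = t d"
    unfolding fund_weight_def
  proof (rule the_equality)
    show "\<exists>s. (\<forall>j\<in>{1..r}. s j \<noteq> 0) \<and> h = mat_prod (2^r) (map (\<lambda>j. coroot r j (s j)) [1..<Suc r]) \<and> t d = s d"
      using t coroot_product_eq_tor[OF t(1)] by metis
    fix c assume "\<exists>s. (\<forall>j\<in>{1..r}. s j \<noteq> 0) \<and> h = mat_prod (2^r) (map (\<lambda>j. coroot r j (s j)) [1..<Suc r]) \<and> c = s d"
    then obtain s where s: "\<forall>j\<in>{1..r}. s j \<noteq> 0" "h = tor r s" "c = s d"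
      using coroot_product_eq_tor by metis
    have "minor (vrep r (1\<^sub>m (2^r) * tor r u * 1\<^sub>m (2^r))) (start_tuple d) (start_tuple d) = u d"
      if "\<forall>j\<in>{1..r}. u j \<noteq> 0" "h = tor r u" for u
      using minor_gauss[OF grp_one(3) _ grp_one(2) that(1) d] m(2) that(2) by simp
    from this[OF s(1,2)] this[OF t] show "c = t d" using s t by simp
  qed
  moreover have "minor (vrep r x) (start_tuple d) (start_tuple d) = t d"
    using minor_gauss[OF m(1) m(2)[unfolded t(2)] m(3) t(1) d] by (simp add: xe t(2))
  ultimately show ?thesis by (simp add: tp)
qed

text \<open>
  The minor with rows \<open>es\<close> is regular and has the prescribed values on $\overline w G_0$, by
  \<open>fund_weight_torus_part\<close> and the hypothesis \<open>shift\<close>. Any other such function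
  agrees with it because $\overline w G_0$ is dense in $G$.
\<close>

theorem gen_minor_eq_minor:
  assumes w: "w_bar r js \<in> grp_G r" and d: "1 \<le> d" "d < r"
    and es: "length es = d" "set es \<subseteq> letters r"
    and shift: "\<And>g. g \<in> grp_G r \<Longrightarrow> minor (vrep r (w_bar r js * g)) es (start_tuple d) = minor (vrep r g) (start_tuple d) (start_tuple d)"
    and x: "x \<in> grp_G r"
  shows "gen_minor r js d x = minor (vrep r x) es (start_tuple d)"
proof -
  let ?w = "w_bar r js"
  define F where "F = restrict (\<lambda>x. minor (vrep r x) es (start_tuple d)) (grp_G r)"
  have X: "grp_G r \<subseteq> carrier_mat (2^r) (2^r)" using grp_carrier(1) by blast
  have inv: "inv\<^bsub>GL (2^r)\<^esub> ?w * (?w * g) = g" if "g \<in> grp_G r" for g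
  proof -
    interpret group "GL (2^r)" by (rule group_GL)
    show ?thesis using inv_solve_left[of "g" "?w" "?w * g"] m_closed[OF grp_GL(1)[OF w] grp_GL(1)[OF that]] grp_GL(1)[OF w] grp_GL(1)[OF that] by simp
  qed
  have "gen_minor r js d = F"
    unfolding gen_minor_def
  proof (rule the_equality)
    have "F x = fund_weight r d (torus_part r (inv\<^bsub>GL (2^r)\<^esub> ?w * x))" if x: "x \<in> (\<lambda>g. ?w * g) ` grp_G0 r" for x
    proof -
      obtain g where g: "x = ?w * g" "g \<in> grp_G0 r" using x by blast
      then have gG: "g \<in> grp_G r" using grp_G0_subset by blast
      then have "x \<in> grp_G r" using g w grp_mult_closed(1) by blast
      then show ?thesis using shift[OF gG] fund_weight_torus_part[OF g(2) d] inv[OF gG] by (simp add: F_def g(1))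
    qed
    moreover have "regular_on (2^r) (grp_G r) F"
      using regular_on_minor_vrep[OF X es(2), of "start_tuple d"] es(1)
      by (subst regular_on_cong[of _ _ "\<lambda>x. minor (vrep r x) es (start_tuple d)"]) (auto simp: F_def)
    ultimately show "F \<in> extensional (grp_G r) \<and> regular_on (2^r) (grp_G r) F \<and>
      (\<forall>x\<in>(\<lambda>g. ?w * g) ` grp_G0 r. F x = fund_weight r d (torus_part r (inv\<^bsub>GL (2^r)\<^esub> ?w * x)))"
      by (auto simp: F_def)
    note Fp = this
    fix F' assume F': "F' \<in> extensional (grp_G r) \<and> regular_on (2^r) (grp_G r) F' \<and>
      (\<forall>x\<in>(\<lambda>g. ?w * g) ` grp_G0 r. F' x = fund_weight r d (torus_part r (inv\<^bsub>GL (2^r)\<^esub> ?w * x)))"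
    obtain p p' where p: "p \<in> coord_ring (2^r)" "\<forall>g\<in>grp_G r. F g = p g" and p': "p' \<in> coord_ring (2^r)" "\<forall>g\<in>grp_G r. F' g = p' g"
      using Fp F' by (auto simp: regular_on_def)
    let ?q = "\<lambda>g. p g + (\<lambda>_. -1) g * p' g"
    have q: "?q \<in> coord_ring (2^r)" by (intro coord_ring.add coord_ring.mult coord_ring.const p p')
    have zero: "?q (?w * g) = 0" if "g \<in> grp_G0 r" for g
    proof -
      have "?w * g \<in> grp_G r" using that grp_G0_subset w grp_mult_closed(1) by blast
      moreover have "F (?w * g) = F' (?w * g)" using Fp F' that by auto
      ultimately show ?thesis using p p' by simp
    qed
    have "F' g = F g" if g: "g \<in> grp_G r" for g
    proof -
      interpret group "GL (2^r)" by (rule group_GL)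
      define g' where "g' = inv\<^bsub>GL (2^r)\<^esub> ?w * g"
      have "g' \<in> grp_G r" unfolding g'_def
        using grp_mult_closed(1)[OF subgroup.m_inv_closed[OF subgroup_G w] g] .
      moreover have "g = ?w * g'" unfolding g'_def
        using inv_solve_left[of "g'" "?w" g] grp_GL(1)[OF w] grp_GL(1)[OF g] grp_GL(1)[OF \<open>g' \<in> grp_G r\<close>] by (simp add: g'_def)
      ultimately show ?thesis using translate_big_cell_dense[OF q w zero, of g'] g p p' by auto
    qed
    then show "F' = F" using F' by (auto simp: F_def extensional_def fun_eq_iff)
  qed
  then show ?thesis using x by (simp add: F_def)
qed

section \<open>The lifted Weyl group element\<close>

definition monomial_row :: "nat \<Rightarrow> complex mat \<Rightarrow> letter \<Rightarrow> complex \<Rightarrow> letter \<Rightarrow> bool" where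
  "monomial_row r g b x b' \<longleftrightarrow> b' \<in> letters r \<and> (\<forall>c\<in>letters r. vrep r g b c = (if c = b' then x else 0))"

lemma ex_intertwines: "g \<in> grp_G r \<Longrightarrow> \<exists>M. intertwines r g M"
proof (induction rule: grp_G_induct)
  case one
  then show ?case using intertwines_one by blast
next
  case (x i t g)
  then show ?case using intertwines_mult[OF intertwines_x_pos[of i r t]] by blast
next
  case (y i t g)
  then show ?case using intertwines_mult[OF intertwines_y_neg[of i r t]] by blast
qed

lemma grp_G_det: "g \<in> grp_G r \<Longrightarrow> det g \<noteq> 0"
  using grp_GL(1) GL_det by blast

lemma intertwines_vrep:
  assumes "g \<in> grp_G r"
  shows "intertwines r g (vrep r g)"
proof -
  obtain M where M: "intertwines r g M" using ex_intertwines[OF assms] by blast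
  then show ?thesis by (rule intertwines_cong) (simp add: vrep_eq[OF M grp_G_det[OF assms]])
qed

lemma vrep_mult:
  assumes "g \<in> grp_G r" "h \<in> grp_G r" "a \<in> letters r" "b \<in> letters r"
  shows "vrep r (g * h) b a = letter_comp r (vrep r g) (vrep r h) b a"
  using assms by (intro vrep_eq intertwines_mult intertwines_vrep grp_G_det grp_mult_closed)

lemma letter_comp_support:
  assumes "S \<subseteq> letters r" "\<And>c. c \<in> letters r \<Longrightarrow> c \<notin> S \<Longrightarrow> A b c = 0"
  shows "letter_comp r A B b a = (\<Sum>c\<in>S. A b c * B c a)"
  unfolding letter_comp_def by (rule sum.mono_neutral_right) (use assms in auto)

lemma monomial_row_mult:
  assumes "g \<in> grp_G r" "h \<in> grp_G r" "b \<in> letters r" "monomial_row r g b x b'" "monomial_row r h b' y b''"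
  shows "monomial_row r (g * h) b (x * y) b''"
  unfolding monomial_row_def
proof (intro conjI ballI)
  show "b'' \<in> letters r" using assms(5) by (simp add: monomial_row_def)
  fix c assume c: "c \<in> letters r"
  have "vrep r (g * h) b c = (\<Sum>d\<in>{b'}. vrep r g b d * vrep r h d c)"
    unfolding vrep_mult[OF assms(1,2) c assms(3)]
    by (rule letter_comp_support) (use assms(4) in \<open>auto simp: monomial_row_def\<close>)
  then show "vrep r (g * h) b c = (if c = b'' then x * y else 0)"
    using assms(4,5) c by (simp add: monomial_row_def)
qed

lemma flip_eq_simps [simp]:
  "flip c = Plain k \<longleftrightarrow> c = Bar k" "flip c = Bar k \<longleftrightarrow> c = Plain k" "flip c = Nul \<longleftrightarrow> c = Nul"
  "Plain k = flip c \<longleftrightarrow> c = Bar k" "Bar k = flip c \<longleftrightarrow> c = Plain k" "Nul = flip c \<longleftrightarrow> c = Nul"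
  by (cases c; auto)+

lemma flip_inject [simp]: "flip a = flip b \<longleftrightarrow> a = b"
  by (metis flip_flip)

definition s_act :: "nat \<Rightarrow> nat \<Rightarrow> letter \<Rightarrow> letter \<Rightarrow> complex" where
  "s_act r i = letter_comp r (raise_act r i (-1)) (letter_comp r (lower_act r i 1) (raise_act r i (-1)))"

lemma s_bar_mem: "1 \<le> i \<Longrightarrow> i \<le> r \<Longrightarrow> s_bar r i \<in> grp_G r"
  unfolding s_bar_def by (intro grp_mult_closed x_pos_mem y_neg_mem)

lemma vrep_s_bar:
  assumes i: "1 \<le> i" "i \<le> r" and ab: "a \<in> letters r" "b \<in> letters r"
  shows "vrep r (s_bar r i) b a = s_act r i b a"
proof (rule vrep_eq[OF _ grp_G_det[OF s_bar_mem[OF i]] ab])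
  have "s_bar r i = x_pos r i (-1) * (y_neg r i 1 * x_pos r i (-1))"
    unfolding s_bar_def using i by (intro assoc_mult_mat[of _ "2^r" "2^r" _ "2^r" _ "2^r"]) auto
  then show "intertwines r (s_bar r i) (s_act r i)"
    unfolding s_act_def using i by (auto intro!: intertwines_mult intertwines_x_pos intertwines_y_neg)
qed

lemma monomial_row_s_bar_fixed:
  assumes i: "1 \<le> i" "i \<le> r" and b: "b \<in> letters r" "b \<noteq> Plain i" "b \<noteq> Bar i"
    "i < r \<Longrightarrow> b \<noteq> Plain (i + 1)" "i < r \<Longrightarrow> b \<noteq> Bar (i + 1)" "i = r \<Longrightarrow> b \<noteq> Nul"
  shows "monomial_row r (s_bar r i) b 1 b"
proof -
  have up: "raise_act r i t b c = (if c = b then 1 else 0)" for t c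
    using b i by (cases b; cases c) (auto simp: raise_act_def lower_act_def)
  have lo: "lower_act r i t b c = (if c = b then 1 else 0)" for t c
    using b i by (cases b; cases c) (auto simp: lower_act_def)
  have "letter_comp r (raise_act r i t) M b c = M b c" "letter_comp r (lower_act r i t) M b c = M b c" for M t c
    by (subst letter_comp_support[of "{b}"]; use b in \<open>auto simp: up lo\<close>)+
  then show ?thesis using b(1) by (auto simp: monomial_row_def vrep_s_bar[OF i] s_act_def up)
qed

text \<open>
  On a two-dimensional representation of $\mathrm{SL}_2$ the element $\overline{s_i}$ is the rotation
  with rows $(0, -1)$ and $(1, 0)$.
\<close>

lemma monomial_row_s_bar:
  assumes i: "1 \<le> i" "i < r"
  shows "monomial_row r (s_bar r i) (Plain (i + 1)) 1 (Plain i)"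
    and "monomial_row r (s_bar r i) (Bar i) 1 (Bar (i + 1))"
    and "monomial_row r (s_bar r i) (Bar (i + 1)) (-1) (Bar i)"
proof -
  have ir: "1 \<le> i" "i \<le> r" using i by auto
  have up: "letter_comp r (raise_act r i t) M (Plain (i + 1)) c = M (Plain (i + 1)) c" for M t c
    by (subst letter_comp_support[of "{Plain (i + 1)}"]) (use i in \<open>auto simp: raise_act_def lower_act_def\<close>)
  have up1: "letter_comp r (raise_act r i t) M (Bar i) c = M (Bar i) c" for M t c
    by (subst letter_comp_support[of "{Bar i}"]) (use i in \<open>auto simp: raise_act_def lower_act_def\<close>)
  have up2: "letter_comp r (raise_act r i t) M (Bar (i + 1)) c = M (Bar (i + 1)) c + t * M (Bar i) c" for M t c
    by (subst letter_comp_support[of "{Bar (i + 1), Bar i}"])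
       (use i in \<open>auto simp: raise_act_def lower_act_def\<close>)
  have lo: "letter_comp r (lower_act r i t) M (Plain (i + 1)) c = M (Plain (i + 1)) c + t * M (Plain i) c" for M t c
    by (subst letter_comp_support[of "{Plain (i + 1), Plain i}"]) (use i in \<open>auto simp: lower_act_def\<close>)
  have lo2: "letter_comp r (lower_act r i t) M (Bar i) c = M (Bar i) c + t * M (Bar (i + 1)) c" for M t c
    by (subst letter_comp_support[of "{Bar (i + 1), Bar i}"]) (use i in \<open>auto simp: lower_act_def\<close>)
  have lo3: "letter_comp r (lower_act r i t) M (Bar (i + 1)) c = M (Bar (i + 1)) c" for M t c
    by (subst letter_comp_support[of "{Bar (i + 1)}"]) (use i in \<open>auto simp: lower_act_def\<close>)
  show "monomial_row r (s_bar r i) (Plain (i + 1)) 1 (Plain i)"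
    "monomial_row r (s_bar r i) (Bar i) 1 (Bar (i + 1))"
    "monomial_row r (s_bar r i) (Bar (i + 1)) (-1) (Bar i)"
    using i by (auto simp: monomial_row_def vrep_s_bar[OF ir] s_act_def up[simplified] up1[simplified] up2[simplified] lo[simplified] lo2[simplified] lo3[simplified]
        raise_act_def lower_act_def)
qed

lemma monomial_row_s_bar_last:
  assumes r: "1 \<le> r"
  shows "monomial_row r (s_bar r r) (Bar r) 1 (Plain r)"
proof -
  have up: "letter_comp r (raise_act r r t) M (Bar r) c = M (Bar r) c" for M t c
    by (subst letter_comp_support[of "{Bar r}"]) (use r in \<open>auto simp: raise_act_def lower_act_def\<close>)
  have lo: "letter_comp r (lower_act r r 1) M (Bar r) c = M (Bar r) c + 2 * M Nul c + M (Plain r) c" for M c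
    by (subst letter_comp_support[of "{Bar r, Nul, Plain r}"]) (use r in \<open>auto simp: lower_act_def\<close>)
  show ?thesis
    using r by (auto simp: monomial_row_def vrep_s_bar s_act_def up lo raise_act_def lower_act_def)
qed

lemma w_bar_mem: "set js \<subseteq> {1..r} \<Longrightarrow> w_bar r js \<in> grp_G r"
proof (induction js)
  case Nil
  then show ?case using grp_one(1) by (simp add: w_bar_def mat_prod_def)
next
  case (Cons j js)
  then show ?case using grp_mult_closed(1)[OF s_bar_mem[of j r]] by (simp add: w_bar_def mat_prod_def)
qed

lemma w_bar_append:
  assumes "set js \<subseteq> {1..r}" "set ks \<subseteq> {1..r}"
  shows "w_bar r (js @ ks) = w_bar r js * w_bar r ks"
  using assms(1)
proof (induction js)
  case Nil
  then show ?case using grp_carrier(1)[OF w_bar_mem[OF assms(2)]] by (simp add: w_bar_def mat_prod_def)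
next
  case (Cons j js)
  have "s_bar r j * (w_bar r js * w_bar r ks) = s_bar r j * w_bar r js * w_bar r ks"
    using Cons.prems assms(2) grp_carrier(1)[OF w_bar_mem] grp_carrier(1)[OF s_bar_mem]
    by (intro assoc_mult_mat[symmetric, of _ "2^r" "2^r" _ "2^r" _ "2^r"]) auto
  then show ?case using Cons by (simp add: w_bar_def mat_prod_def)
qed

lemma w_bar_Nil: "w_bar r [] = 1\<^sub>m (2^r)"
  and w_bar_single: "1 \<le> j \<Longrightarrow> j \<le> r \<Longrightarrow> w_bar r [j] = s_bar r j"
  using grp_carrier(1)[OF s_bar_mem, of j r] by (auto simp: w_bar_def mat_prod_def)

lemma monomial_row_one: "b \<in> letters r \<Longrightarrow> monomial_row r (1\<^sub>m (2^r)) b 1 b"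
  using vrep_eq[OF intertwines_one, of r] by (auto simp: monomial_row_def)

lemma monomial_row_append:
  assumes "set js \<subseteq> {1..r}" "set ks \<subseteq> {1..r}" "b \<in> letters r"
    "monomial_row r (w_bar r js) b x b'" "monomial_row r (w_bar r ks) b' y b''"
  shows "monomial_row r (w_bar r (js @ ks)) b (x * y) b''"
  unfolding w_bar_append[OF assms(1,2)] using assms by (intro monomial_row_mult w_bar_mem)

lemma monomial_row_fixed:
  assumes "set js \<subseteq> {1..r}" "b \<in> letters r" "\<And>i. i \<in> set js \<Longrightarrow> monomial_row r (s_bar r i) b 1 b"
  shows "monomial_row r (w_bar r js) b 1 b"
  using assms
proof (induction js)
  case Nil
  then show ?case using monomial_row_one[of b r] by (simp add: w_bar_Nil)
next
  case (Cons j js)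
  have "monomial_row r (w_bar r ([j] @ js)) b (1 * 1) b"
    by (rule monomial_row_append[where b' = b]) (use Cons in \<open>auto simp: w_bar_single\<close>)
  then show ?case by simp
qed

text \<open>
  In an increasing run of simple reflections a letter stays fixed until the one reflection that moves
  it, and its image is fixed by the later ones.
\<close>

lemma monomial_row_once:
  assumes k: "1 \<le> k" "k \<le> d" "d \<le> r" and b: "b \<in> letters r" "b' \<in> letters r"
    and mid: "monomial_row r (s_bar r k) b x b'"
    and bef: "\<And>i. 1 \<le> i \<Longrightarrow> i < k \<Longrightarrow> monomial_row r (s_bar r i) b 1 b"
    and aft: "\<And>i. k < i \<Longrightarrow> i \<le> d \<Longrightarrow> monomial_row r (s_bar r i) b' 1 b'"
  shows "monomial_row r (w_bar r [1..<Suc d]) b x b'"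
proof -
  have "[1..<Suc d] = [1..<k] @ [k..<Suc d]" using k upt_add_eq_append[of 1 k "Suc d - k"] by simp
  also have "[k..<Suc d] = [k] @ [Suc k..<Suc d]" using k by (simp add: upt_conv_Cons)
  finally have split: "[1..<Suc d] = [1..<k] @ [k] @ [Suc k..<Suc d]" .
  have rest: "monomial_row r (w_bar r ([k] @ [Suc k..<Suc d])) b (x * 1) b'"
  proof (rule monomial_row_append[where b' = b'])
    show "monomial_row r (w_bar r [k]) b x b'" using mid k by (simp add: w_bar_single)
    show "monomial_row r (w_bar r [Suc k..<Suc d]) b' 1 b'" by (rule monomial_row_fixed) (use k b aft in auto)
  qed (use k b in auto)
  have start: "monomial_row r (w_bar r [1..<k]) b 1 b" by (rule monomial_row_fixed) (use k b bef in auto)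
  have "monomial_row r (w_bar r ([1..<k] @ ([k] @ [Suc k..<Suc d]))) b (1 * (x * 1)) b'"
    by (rule monomial_row_append[OF _ _ b(1) start rest]) (use k in auto)
  then show ?thesis unfolding split by simp
qed

lemma monomial_row_run_Plain:
  assumes "1 \<le> k" "k \<le> d" "d \<le> r" "k < r"
  shows "monomial_row r (w_bar r [1..<Suc d]) (Plain (k + 1)) 1 (Plain k)"
  using assms by (intro monomial_row_once[of k d r] monomial_row_s_bar monomial_row_s_bar_fixed) auto

lemma monomial_row_cycle_Bar:
  assumes "1 \<le> k" "k < r"
  shows "monomial_row r (w_bar r [1..<Suc r]) (Bar (k + 1)) (-1) (Bar k)"
  using assms by (intro monomial_row_once[of k r r] monomial_row_s_bar monomial_row_s_bar_fixed) auto

lemma monomial_row_cycle_Bar_1: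
  assumes r: "1 \<le> r"
  shows "monomial_row r (w_bar r [1..<Suc r]) (Bar 1) 1 (Plain r)"
proof -
  have "monomial_row r (w_bar r [1..<Suc k]) (Bar 1) 1 (Bar (Suc k))" if "k < r" for k
    using that
  proof (induction k)
    case 0
    then show ?case using monomial_row_one[of "Bar 1" r] by (simp add: w_bar_Nil)
  next
    case (Suc k)
    have "monomial_row r (w_bar r ([1..<Suc k] @ [Suc k])) (Bar 1) (1 * 1) (Bar (Suc (Suc k)))"
      by (rule monomial_row_append[where b' = "Bar (Suc k)"])
         (use Suc monomial_row_s_bar(2)[of "Suc k" r] in \<open>auto simp: w_bar_single\<close>)
    then show ?case by simp
  qed
  from this[of "r - 1"] have "monomial_row r (w_bar r [1..<r]) (Bar 1) 1 (Bar r)" using r by simp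
  then have "monomial_row r (w_bar r ([1..<r] @ [r])) (Bar 1) (1 * 1) (Plain r)"
    by (intro monomial_row_append[where b' = "Bar r"])
       (use r monomial_row_s_bar_last[OF r] in \<open>auto simp: w_bar_single\<close>)
  then show ?thesis using r by simp
qed

text \<open>
  The cycle $s_1 \cdots s_r$ moves the letters along $1 \to 2 \to \dots \to r \to \overline 1 \to \overline 2
  \to \dots \to \overline r$.
\<close>

definition orbit_letter :: "nat \<Rightarrow> nat \<Rightarrow> letter" where
  "orbit_letter r k = (if k \<le> r then Plain k else Bar (k - r))"

text \<open>
  Every step of the cycle from a barred letter to the next one changes the sign.
\<close>

definition orbit_sign :: "nat \<Rightarrow> nat \<Rightarrow> complex" where
  "orbit_sign r k = (if k \<le> r then 1 else (-1) ^ (k - r - 1))"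

lemma monomial_row_cycle:
  assumes k: "1 \<le> k" "k < 2 * r"
  shows "monomial_row r (w_bar r [1..<Suc r]) (orbit_letter r (Suc k)) (orbit_sign r (Suc k) * orbit_sign r k) (orbit_letter r k)"
proof -
  consider "k < r" | "k = r" | "r < k" by linarith
  then show ?thesis
  proof cases
    case 1
    then show ?thesis using monomial_row_run_Plain[of k r r] k by (simp add: orbit_letter_def orbit_sign_def)
  next
    case 2
    then show ?thesis using monomial_row_cycle_Bar_1[of r] k by (simp add: orbit_letter_def orbit_sign_def)
  next
    case 3
    then obtain j where j: "k = r + Suc j" by (metis add_Suc_right less_iff_Suc_add)
    have "orbit_sign r (Suc k) * orbit_sign r k = -1"
      by (simp add: orbit_sign_def j flip: power_mult_distrib)
    then show ?thesis using monomial_row_cycle_Bar[of "Suc j" r] k j by (simp add: orbit_letter_def)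
  qed
qed

lemma orbit_letter_mem: "1 \<le> k \<Longrightarrow> k \<le> 2 * r \<Longrightarrow> orbit_letter r k \<in> letters r"
  by (auto simp: orbit_letter_def)

lemma orbit_sign_square [simp]: "orbit_sign r k * (orbit_sign r k * x) = x"
  by (simp add: orbit_sign_def flip: mult.assoc power_mult_distrib)

lemma set_concat_replicate_cycle: "set (concat (replicate n [1..<Suc r])) \<subseteq> {1..r}"
  by (induction n) auto

lemma monomial_row_cycles:
  assumes "1 \<le> k" "k + n \<le> 2 * r"
  shows "monomial_row r (w_bar r (concat (replicate n [1..<Suc r]))) (orbit_letter r (k + n))
    (orbit_sign r (k + n) * orbit_sign r k) (orbit_letter r k)"
  using assms(2)
proof (induction n)
  case 0
  then show ?case using monomial_row_one[OF orbit_letter_mem[of k r]] assms(1) orbit_sign_square[of r k 1]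
    by (simp add: w_bar_Nil)
next
  case (Suc n)
  have "monomial_row r (w_bar r ([1..<Suc r] @ concat (replicate n [1..<Suc r]))) (orbit_letter r (Suc (k + n)))
    ((orbit_sign r (Suc (k + n)) * orbit_sign r (k + n)) * (orbit_sign r (k + n) * orbit_sign r k)) (orbit_letter r k)"
    by (rule monomial_row_append[where b' = "orbit_letter r (k + n)"])
       (use Suc assms(1) set_concat_replicate_cycle[of n r] in \<open>auto intro!: orbit_letter_mem monomial_row_cycle simp del: upt_Suc One_nat_def\<close>)
  then show ?case by (simp add: mult.assoc del: upt_Suc)
qed

lemma set_word_i: "d \<le> r \<Longrightarrow> set (word_i r m d) \<subseteq> {1..r}"
  using set_concat_replicate_cycle[of "m - 1" r] by (auto simp: word_i_def simp del: upt_Suc)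

lemma monomial_row_word:
  assumes "1 \<le> i" "i \<le> d" "d < r" "1 \<le> m" "m \<le> r"
  shows "monomial_row r (w_bar r (word_i r m d)) (orbit_letter r (m + i)) (orbit_sign r (m + i)) (Plain i)"
proof -
  have eq: "m + i = Suc i + (m - 1)" using assms by simp
  have "monomial_row r (w_bar r (concat (replicate (m - 1) [1..<Suc r]) @ [1..<Suc d])) (orbit_letter r (Suc i + (m - 1)))
     ((orbit_sign r (Suc i + (m - 1)) * orbit_sign r (Suc i)) * 1) (Plain i)"
  proof (rule monomial_row_append[where b' = "orbit_letter r (Suc i)"])
    show "monomial_row r (w_bar r [1..<Suc d]) (orbit_letter r (Suc i)) 1 (Plain i)"
      using monomial_row_run_Plain[of i d r] assms by (simp add: orbit_letter_def)
  qed (use assms set_concat_replicate_cycle[of "m - 1" r] monomial_row_cycles[of "Suc i" "m - 1" r] in \<open>auto intro!: orbit_letter_mem simp del: upt_Suc One_nat_def\<close>)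
  then show ?thesis using assms unfolding eq word_i_def by (simp add: orbit_sign_def del: upt_Suc)
qed

section \<open>The extremal minor\<close>

text \<open>
  Reversing $q$ rows costs the sign $(-1)^{0 + 1 + \dots + (q - 1)}$, which is distributed over the
  rows.
\<close>

lemma minor_reverse_rows:
  assumes "length as = length xs + q + length zs"
  shows "minor (\<lambda>f. f) (xs @ map \<phi> (rev [1..<Suc q]) @ zs) as
    = minor (\<lambda>f. f) (xs @ map (\<lambda>j a. (-1) ^ (j - 1) * \<phi> j a) [1..<Suc q] @ zs) as"
  using assms
proof (induction q arbitrary: xs zs)
  case (Suc q)
  let ?\<psi> = "\<lambda>j a. (-1) ^ (j - 1) * \<phi> j a"
  have "minor (\<lambda>f. f) (xs @ map \<phi> (rev [1..<Suc (Suc q)]) @ zs) as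
      = minor (\<lambda>f. f) ((xs @ [\<phi> (Suc q)]) @ map \<phi> (rev [1..<Suc q]) @ zs) as" by simp
  also have "\<dots> = minor (\<lambda>f. f) ((xs @ [\<phi> (Suc q)]) @ map ?\<psi> [1..<Suc q] @ zs) as"
    by (rule Suc.IH) (use Suc.prems in simp)
  also have "\<dots> = minor (\<lambda>f. f) (xs @ \<phi> (Suc q) # map ?\<psi> [1..<Suc q] @ zs) as" by simp
  also have "\<dots> = (-1) ^ q * minor (\<lambda>f. f) (xs @ map ?\<psi> [1..<Suc q] @ \<phi> (Suc q) # zs) as"
    using minor_move_row[of as xs "map ?\<psi> [1..<Suc q]" zs "\<lambda>f. f" "\<phi> (Suc q)"] Suc.prems by simp
  also have "\<dots> = minor (\<lambda>f. f) ((xs @ map ?\<psi> [1..<Suc q]) @ (\<lambda>a. (-1) ^ q * \<phi> (Suc q) a) # zs) as"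
    using minor_scale_row[of as "xs @ map ?\<psi> [1..<Suc q]" zs "(-1) ^ q" "\<phi> (Suc q)"] Suc.prems by simp
  finally show ?case by simp
qed simp

lemma end_tuple_mem:
  assumes "1 \<le> m" "m \<le> r" "d < r"
  shows "end_tuple r d m \<in> sorted_tuples (letters r) d"
  using assms
  by (auto simp: end_tuple_def sorted_tuples_def sorted_wrt_map sorted_wrt_append sorted_wrt_rev simp del: upt_Suc)

text \<open>
  The row of $\overline w$ at the letter $m + i$ of the orbit is, up to the orbit sign, the unit row
  $i$. The end tuple lists these letters with the barred ones in reverse order, and the sign of the
  reversal cancels the orbit signs.
\<close>

lemma minor_end_tuple:
  assumes "1 \<le> m" "m \<le> r" "1 \<le> d" "d < r" and g: "g \<in> grp_G r"
  shows "minor (vrep r (w_bar r (word_i r m d) * g)) (end_tuple r d m) (start_tuple d)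
    = minor (vrep r g) (start_tuple d) (start_tuple d)"
proof -
  let ?s = "start_tuple d" and ?w = "w_bar r (word_i r m d)"
  let ?M = "vrep r (?w * g)"
  let ?row = "\<lambda>i a. orbit_sign r (m + i) * ?M (orbit_letter r (m + i)) a"
  have w: "?w \<in> grp_G r" using assms by (intro w_bar_mem set_word_i) auto
  define q where "q = m + d - r"
  have "minor ?M (end_tuple r d m) ?s = minor (\<lambda>f. f) (map ?M (end_tuple r d m)) ?s"
    using end_tuple_mem[of m r d] assms by (subst minor_map_rows) (auto simp: sorted_tuples_def)
  also have "\<dots> = minor (\<lambda>f. f) (map ?row [1..<Suc d]) ?s"
  proof (cases "m + d > r")
    case True
    have "minor (\<lambda>f. f) (map ?M (end_tuple r d m)) ?s
      = minor (\<lambda>f. f) (map ?M (map Plain [m + 1..<Suc r]) @ map (\<lambda>j. ?M (Bar j)) (rev [1..<Suc q]) @ []) ?s"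
      using True by (simp add: end_tuple_def q_def comp_def rev_map del: upt_Suc)
    also have "\<dots> = minor (\<lambda>f. f) (map ?M (map Plain [m + 1..<Suc r]) @ map (\<lambda>j a. (-1) ^ (j - 1) * ?M (Bar j) a) [1..<Suc q] @ []) ?s"
      using True assms by (intro minor_reverse_rows) (auto simp: q_def)
    also have "map ?M (map Plain [m + 1..<Suc r]) @ map (\<lambda>j a. (-1) ^ (j - 1) * ?M (Bar j) a) [1..<Suc q] @ [] = map ?row [1..<Suc d]"
    proof (rule nth_equalityI)
      show "length (map ?M (map Plain [m + 1..<Suc r]) @ map (\<lambda>j a. (-1) ^ (j - 1) * ?M (Bar j) a) [1..<Suc q] @ []) = length (map ?row [1..<Suc d])"
        using True assms by (auto simp: q_def simp del: upt_Suc)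
      fix z assume "z < length (map ?M (map Plain [m + 1..<Suc r]) @ map (\<lambda>j a. (-1) ^ (j - 1) * ?M (Bar j) a) [1..<Suc q] @ [])"
      then have z: "z < d" using True assms by (auto simp: q_def simp del: upt_Suc)
      show "(map ?M (map Plain [m + 1..<Suc r]) @ map (\<lambda>j a. (-1) ^ (j - 1) * ?M (Bar j) a) [1..<Suc q] @ []) ! z = map ?row [1..<Suc d] ! z"
      proof (cases "z < r - m")
        case True
        then have "Suc (m + z) \<le> r" by simp
        then show ?thesis using z True by (simp add: nth_append orbit_letter_def orbit_sign_def del: upt_Suc)
      next
        case False
        then have "m + Suc z - r = Suc (z - (r - m))" "z - (r - m) < q" "\<not> Suc (m + z) \<le> r" using assms z by (auto simp: q_def)
        then show ?thesis using z False by (simp add: nth_append orbit_letter_def orbit_sign_def del: upt_Suc)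
      qed
    qed
    finally show ?thesis .
  next
    case False
    then have "map ?M (end_tuple r d m) = map ?row [1..<Suc d]"
      by (intro nth_equalityI) (auto simp: end_tuple_def orbit_letter_def orbit_sign_def simp del: upt_Suc)
    then show ?thesis by simp
  qed
  also have "\<dots> = minor ?row [1..<Suc d] ?s" by (rule minor_map_rows) simp
  also have "\<dots> = minor (\<lambda>i. vrep r g (Plain i)) [1..<Suc d] ?s"
  proof (rule minor_cong)
    fix i a assume i: "i \<in> set [1..<Suc d]" and "a \<in> set ?s"
    then have a: "a \<in> letters r" using start_tuple_mem[of d r] assms by (auto simp: sorted_tuples_def)
    have row: "monomial_row r ?w (orbit_letter r (m + i)) (orbit_sign r (m + i)) (Plain i)"
      using i assms by (intro monomial_row_word) auto
    have "?M (orbit_letter r (m + i)) a = letter_comp r (vrep r ?w) (vrep r g) (orbit_letter r (m + i)) a"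
      using i assms by (intro vrep_mult w g a orbit_letter_mem) auto
    also have "\<dots> = (\<Sum>c\<in>{Plain i}. vrep r ?w (orbit_letter r (m + i)) c * vrep r g c a)"
      by (rule letter_comp_support) (use row in \<open>auto simp: monomial_row_def\<close>)
    also have "\<dots> = orbit_sign r (m + i) * vrep r g (Plain i) a" using row by (simp add: monomial_row_def)
    finally show "?row i a = vrep r g (Plain i) a" by simp
  qed simp
  also have "\<dots> = minor (vrep r g) ?s ?s" unfolding start_tuple_def by (rule minor_map_rows[symmetric]) simp
  finally show ?thesis .
qed

section \<open>The matrix of a cycle\<close>

definition x_minus_act :: "nat \<Rightarrow> nat \<Rightarrow> complex \<Rightarrow> letter \<Rightarrow> letter \<Rightarrow> complex" where
  "x_minus_act r i t b a = lower_act r i t b a * inverse t powi letter_weight r i a"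

lemma x_minus_mem:
  assumes "1 \<le> i" "i \<le> r" "t \<noteq> 0"
  shows "x_minus r i t \<in> grp_G r"
  unfolding x_minus_def using assms by (intro grp_mult_closed y_neg_mem coroot_mem_G) auto

lemma intertwines_x_minus:
  assumes i: "1 \<le> i" "i \<le> r" and t: "t \<noteq> 0"
  shows "intertwines r (x_minus r i t) (x_minus_act r i t)"
proof -
  have t': "inverse t \<noteq> 0" using t by simp
  show ?thesis unfolding x_minus_def
  proof (rule intertwines_cong[OF intertwines_mult[OF intertwines_y_neg[OF i] intertwines_coroot[OF i t']]])
    fix b a assume "b \<in> letters r" "a \<in> letters r"
    then have "letter_comp r (lower_act r i t) (torus_act r i (inverse t)) b a
      = (\<Sum>c\<in>letters r. if c = a then x_minus_act r i t b a else 0)"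
      unfolding letter_comp_def by (intro sum.cong refl) (auto simp: torus_act_def x_minus_act_def)
    then show "letter_comp r (lower_act r i t) (torus_act r i (inverse t)) b a = x_minus_act r i t b a"
      using \<open>a \<in> letters r\<close> by simp
  qed
qed

text \<open>
  The letter $0$ is moved only by $x_{-r}$ and is therefore given the mode $r$.
\<close>

fun mode :: "nat \<Rightarrow> letter \<Rightarrow> nat" where
  "mode r (Plain i) = i" | "mode r Nul = r" | "mode r (Bar i) = i"

text \<open>
  The matrix of the end $x_{-k}(Y_k) \cdots x_{-r}(Y_r)$ of a cycle: letters of smaller mode are fixed,
  and the others see the labels of the cycle with $Y_j = 1$ for $j < k$.
\<close>

definition tail_entry :: "nat \<Rightarrow> (nat \<Rightarrow> nat \<Rightarrow> complex) \<Rightarrow> nat \<Rightarrow> nat \<Rightarrow> letter \<Rightarrow> letter \<Rightarrow> complex" where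
  "tail_entry r Y t k b a = (if mode r a < k \<or> mode r b < k then (if b = a then 1 else 0)
     else cycle_entry r (\<lambda>s j. if j < k then 1 else Y s j) t b a)"

lemma x_minus_row_other:
  assumes i: "1 \<le> i" "i \<le> r" and b: "b \<in> letters r" "b \<noteq> Plain i" "b \<noteq> Bar i"
    "i < r \<Longrightarrow> b \<noteq> Plain (i + 1)" "i < r \<Longrightarrow> b \<noteq> Bar (i + 1)" "i = r \<Longrightarrow> b \<noteq> Nul"
  shows "letter_comp r (x_minus_act r i t) M b a = M b a"
proof -
  have "letter_comp r (x_minus_act r i t) M b a = (\<Sum>c\<in>{b}. x_minus_act r i t b c * M c a)"
    by (rule letter_comp_support) (use b i in \<open>auto simp: x_minus_act_def lower_act_def\<close>)
  also have "x_minus_act r i t b b = 1"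
    using b i by (cases b) (auto simp: x_minus_act_def lower_act_def mode_weight_def)
  ultimately show ?thesis by simp
qed

lemma x_minus_rows:
  assumes i: "1 \<le> i" "i < r" and t: "t \<noteq> 0"
  shows "letter_comp r (x_minus_act r i t) M (Plain i) a = M (Plain i) a / t"
    and "letter_comp r (x_minus_act r i t) M (Plain (i + 1)) a = M (Plain i) a + t * M (Plain (i + 1)) a"
    and "letter_comp r (x_minus_act r i t) M (Bar (i + 1)) a = M (Bar (i + 1)) a / t"
    and "letter_comp r (x_minus_act r i t) M (Bar i) a = M (Bar (i + 1)) a + t * M (Bar i) a"
  using i t
  by (subst letter_comp_support[of "{Plain i}"] letter_comp_support[of "{Plain i, Plain (i + 1)}"]
      letter_comp_support[of "{Bar (i + 1)}"] letter_comp_support[of "{Bar (i + 1), Bar i}"];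
      auto simp: x_minus_act_def lower_act_def mode_weight_def power_int_minus divide_inverse; fail)+

lemma x_minus_rows_last:
  assumes r: "1 \<le> r" and t: "t \<noteq> 0"
  shows "letter_comp r (x_minus_act r r t) M (Plain r) a = M (Plain r) a / t\<^sup>2"
    and "letter_comp r (x_minus_act r r t) M Nul a = M (Plain r) a / t + M Nul a"
    and "letter_comp r (x_minus_act r r t) M (Bar r) a = M (Plain r) a + 2 * t * M Nul a + t\<^sup>2 * M (Bar r) a"
proof -
  have ent: "x_minus_act r r t (Plain r) (Plain r) = 1 / t\<^sup>2" "x_minus_act r r t Nul (Plain r) = 1 / t"
    "x_minus_act r r t Nul Nul = 1" "x_minus_act r r t (Bar r) (Plain r) = 1"
    "x_minus_act r r t (Bar r) Nul = 2 * t" "x_minus_act r r t (Bar r) (Bar r) = t\<^sup>2"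
    using t by (simp_all add: x_minus_act_def lower_act_def mode_weight_def power_int_minus field_simps power2_eq_square)
  have zero: "x_minus_act r r t b c = 0" if "c \<noteq> b" "c \<noteq> Plain r" "c \<noteq> Nul" for b c
    using that by (simp add: x_minus_act_def lower_act_def)
  have zero': "x_minus_act r r t (Plain r) Nul = 0" "x_minus_act r r t Nul (Bar r) = 0"
    by (simp_all add: x_minus_act_def lower_act_def)
  show "letter_comp r (x_minus_act r r t) M (Plain r) a = M (Plain r) a / t\<^sup>2"
    by (subst letter_comp_support[of "{Plain r, Nul}"]) (use r zero zero' ent in auto)
  show "letter_comp r (x_minus_act r r t) M Nul a = M (Plain r) a / t + M Nul a"
    by (subst letter_comp_support[of "{Plain r, Nul}"]) (use r zero zero' ent in auto)
  show "letter_comp r (x_minus_act r r t) M (Bar r) a = M (Plain r) a + 2 * t * M Nul a + t\<^sup>2 * M (Bar r) a"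
    by (subst letter_comp_support[of "{Plain r, Nul, Bar r}"]) (use r zero zero' ent in auto)
qed

text \<open>
  Multiplication by $x_{-i}$ on the left changes only the rows $i, i+1, \overline{i+1}, \overline i$, or
  $r, 0, \overline r$ if $i = r$.
\<close>

lemma tail_entry_step:
  assumes i: "1 \<le> i" "i \<le> r" and ab: "a \<in> letters r" "b \<in> letters r" and Yi: "Y t i \<noteq> 0"
  shows "letter_comp r (x_minus_act r i (Y t i)) (tail_entry r Y t (Suc i)) b a = tail_entry r Y t i b a"
proof -
  consider (other) "b \<noteq> Plain i" "b \<noteq> Bar i" "i < r \<longrightarrow> b \<noteq> Plain (i + 1)" "i < r \<longrightarrow> b \<noteq> Bar (i + 1)" "i = r \<longrightarrow> b \<noteq> Nul"
    | (mid) "i < r" "b \<in> {Plain i, Plain (i + 1), Bar (i + 1), Bar i}"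
    | (last) "i = r" "b \<in> {Plain r, Nul, Bar r}" using i by fastforce
  then show ?thesis
  proof cases
    case other
    then have "letter_comp r (x_minus_act r i (Y t i)) (tail_entry r Y t (Suc i)) b a = tail_entry r Y t (Suc i) b a"
      using i ab by (intro x_minus_row_other) auto
    also have "\<dots> = tail_entry r Y t i b a"
      using other i ab Yi by (cases a; cases b) (auto simp: tail_entry_def cycle_entry_def Yc_def)
    finally show ?thesis .
  next
    case mid
    then consider "b = Plain i" | "b = Plain (i + 1)" | "b = Bar (i + 1)" | "b = Bar i" by blast
    then show ?thesis
    proof cases
      case 1
      show ?thesis unfolding 1 x_minus_rows(1)[OF i(1) mid(1) Yi] using ab(1) i mid(1)
        by (cases a) (auto simp: tail_entry_def cycle_entry_def Yc_def)
    next
      case 2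
      show ?thesis unfolding 2 x_minus_rows(2)[OF i(1) mid(1) Yi] using ab(1) i mid(1)
        by (cases a) (auto simp: tail_entry_def cycle_entry_def Yc_def)
    next
      case 3
      show ?thesis unfolding 3 x_minus_rows(3)[OF i(1) mid(1) Yi] using ab(1) i mid(1)
        by (cases a) (auto simp: tail_entry_def cycle_entry_def Yc_def)
    next
      case 4
      show ?thesis unfolding 4 x_minus_rows(4)[OF i(1) mid(1) Yi] using ab(1) i mid(1)
        by (cases a) (auto simp: tail_entry_def cycle_entry_def Yc_def less_Suc_eq)
    qed
  next
    case last
    have r: "1 \<le> r" and Yr: "Y t r \<noteq> 0" using i Yi last by auto
    from last consider "b = Plain r" | "b = Nul" | "b = Bar r" by blast
    then show ?thesis
    proof cases
      case 1
      show ?thesis unfolding 1 last(1) x_minus_rows_last(1)[OF r Yr] using ab(1) r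
        by (cases a) (auto simp: tail_entry_def cycle_entry_def Yc_def)
    next
      case 2
      show ?thesis unfolding 2 last(1) x_minus_rows_last(2)[OF r Yr] using ab(1) r
        by (cases a) (auto simp: tail_entry_def cycle_entry_def Yc_def)
    next
      case 3
      show ?thesis unfolding 3 last(1) x_minus_rows_last(3)[OF r Yr] using ab(1) r
        by (cases a) (auto simp: tail_entry_def cycle_entry_def Yc_def)
    qed
  qed
qed

lemma xL_Cons: "xL r (i # ws) (t # ts) = x_minus r i t * xL r ws ts"
  by (simp add: xL_def mat_prod_def)

lemma xL_mem:
  "length ws = length ts \<Longrightarrow> set ws \<subseteq> {1..r} \<Longrightarrow> 0 \<notin> set ts \<Longrightarrow> xL r ws ts \<in> grp_G r"
proof (induction ws ts rule: list_induct2)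
  case Nil
  then show ?case using grp_one(1) by (simp add: xL_def mat_prod_def)
next
  case (Cons i ws t ts)
  then show ?case by (auto simp: xL_Cons intro!: grp_mult_closed x_minus_mem)
qed

lemma xL_append:
  assumes "length ws = length ts" "set ws \<subseteq> {1..r}" "0 \<notin> set ts" and g: "xL r ws' ts' \<in> grp_G r"
  shows "xL r (ws @ ws') (ts @ ts') = xL r ws ts * xL r ws' ts'"
  using assms(1-3)
proof (induction ws ts rule: list_induct2)
  case Nil
  then show ?case using grp_carrier(1)[OF g] by (simp add: xL_def mat_prod_def)
next
  case (Cons i ws t ts)
  have "x_minus r i t * xL r ws ts * xL r ws' ts' = x_minus r i t * (xL r ws ts * xL r ws' ts')"
    by (rule assoc_mult_mat[of _ "2^r" "2^r" _ "2^r" _ "2^r"])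
       (use Cons.prems Cons.hyps g in \<open>auto intro!: grp_carrier(1) x_minus_mem xL_mem\<close>)
  then show ?case using Cons by (simp add: xL_Cons)
qed

lemma intertwines_tail:
  assumes Y: "\<And>j. 1 \<le> j \<Longrightarrow> j \<le> r \<Longrightarrow> Y t j \<noteq> 0" and k: "1 \<le> k" "k \<le> Suc r"
  shows "intertwines r (xL r [k..<Suc r] (map (Y t) [k..<Suc r])) (tail_entry r Y t k)"
  using k(2,1)
proof (induction k rule: inc_induct)
  case base
  have "mode r a < Suc r" if "a \<in> letters r" for a using that by (cases a) auto
  then have "intertwines r (1\<^sub>m (2^r)) (tail_entry r Y t (Suc r))"
    by (intro intertwines_cong[OF intertwines_one]) (simp add: tail_entry_def)
  then show ?case by (simp add: xL_def mat_prod_def)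
next
  case (step k)
  then have k: "1 \<le> k" "k \<le> r" by auto
  have "xL r [k..<Suc r] (map (Y t) [k..<Suc r]) = x_minus r k (Y t k) * xL r [Suc k..<Suc r] (map (Y t) [Suc k..<Suc r])"
    using k by (subst (1 2) upt_conv_Cons) (simp_all add: xL_Cons del: upt_Suc)
  moreover have "intertwines r (x_minus r k (Y t k) * xL r [Suc k..<Suc r] (map (Y t) [Suc k..<Suc r])) (tail_entry r Y t k)"
  proof (rule intertwines_cong[OF intertwines_mult[OF intertwines_x_minus[OF k Y[OF k]] step.IH]])
    show "letter_comp r (x_minus_act r k (Y t k)) (tail_entry r Y t (Suc k)) b a = tail_entry r Y t k b a"
      if "b \<in> letters r" "a \<in> letters r" for b a
      using tail_entry_step[of k r a b Y t] k Y that by blast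
  qed (use k in auto)
  ultimately show ?case by simp
qed

lemma tail_entry_1:
  assumes "a \<in> letters r" "b \<in> letters r"
  shows "tail_entry r Y t 1 b a = cycle_entry r Y t b a"
proof -
  have "\<not> mode r a < 1" "\<not> mode r b < 1" if "1 \<le> r" using assms that by (cases a; cases b; auto)+
  moreover have "Yc (\<lambda>s j. if j < 1 then 1 else Y s j) t j = Yc Y t j" for j by (simp add: Yc_def)
  moreover have "step_label r (\<lambda>s j. if j < 1 then 1 else Y s j) t a b = step_label r Y t a b"
    by (cases a; cases b) (simp_all add: Yc_def)
  moreover have "a = Nul" "b = Nul" if "r = 0" using assms that by (cases a; cases b; auto)+
  ultimately show ?thesis by (cases "r = 0") (auto simp: tail_entry_def cycle_entry_def)
qed

definition cyc :: "nat \<Rightarrow> (nat \<Rightarrow> nat \<Rightarrow> complex) \<Rightarrow> nat \<Rightarrow> complex mat" where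
  "cyc r Y t = xL r [1..<Suc r] (map (Y t) [1..<Suc r])"

lemma cyc_mem:
  assumes "\<And>j. 1 \<le> j \<Longrightarrow> j \<le> r \<Longrightarrow> Y t j \<noteq> 0"
  shows "cyc r Y t \<in> grp_G r"
  unfolding cyc_def using assms by (intro xL_mem) (auto simp del: upt_Suc)

lemma vrep_cyc:
  assumes Y: "\<And>j. 1 \<le> j \<Longrightarrow> j \<le> r \<Longrightarrow> Y t j \<noteq> 0" and ab: "a \<in> letters r" "b \<in> letters r"
  shows "vrep r (cyc r Y t) b a = cycle_entry r Y t b a"
  using vrep_eq[OF intertwines_tail[of r Y t 1, OF Y] grp_G_det[OF cyc_mem[of r Y t, OF Y, unfolded cyc_def]] ab]
    tail_entry_1[OF ab, of Y t] by (simp add: cyc_def del: upt_Suc)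

text \<open>
  Complete the cycle with $Y_j = 1$ for $j > d$. The additional factors $x_{-j}$ fix the vectors
  $v_1, \dots, v_d$, and the labels of the steps from $1, \dots, d$ contain only $Y_1, \dots, Y_d$.
\<close>

lemma vrep_partial_cycle:
  assumes Y: "\<And>j. 1 \<le> j \<Longrightarrow> j \<le> d \<Longrightarrow> Y t j \<noteq> 0" and d: "d < r" and a: "a \<in> Plain ` {1..d}" and b: "b \<in> letters r"
  shows "vrep r (xL r [1..<Suc d] (map (Y t) [1..<Suc d])) b a = cycle_entry r Y t b a"
proof -
  define Y' where "Y' s j = (if j \<le> d then Y s j else 1)" for s j
  have Y': "Y' t j \<noteq> 0" if "1 \<le> j" "j \<le> r" for j using Y that by (simp add: Y'_def)
  have aL: "a \<in> letters r" using a d by auto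
  let ?g = "xL r [1..<Suc d] (map (Y' t) [1..<Suc d])" and ?h = "xL r [Suc d..<Suc r] (map (Y' t) [Suc d..<Suc r])"
  have g: "?g \<in> grp_G r" using d Y' by (intro xL_mem) (auto simp del: upt_Suc)
  have h: "?h \<in> grp_G r" using d Y' by (intro xL_mem) (auto simp del: upt_Suc)
  have "[1..<Suc r] = [1..<Suc d] @ [Suc d..<Suc r]" using d upt_add_eq_append[of 1 "Suc d" "r - d"] by (simp del: upt_Suc)
  then have "cyc r Y' t = ?g * ?h"
    unfolding cyc_def using h d Y' by (simp only: map_append) (intro xL_append, auto simp del: upt_Suc)
  then have "cycle_entry r Y' t b a = letter_comp r (vrep r ?g) (vrep r ?h) b a"
    using vrep_cyc[of r Y' t a b, OF Y' aL b] vrep_mult[OF g h aL b] by simp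
  also have "\<dots> = (\<Sum>c\<in>letters r. if c = a then vrep r ?g b a else 0)"
    unfolding letter_comp_def
  proof (intro sum.cong refl)
    fix c assume c: "c \<in> letters r"
    have "vrep r ?h c a = tail_entry r Y' t (Suc d) c a"
      by (rule vrep_eq[OF intertwines_tail[of r Y' t "Suc d", OF Y'] grp_G_det[OF h] aL c]) (use d in auto)
    also have "\<dots> = (if c = a then 1 else 0)" using a by (auto simp: tail_entry_def)
    finally show "vrep r ?g b c * vrep r ?h c a = (if c = a then vrep r ?g b a else 0)" by simp
  qed
  also have "\<dots> = vrep r ?g b a" using aL by simp
  also have "?g = xL r [1..<Suc d] (map (Y t) [1..<Suc d])"
    by (intro arg_cong2[where f = "xL r"] map_cong refl) (auto simp: Y'_def simp del: upt_Suc)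
  finally have "vrep r (xL r [1..<Suc d] (map (Y t) [1..<Suc d])) b a = cycle_entry r Y' t b a" by simp
  also have "\<dots> = cycle_entry r Y t b a" using a d by (cases b) (auto simp: cycle_entry_def Yc_def Y'_def)
  finally show ?thesis .
qed

section \<open>The path sum\<close>

lemma minor_cyc:
  assumes Y: "\<And>j. 1 \<le> j \<Longrightarrow> j \<le> r \<Longrightarrow> Y t j \<noteq> 0" and r: "0 < r"
    and as: "as \<in> sorted_tuples (letters r) d" and bs: "bs \<in> sorted_tuples (letters r) d"
  shows "minor (vrep r (cyc r Y t)) bs as = (if admissible_edge r as bs then edge_label r Y t as bs else 0)"
proof -
  have "minor (vrep r (cyc r Y t)) bs as = minor (cycle_entry r Y t) bs as"
    using as bs by (intro minor_cong vrep_cyc Y) (auto simp: sorted_tuples_def)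
  also have "\<dots> = (if admissible_edge r as bs then edge_label r Y t as bs else 0)"
    using as bs by (intro minor_cycle_entry r Y) (auto simp: sorted_tuples_def)
  finally show ?thesis .
qed

lemma edge_label_cong:
  assumes "\<And>a b. a \<in> set as \<Longrightarrow> step_label r Y t a b = step_label r Y' t a b"
  shows "edge_label r Y t as bs = edge_label r Y' t as bs"
  unfolding edge_label_def using assms by (intro arg_cong2[where f = "(*)"] prod.cong refl) auto

lemma minor_partial_cycle:
  assumes Y: "\<And>j. 1 \<le> j \<Longrightarrow> j \<le> d \<Longrightarrow> Y t j \<noteq> 0" and d: "d < r"
    and bs: "bs \<in> sorted_tuples (letters r) d"
  shows "minor (vrep r (xL r [1..<Suc d] (map (Y t) [1..<Suc d]))) bs (start_tuple d)
    = (if admissible_edge r (start_tuple d) bs then edge_label r Y t (start_tuple d) bs else 0)"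
proof -
  define Y' where "Y' s j = (if j \<le> d then Y s j else 1)" for s j
  have Y': "Y' t j \<noteq> 0" if "1 \<le> j" "j \<le> r" for j using Y that by (simp add: Y'_def)
  have lab: "step_label r Y t a b = step_label r Y' t a b" if "a \<in> set (start_tuple d)" for a b
    using that d by (cases b) (auto simp: set_start_tuple Yc_def Y'_def)
  have s: "start_tuple d \<in> sorted_tuples (letters r) d" using start_tuple_mem[of d r] d by simp
  have "minor (vrep r (xL r [1..<Suc d] (map (Y t) [1..<Suc d]))) bs (start_tuple d) = minor (cycle_entry r Y' t) bs (start_tuple d)"
  proof (rule minor_cong)
    show "length bs = length (start_tuple d)" using bs by (simp add: sorted_tuples_def)
    fix b a assume b: "b \<in> set bs" and a: "a \<in> set (start_tuple d)"
    have "vrep r (xL r [1..<Suc d] (map (Y t) [1..<Suc d])) b a = cycle_entry r Y t b a"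
      using a b bs by (intro vrep_partial_cycle Y d) (auto simp: set_start_tuple sorted_tuples_def)
    then show "vrep r (xL r [1..<Suc d] (map (Y t) [1..<Suc d])) b a = cycle_entry r Y' t b a"
      by (simp add: cycle_entry_def lab[OF a])
  qed
  also have "\<dots> = (if admissible_edge r (start_tuple d) bs then edge_label r Y' t (start_tuple d) bs else 0)"
    using s bs d by (intro minor_cycle_entry Y') (auto simp: sorted_tuples_def)
  also have "edge_label r Y' t (start_tuple d) bs = edge_label r Y t (start_tuple d) bs"
    by (rule edge_label_cong) (simp add: lab)
  finally show ?thesis .
qed

text \<open>
  The product of the last $k$ full cycles and the final incomplete one.
\<close>

primrec suffix_prod :: "nat \<Rightarrow> nat \<Rightarrow> nat \<Rightarrow> (nat \<Rightarrow> nat \<Rightarrow> complex) \<Rightarrow> nat \<Rightarrow> complex mat" where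
  "suffix_prod r d m Y 0 = xL r [1..<Suc d] (map (Y m) [1..<Suc d])"
| "suffix_prod r d m Y (Suc k) = cyc r Y (m - Suc k) * suffix_prod r d m Y k"

lemma suffix_prod_mem:
  assumes Y: "\<And>s j. 1 \<le> s \<Longrightarrow> s < m \<Longrightarrow> 1 \<le> j \<Longrightarrow> j \<le> r \<Longrightarrow> Y s j \<noteq> 0"
    and Ym: "\<And>j. 1 \<le> j \<Longrightarrow> j \<le> d \<Longrightarrow> Y m j \<noteq> 0" and d: "d < r" and k: "k < m"
  shows "suffix_prod r d m Y k \<in> grp_G r"
  using k
proof (induction k)
  case 0
  then show ?case using Ym d by (auto intro!: xL_mem simp del: upt_Suc)
next
  case (Suc k)
  then have "Y (m - Suc k) j \<noteq> 0" if "1 \<le> j" "j \<le> r" for j using Y[of "m - Suc k" j] that by simp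
  then have "cyc r Y (m - Suc k) \<in> grp_G r" by (rule cyc_mem)
  then show ?case using Suc by (simp add: grp_mult_closed(1))
qed

lemma minor_suffix_prod:
  assumes Y: "\<And>s j. 1 \<le> s \<Longrightarrow> s < m \<Longrightarrow> 1 \<le> j \<Longrightarrow> j \<le> r \<Longrightarrow> Y s j \<noteq> 0"
    and Ym: "\<And>j. 1 \<le> j \<Longrightarrow> j \<le> d \<Longrightarrow> Y m j \<noteq> 0" and d: "d < r" and k: "k < m"
    and bs: "bs \<in> sorted_tuples (letters r) d"
  shows "minor (vrep r (suffix_prod r d m Y k)) bs (start_tuple d)
    = transfer (sorted_tuples (letters r) d)
       (\<lambda>s a b. if admissible_edge r a b then edge_label r Y (m - s) a b else 0) (start_tuple d) (Suc k) bs"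
  using k bs
proof (induction k arbitrary: bs)
  case 0
  let ?T = "sorted_tuples (letters r) d"
  have s: "start_tuple d \<in> ?T" using start_tuple_mem[of d r] d by simp
  have "transfer ?T (\<lambda>s a b. if admissible_edge r a b then edge_label r Y (m - s) a b else 0) (start_tuple d) (Suc 0) bs
    = (\<Sum>c\<in>?T. if c = start_tuple d then (if admissible_edge r (start_tuple d) bs then edge_label r Y m (start_tuple d) bs else 0) else 0)"
    unfolding transfer.simps by (rule sum.cong) auto
  then show ?case using minor_partial_cycle[of d Y m r bs, OF Ym d] 0 s by (simp add: finite_sorted_tuples)
next
  case (Suc k)
  let ?T = "sorted_tuples (letters r) d" and ?s = "start_tuple d"
  let ?g = "cyc r Y (m - Suc k)" and ?h = "suffix_prod r d m Y k"
  have s: "?s \<in> ?T" using start_tuple_mem[of d r] d by simp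
  have Yk: "Y (m - Suc k) j \<noteq> 0" if "1 \<le> j" "j \<le> r" for j using Y[of "m - Suc k" j] Suc.prems that by simp
  have g: "?g \<in> grp_G r" by (intro cyc_mem Yk)
  have h: "?h \<in> grp_G r" using Suc.prems by (intro suffix_prod_mem Y Ym d) auto
  have "minor (vrep r (?g * ?h)) bs ?s = minor (letter_comp r (vrep r ?g) (vrep r ?h)) bs ?s"
    using s Suc.prems by (intro minor_cong vrep_mult g h) (auto simp: sorted_tuples_def)
  also have "\<dots> = (\<Sum>cs\<in>?T. minor (vrep r ?g) bs cs * minor (vrep r ?h) cs ?s)"
    unfolding letter_comp_def using Suc.prems by (intro Cauchy_Binet) (auto simp: sorted_tuples_def)
  also have "\<dots> = (\<Sum>cs\<in>?T. (if admissible_edge r cs bs then edge_label r Y (m - Suc k) cs bs else 0) *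
      transfer ?T (\<lambda>s a b. if admissible_edge r a b then edge_label r Y (m - s) a b else 0) ?s (Suc k) cs)"
    using Suc d by (intro sum.cong refl arg_cong2[where f = "(*)"] minor_cyc Yk) auto
  finally show ?case by (simp only: suffix_prod.simps transfer.simps)
qed

lemma xL_word_eq_suffix_prod:
  assumes Y: "\<And>s j. 1 \<le> s \<Longrightarrow> s < m \<Longrightarrow> 1 \<le> j \<Longrightarrow> j \<le> r \<Longrightarrow> Y s j \<noteq> 0"
    and Ym: "\<And>j. 1 \<le> j \<Longrightarrow> j \<le> d \<Longrightarrow> Y m j \<noteq> 0" and d: "d < r" and m: "1 \<le> m"
  shows "xL r (word_i r m d) (coord_list r m d Y) = suffix_prod r d m Y (m - 1)"
proof -
  have "xL r (concat (replicate k [1..<Suc r]) @ [1..<Suc d]) (concat (map (\<lambda>s. map (Y s) [1..<Suc r]) [m - k..<m]) @ map (Y m) [1..<Suc d])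
    = suffix_prod r d m Y k" if "k < m" for k
    using that
  proof (induction k)
    case 0
    then show ?case by (simp del: upt_Suc)
  next
    case (Suc k)
    let ?ws = "concat (replicate k [1..<Suc r]) @ [1..<Suc d]"
    let ?ts = "concat (map (\<lambda>s. map (Y s) [1..<Suc r]) [m - k..<m]) @ map (Y m) [1..<Suc d]"
    have IH: "xL r ?ws ?ts = suffix_prod r d m Y k" using Suc by simp
    have up: "[m - Suc k..<m] = (m - Suc k) # [m - k..<m]" using Suc.prems
      by (subst upt_conv_Cons) (auto simp: Suc_diff_Suc)
    have Yk: "Y (m - Suc k) j \<noteq> 0" if "1 \<le> j" "j \<le> r" for j using Y[of "m - Suc k" j] Suc.prems that by simp
    have "xL r ([1..<Suc r] @ ?ws) (map (Y (m - Suc k)) [1..<Suc r] @ ?ts) = cyc r Y (m - Suc k) * xL r ?ws ?ts"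
      unfolding cyc_def
    proof (rule xL_append)
      show "xL r ?ws ?ts \<in> grp_G r" unfolding IH using Suc.prems by (intro suffix_prod_mem Y Ym d) auto
    qed (use Yk in \<open>auto simp del: upt_Suc\<close>)
    then show ?case unfolding IH up by (simp del: upt_Suc)
  qed
  from this[of "m - 1"] m show ?thesis by (simp add: word_i_def coord_list_def del: upt_Suc)
qed

lemma take_word_i:
  assumes "1 \<le> m'" "m' \<le> m" "1 \<le> d" "d < r"
  shows "take ((m' - 1) * r + d) (word_i r m d) = word_i r m' d"
    and "word_i r m d ! ((m' - 1) * r + d - 1) = d"
proof -
  have len: "length (concat (replicate n [1..<Suc r])) = n * r" for n by (induction n) auto
  obtain ws where ws: "word_i r m d = concat (replicate (m' - 1) [1..<Suc r]) @ [1..<Suc d] @ ws"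
  proof (cases "m' = m")
    case True
    then show ?thesis using that[of "[]"] by (simp add: word_i_def)
  next
    case False
    then obtain n where n: "m - 1 = (m' - 1) + Suc n" using assms
      by (metis add_Suc_right diff_add_inverse2 le_neq_implies_less less_imp_Suc_add ordered_cancel_comm_monoid_diff_class.diff_add_assoc2)
    have up: "[1..<Suc r] = [1..<Suc d] @ [Suc d..<Suc r]" using assms upt_add_eq_append[of 1 "Suc d" "r - d"] by (simp del: upt_Suc)
    have "word_i r m d = concat (replicate (m' - 1) [1..<Suc r]) @ [1..<Suc r] @ concat (replicate n [1..<Suc r]) @ [1..<Suc d]"
      unfolding word_i_def n replicate_add by (simp del: upt_Suc)
    also have "\<dots> = concat (replicate (m' - 1) [1..<Suc r]) @ [1..<Suc d] @ ([Suc d..<Suc r] @ concat (replicate n [1..<Suc r]) @ [1..<Suc d])"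
      by (subst (2) up) (simp del: upt_Suc)
    finally show ?thesis by (rule that)
  qed
  show "take ((m' - 1) * r + d) (word_i r m d) = word_i r m' d"
    unfolding ws using len[of "m' - 1"] by (simp add: word_i_def del: upt_Suc)
  have "(m' - 1) * r + d - 1 = length (concat (replicate (m' - 1) [1..<Suc r])) + (d - 1)"
    unfolding len using assms by simp
  then show "word_i r m d ! ((m' - 1) * r + d - 1) = d"
    unfolding ws using assms by (simp only: nth_append_length_plus) (simp add: nth_append del: upt_Suc)
qed

theorem proposition6p7:
  fixes r d m m' :: nat and Y :: "nat \<Rightarrow> nat \<Rightarrow> complex"
  assumes "1 \<le> m'" and "m' \<le> m" and "m \<le> r" and "1 \<le> d" and "d < r"
    and "\<And>s j. 1 \<le> s \<Longrightarrow> s < m \<Longrightarrow> 1 \<le> j \<Longrightarrow> j \<le> r \<Longrightarrow> Y s j \<noteq> 0"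
    and "\<And>j. 1 \<le> j \<Longrightarrow> j \<le> d \<Longrightarrow> Y m j \<noteq> 0"
  shows "DeltaL r ((m' - 1) * r + d) (word_i r m d) (coord_list r m d Y) =
         (\<Sum>p\<in>paths r d m m'. path_label r m Y p)"
proof -
  let ?g = "suffix_prod r d m Y (m - 1)" and ?e = "end_tuple r d m'" and ?s = "start_tuple d"
  have m: "1 \<le> m" "m - 1 < m" "Suc (m - 1) = m" and m': "m' \<le> r" using assms(1-3) by auto
  have s: "?s \<in> sorted_tuples (letters r) d" using start_tuple_mem[of d r] assms(5) by simp
  have e: "?e \<in> sorted_tuples (letters r) d" by (rule end_tuple_mem[OF assms(1) m' assms(5)])
  have w: "w_bar r (word_i r m' d) \<in> grp_G r" using assms(5) by (intro w_bar_mem set_word_i) simp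
  have g: "?g \<in> grp_G r" by (rule suffix_prod_mem[where Y = Y and m = m and r = r and d = d, OF assms(6,7,5) m(2)])
  have word: "xL r (word_i r m d) (coord_list r m d Y) = ?g"
    by (rule xL_word_eq_suffix_prod) (use assms m(1) in auto)
  have "DeltaL r ((m' - 1) * r + d) (word_i r m d) (coord_list r m d Y) = gen_minor r (word_i r m' d) d ?g"
    unfolding DeltaL_def Delta_def take_word_i[OF assms(1,2,4,5)] word ..
  also have "\<dots> = minor (vrep r ?g) ?e ?s"
    by (rule gen_minor_eq_minor[OF w assms(4,5) _ _ minor_end_tuple[OF assms(1) m' assms(4,5)] g])
       (use e in \<open>auto simp: sorted_tuples_def\<close>)
  also have "\<dots> = transfer (sorted_tuples (letters r) d)
       (\<lambda>s a b. if admissible_edge r a b then edge_label r Y (m - s) a b else 0) ?s m ?e"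
    using minor_suffix_prod[where Y = Y and m = m and r = r and d = d, OF assms(6,7,5) m(2) e] unfolding m(3) .
  also have "\<dots> = (\<Sum>p\<in>paths r d m m'. path_label r m Y p)"
    by (rule sum_paths_eq_transfer[OF s e, symmetric])
  finally show ?thesis .
qed

end
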